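(* There is an absolute constant $C>0$ such that for every odd prime $p$ and every positive integer $k$ with $$ k\le p^{1/(8\sqrt{e})}\exp\Big(\tfrac12\sqrt{e^{-1}\log p\,\log\log p}-\tfrac12\log\log p\Big), $$ the $k$-th smallest positive quadratic nonresidue $n_k(p)$ modulo $p$ satisfies $$ n_k(p)\le C\, p^{1/(4\sqrt{e})}\exp\Big(\sqrt{e^{-1}\log p\,\log\log p}\,\Big). $$
   Context: For an odd prime $p$, $(\cdot|p)$ denotes the Legendre symbol, and $n_1(p)<n_2(p)<\cdots$ denotes the increasing sequence of all positive integers $n$ with $(n|p)=-1$ (the positive quadratic nonresidues modulo $p$). *)

theory Defs
  imports Complex_Main "HOL-Library.Infinite_Set" "HOL-Number_Theory.Number_Theory"
begin

definition nonresidues :: "nat \<Rightarrow> nat set" where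
  "nonresidues p = {n. n > 0 \<and> Legendre (int n) (int p) = -1}"

text \<open>
  The library's \<open>enumerate\<close> counts from 0, so the first nonresidue is \<open>nth_nonresidue p 1\<close>.
  Only \<open>k \<ge> 1\<close> is meaningful.
\<close>
definition nth_nonresidue :: "nat \<Rightarrow> nat \<Rightarrow> nat" where
  "nth_nonresidue p k = enumerate (nonresidues p) (k - 1)"

lemma infinite_nonresidues:
  assumes "prime p" "odd p"
  shows "infinite (nonresidues p)"
proof -
  have p2: "p > 2" using assms by (metis prime_ge_2_nat le_neq_implies_less even_numeral)
  define f where "f = (\<lambda>x. x ^ 2 mod p)"
  have sub: "f ` {1..<p} \<subseteq> {1..<p}"
  proof
    fix y assume "y \<in> f ` {1..<p}"
    then obtain x where x: "x \<in> {1..<p}" "y = x ^ 2 mod p" by (auto simp: f_def)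
    have "\<not> p dvd x" using x by (auto dest: dvd_imp_le)
    hence "\<not> p dvd x ^ 2" using assms(1) prime_dvd_power_nat by blast
    hence "y \<noteq> 0" using x by (auto simp: dvd_eq_mod_eq_0)
    moreover have "y < p" using x p2 by simp
    ultimately show "y \<in> {1..<p}" by simp
  qed
  have "f (p - 1) = f 1"
  proof -
    have "(p - 1) ^ 2 = 1 + p * (p - 2)" using p2
      by (cases p; cases "p - 1") (auto simp: power2_eq_square algebra_simps)
    thus ?thesis by (simp only: f_def mod_mult_self2) simp
  qed
  hence "\<not> inj_on f {1..<p}" 
    using p2 inj_on_eq_iff[of f "{1..<p}" "p - 1" 1] by fastforce
  hence "f ` {1..<p} \<noteq> {1..<p}" by (metis eq_card_imp_inj_on finite_atLeastLessThan)
  then obtain a where a: "a \<in> {1..<p}" "a \<notin> f ` {1..<p}" using sub by blast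
  have nq: "\<not> QuadRes (int p) (int a)"
  proof
    assume "QuadRes (int p) (int a)"
    then obtain y where y: "[y ^ 2 = int a] (mod int p)" by (auto simp: QuadRes_def)
    define x where "x = nat (y mod int p)"
    have xi: "int x = y mod int p" using p2 by (simp add: x_def)
    have "int (x ^ 2 mod p) = y ^ 2 mod int p" by (simp add: zmod_int xi power_mod)
    also have "\<dots> = int a" using y a by (simp add: cong_def)
    finally have fx: "f x = a" by (simp add: f_def)
    have "int x < int p" unfolding xi using p2 by simp
    hence "x < p" by simp
    moreover have "x \<noteq> 0" using fx a by (auto simp: f_def)
    ultimately show False using fx a by force
  qed
  have "a + p * m \<in> nonresidues p" for m
  proof -
    have c: "[int (a + p * m) = int a] (mod int p)" by (simp add: cong_def)
    have "\<not> [int a = 0] (mod int p)" using a by (simp add: cong_def)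
    hence "Legendre (int (a + p * m)) (int p) = -1"
      using nq c unfolding Legendre_def QuadRes_def by (metis cong_sym cong_trans)
    thus ?thesis using a by (simp add: nonresidues_def)
  qed
  hence "range (\<lambda>m. a + p * m) \<subseteq> nonresidues p" by blast
  moreover have "inj (\<lambda>m. a + p * m)" using p2 by (auto simp: inj_on_def)
  hence "infinite (range (\<lambda>m. a + p * m))" by (simp add: range_inj_infinite)
  ultimately show ?thesis using finite_subset by blast
qed

end

theory Submission
  imports Defs "HOL-Computational_Algebra.Polynomial" "HOL-Library.Discrete_Functions" "HOL-Analysis.Convex"
    "HOL-Real_Asymp.Real_Asymp"
begin

text \<open>
  Put \<open>L = ln p\<close>, \<open>X = p powr (1 / (4 \<surd>e)) * exp (\<surd>(L ln L / e))\<close> and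
  \<open>h = X powr \<surd>e = p powr (1/4) * exp (\<surd>(L ln L))\<close>.

  Stepanov's method bounds complete sums of Legendre symbols of products of linear factors by
  \<open>O(degree * \<surd>p)\<close>. Since the degree enters only linearly, Burgess' method may be run with
  moments of order \<open>2 r\<close> for \<open>r\<close> close to \<open>\<surd>(L / ln L) / 2\<close>, which is the choice that makes the sum
  of the symbols up to \<open>h\<close> at most \<open>O(h / L)\<close>. So \<open>h / 2 - O(h / L)\<close> integers up to \<open>h\<close> are nonresidues.

  Every nonresidue has a prime factor that is a nonresidue. If fewer than \<open>k\<close> nonresidues are at
  most \<open>x = C X\<close>, then each nonresidue up to \<open>x\<close> exceeds \<open>x / (2 k)\<close>, so for \<open>k\<^sup>2 \<le> X / L\<close> the
  multiples of those below \<open>x\<close> contribute only \<open>O(h / L)\<close>; the multiples of primes between \<open>x\<close> and \<open>h\<close>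
  contribute at most \<open>h * ln (ln h / ln x) + O(h / L) \<le> h / 2 - c h ln C / L + O(h / L)\<close> by Mertens.
  For large \<open>C\<close> this is a contradiction.
\<close>

section \<open>Integer polynomials modulo a prime\<close>

text \<open>The reciprocals of the primes between \<open>X\<close> and \<open>h\<close> sum to about
  \<open>ln (ln h / ln X)\<close>, which is exactly \<open>1/2\<close> because
  \<open>h = X powr sqrt e\<close>. At \<open>x = X\<close> the main terms therefore cancel, and
  everything is decided at relative size \<open>1 / L\<close>: a factor \<open>C\<close> in
  \<open>x\<close> gains a multiple of \<open>ln C / L\<close>, so every error must be
  \<open>O(1 / L)\<close> with a constant independent of \<open>C\<close>. A Burgess bound that
  loses a small power of \<open>p\<close> would not do. With \<open>h = p^(1/4) exp E\<close> and
  \<open>s = 1 / r\<close>, the moment of order \<open>2 r\<close> saves the factor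
  \<open>exp (L s^2 / 4 - E s)\<close>, up to smaller terms. Its minimum over \<open>s\<close> is
  \<open>exp (- E^2 / L)\<close>, and a saving of \<open>1 / L\<close> then means
  \<open>E = sqrt (L ln L)\<close>. One obstacle shapes the character sum part: the nonvanishing
  argument in Stepanov's method rests on odd degree, while a moment of order \<open>2 r\<close>
  produces products of \<open>2 r\<close> linear factors. Inverting about a root of odd multiplicity
  repairs the parity.\<close>

lemma prime_elem_const_int_poly:
  assumes "prime (p::nat)"
  shows "prime_elem [:int p:]"
  using assms by (simp add: prime_elem_const_poly_iff)

text \<open>Congruence of polynomials modulo \<open>p\<close> is expressed throughout as
  divisibility by the constant polynomial \<open>[:int p:]\<close> among integer polynomials, so no
  residue field is built. Evaluation and differentiation respect it.\<close>

lemma const_poly_dvd_poly: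
  assumes "[:c:] dvd (F::int poly)"
  shows "c dvd poly F x"
  using assms by (auto elim!: dvdE)

lemma const_poly_dvd_pderiv:
  assumes "[:c:] dvd (F::int poly)"
  shows "[:c:] dvd pderiv F"
  using assms by (auto simp: const_poly_dvd_iff coeff_pderiv)

lemma const_poly_dvd_linear_remainder:
  assumes "c dvd poly (R::int poly) a"
  shows "\<exists>Q. [:c:] dvd R - [:-a, 1:] * Q"
proof -
  have "[:-a, 1:] dvd R - [:poly R a:]"
    by (subst poly_eq_0_iff_dvd [symmetric]) simp
  then obtain Q where Q: "R - [:poly R a:] = [:-a, 1:] * Q" by (elim dvdE)
  have "R - [:-a, 1:] * Q = [:poly R a:]" using Q by (simp add: algebra_simps)
  moreover have "[:c:] dvd [:poly R a:]" using assms by simp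
  ultimately show ?thesis by metis
qed

text \<open>\<open>[:int p:]\<close> is a prime element and a monic linear factor has content 1, so
  powers of it may be cancelled modulo \<open>p\<close>.\<close>

lemma const_poly_dvd_linear_power_mult_cancel:
  assumes "prime (p::nat)" and "[:int p:] dvd [:-a, 1:] ^ n * F"
  shows "[:int p:] dvd F"
proof -
  have "\<not> [:int p:] dvd [:-a, 1:]"
    using assms(1) by (simp add: const_poly_dvd_iff_dvd_content content_def prime_nat_iff)
  hence "\<not> [:int p:] dvd [:-a, 1:] ^ n"
    using prime_elem_dvd_power prime_elem_const_int_poly[OF assms(1)] by blast
  thus ?thesis using assms(2) prime_elem_dvd_multD prime_elem_const_int_poly[OF assms(1)] by blast
qed

text \<open>The induction is applied to \<open>R\<close> and to its derivative. For
  \<open>m > 0\<close>, differentiating \<open>R = (x - a)^m Q\<close> modulo \<open>p\<close> and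
  cancelling \<open>(x - a)^(m - 1)\<close> leaves \<open>m Q(a) = 0\<close> modulo
  \<open>p\<close>, because the derivative is itself divisible by \<open>(x - a)^m\<close>. The
  bound by \<open>p\<close> makes \<open>m\<close> invertible.\<close>

lemma vanishing_order_mod_prime:
  fixes R :: "int poly"
  assumes p: "prime (p::nat)"
  shows "m \<le> p \<Longrightarrow> (\<And>k. k < m \<Longrightarrow> int p dvd poly ((pderiv ^^ k) R) a) \<Longrightarrow>
    \<exists>Q. [:int p:] dvd R - [:-a, 1:] ^ m * Q"
proof (induction m arbitrary: R)
  case 0
  show ?case by (intro exI[of _ R]) simp
next
  case (Suc m)
  let ?l = "[:-a, 1:] :: int poly" and ?P = "[:int p:]"
  obtain Q where Q: "?P dvd R - ?l ^ m * Q" using Suc.IH[of R] Suc.prems by auto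
  have "int p dvd poly Q a"
  proof (cases m)
    case 0
    thus ?thesis using const_poly_dvd_poly[OF Q, of a] Suc.prems(2)[of 0]
      by (simp add: dvd_diff_right_iff)
  next
    case (Suc n)
    have "\<And>k. k < m \<Longrightarrow> int p dvd poly ((pderiv ^^ k) (pderiv R)) a"
      using Suc.prems(2)[of "Suc _"] by (auto simp: funpow_Suc_right simp del: funpow.simps)
    then obtain Q2 where Q2: "?P dvd pderiv R - ?l ^ m * Q2"
      using Suc.IH[of "pderiv R"] Suc.prems(1) by auto
    have d: "pderiv (?l ^ m * Q) = ?l ^ n * (smult (int m) Q + ?l * pderiv Q)"
    proof -
      define l where "l = ?l"
      have "pderiv l = 1" by (simp add: l_def pderiv_pCons)
      hence "pderiv (l ^ m * Q) = l ^ n * (smult (int m) Q + l * pderiv Q)"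
        unfolding Suc pderiv_mult pderiv_power_Suc by (simp add: algebra_simps)
      thus ?thesis unfolding l_def .
    qed
    have "?P dvd (pderiv R - ?l ^ m * Q2) - pderiv (R - ?l ^ m * Q)"
      using Q2 const_poly_dvd_pderiv[OF Q] by (rule dvd_diff)
    also have "\<dots> = ?l ^ n * ((smult (int m) Q + ?l * pderiv Q) - ?l * Q2)"
      unfolding pderiv_diff d by (simp add: Suc algebra_simps)
    finally have "?P dvd (smult (int m) Q + ?l * pderiv Q) - ?l * Q2"
      by (rule const_poly_dvd_linear_power_mult_cancel[OF p])
    from const_poly_dvd_poly[OF this, of a] have "int p dvd int m * poly Q a" by simp
    moreover have "\<not> int p dvd int m" using Suc.prems(1) Suc by (auto dest: zdvd_imp_le)
    ultimately show ?thesis using p by (simp add: prime_dvd_mult_iff)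
  qed
  then obtain Q3 where "?P dvd Q - ?l * Q3" using const_poly_dvd_linear_remainder by blast
  hence "?P dvd (R - ?l ^ m * Q) + ?l ^ m * (Q - ?l * Q3)" using Q by (intro dvd_add dvd_mult)
  also have "\<dots> = R - ?l ^ Suc m * Q3" by (simp add: algebra_simps)
  finally show ?case by blast
qed

text \<open>Stands in for the coprimality of \<open>M\<close> and \<open>(x - a)^m\<close> modulo
  \<open>p\<close>: factors \<open>x - a\<close> are moved from the product to \<open>Q\<close> one
  at a time.\<close>

lemma linear_power_cancel_mod_prime:
  assumes p: "prime (p::nat)" and M: "\<not> int p dvd poly M a"
  shows "[:int p:] dvd M * Q - [:-a, 1:] ^ m * Q2 \<Longrightarrow> \<exists>Q3. [:int p:] dvd Q - [:-a, 1:] ^ m * Q3"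
proof (induction m arbitrary: Q2)
  case 0
  show ?case by (intro exI[of _ Q]) simp
next
  case (Suc m)
  let ?l = "[:-a, 1:] :: int poly" and ?P = "[:int p:]"
  have "?P dvd M * Q - ?l ^ m * (?l * Q2)" using Suc.prems unfolding power_Suc2 mult.assoc .
  from Suc.IH[OF this] obtain Q3 where Q3: "?P dvd Q - ?l ^ m * Q3" by blast
  have "?P dvd (M * Q - ?l ^ Suc m * Q2) - M * (Q - ?l ^ m * Q3)"
    by (rule dvd_diff[OF Suc.prems dvd_mult[OF Q3]])
  also have "\<dots> = ?l ^ m * (M * Q3 - ?l * Q2)" by (simp add: algebra_simps)
  finally have "?P dvd M * Q3 - ?l * Q2" by (rule const_poly_dvd_linear_power_mult_cancel[OF p])
  from const_poly_dvd_poly[OF this, of a] have "int p dvd poly Q3 a"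
    using p M by (simp add: prime_dvd_mult_iff)
  then obtain Q4 where "?P dvd Q3 - ?l * Q4" using const_poly_dvd_linear_remainder by blast
  hence "?P dvd (Q - ?l ^ m * Q3) + ?l ^ m * (Q3 - ?l * Q4)" using Q3 by (intro dvd_add dvd_mult)
  also have "\<dots> = Q - ?l ^ Suc m * Q4" by (simp add: algebra_simps)
  finally show ?case by blast
qed

lemma linear_powers_prod_mod_prime:
  assumes p: "prime (p::nat)" and "finite A"
    and "\<And>a b. a \<in> A \<Longrightarrow> b \<in> A \<Longrightarrow> a \<noteq> b \<Longrightarrow> \<not> int p dvd a - b"
    and "\<And>a. a \<in> A \<Longrightarrow> \<exists>Q. [:int p:] dvd R - [:-a, 1:] ^ m * Q"
  shows "\<exists>Q. [:int p:] dvd R - (\<Prod>a\<in>A. [:-a, 1:] ^ m) * Q"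
  using assms(2-)
proof (induction A rule: finite_induct)
  case empty
  show ?case by (intro exI[of _ R]) simp
next
  case (insert a A)
  let ?M = "\<Prod>a\<in>A. [:-a, 1:] ^ m :: int poly"
  obtain Q where Q: "[:int p:] dvd R - ?M * Q"
    using insert.IH insert.prems by auto
  obtain Q2 where Q2: "[:int p:] dvd R - [:-a, 1:] ^ m * Q2" using insert.prems(2)[of a] by auto
  have "\<not> int p dvd poly ?M a"
  proof
    assume "int p dvd poly ?M a"
    hence "int p dvd (\<Prod>b\<in>A. (a - b) ^ m)" by (simp add: poly_prod)
    then obtain b where "b \<in> A" "int p dvd (a - b) ^ m"
      using p insert.hyps(1) by (auto simp: prime_dvd_prod_iff)
    hence "int p dvd a - b" using p by (metis prime_dvd_power prime_int_nat_transfer nat_int of_nat_0_le_iff)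
    thus False using insert.prems(1)[of a b] insert.hyps \<open>b \<in> A\<close> by auto
  qed
  moreover have "[:int p:] dvd ?M * Q - [:-a, 1:] ^ m * Q2"
    using dvd_diff[OF Q2 Q] by (simp add: algebra_simps)
  ultimately obtain Q3 where Q3: "[:int p:] dvd Q - [:-a, 1:] ^ m * Q3"
    using linear_power_cancel_mod_prime[OF p] by blast
  have "[:int p:] dvd (R - ?M * Q) + ?M * (Q - [:-a, 1:] ^ m * Q3)"
    using Q Q3 by (intro dvd_add dvd_mult)
  also have "\<dots> = R - (\<Prod>a\<in>insert a A. [:-a, 1:] ^ m) * Q3"
    using insert.hyps by (simp add: algebra_simps)
  finally show ?case by blast
qed

text \<open>For the reduced representative the integer degree is the degree modulo \<open>p\<close>.
  Comparing degrees would fail if a leading coefficient could be divisible by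
  \<open>p\<close>.\<close>

lemma reduce_poly_mod_prime:
  assumes "prime (p::nat)"
  obtains Q' :: "int poly" where "[:int p:] dvd Q - Q'" "Q' = 0 \<or> \<not> int p dvd lead_coeff Q'"
proof
  let ?Q = "map_poly (\<lambda>c. c mod int p) Q"
  show "[:int p:] dvd Q - ?Q"
    by (simp add: const_poly_dvd_iff coeff_map_poly mod_eq_dvd_iff [symmetric])
  show "?Q = 0 \<or> \<not> int p dvd lead_coeff ?Q"
  proof (cases "?Q = 0")
    case False
    hence "lead_coeff ?Q \<noteq> 0" by simp
    moreover have "lead_coeff ?Q = coeff Q (degree ?Q) mod int p" by (simp add: coeff_map_poly)
    ultimately show ?thesis by (metis dvd_imp_mod_0 mod_mod_trivial)
  qed simp
qed

lemma degree_ge_of_monic_dvd_mod_prime: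
  assumes p: "prime (p::nat)" and "lead_coeff M = 1" and R: "[:int p:] dvd R - M * Q"
    and nR: "\<not> [:int p:] dvd R"
  shows "degree M \<le> degree R"
proof -
  obtain Q' where Q': "[:int p:] dvd Q - Q'" "Q' = 0 \<or> \<not> int p dvd lead_coeff Q'"
    using reduce_poly_mod_prime[OF p] .
  have "[:int p:] dvd (R - M * Q) + M * (Q - Q')" using R Q' by (intro dvd_add dvd_mult)
  hence R': "[:int p:] dvd R - M * Q'" by (simp add: algebra_simps)
  have "Q' \<noteq> 0" using R' nR by auto
  have "coeff (M * Q') (degree M + degree Q') = lead_coeff Q'"
    using assms(2) by (simp add: coeff_mult_degree_sum)
  moreover have "int p dvd coeff R (degree M + degree Q') - coeff (M * Q') (degree M + degree Q')"
    using R' by (auto simp: const_poly_dvd_iff simp flip: coeff_diff)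
  ultimately have "coeff R (degree M + degree Q') \<noteq> 0"
    using Q'(2) \<open>Q' \<noteq> 0\<close> by (auto simp: dvd_diff_right_iff)
  hence "degree M + degree Q' \<le> degree R" by (rule le_degree)
  thus ?thesis by simp
qed

text \<open>The product of all \<open>(x - a)^m\<close> divides \<open>R\<close> modulo
  \<open>p\<close> and, being monic, keeps its degree after reduction. Stepanov's method applies
  this to an \<open>R\<close> whose degree is little more than \<open>m p / 2\<close>.\<close>

lemma card_zeros_mod_prime_le:
  fixes R :: "int poly"
  assumes p: "prime (p::nat)" and nR: "\<not> [:int p:] dvd R" and A: "finite A"
    and dist: "\<And>a b. a \<in> A \<Longrightarrow> b \<in> A \<Longrightarrow> a \<noteq> b \<Longrightarrow> \<not> int p dvd a - b"
    and m: "m \<le> p"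
    and van: "\<And>a k. a \<in> A \<Longrightarrow> k < m \<Longrightarrow> int p dvd poly ((pderiv ^^ k) R) a"
  shows "m * card A \<le> degree R"
proof -
  let ?M = "\<Prod>a\<in>A. [:-a, 1:] ^ m :: int poly"
  obtain Q where "[:int p:] dvd R - ?M * Q"
    using linear_powers_prod_mod_prime[OF p A dist] vanishing_order_mod_prime[OF p m] van by metis
  moreover have "lead_coeff ?M = 1" by (simp add: lead_coeff_prod lead_coeff_power)
  ultimately have "degree ?M \<le> degree R" using degree_ge_of_monic_dvd_mod_prime[OF p] nR by blast
  moreover have "degree ?M = m * card A"
    by (subst degree_prod_eq_sum_degree) (auto simp: degree_linear_power)
  ultimately show ?thesis by simp
qed


section \<open>Stepanov's auxiliary polynomial\<close>

text \<open>
  Modulo \<open>p\<close> the \<open>k\<close>-th derivative of \<open>f ^ c * Q * x ^ (j * p)\<close> is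
  \<open>f ^ (c - k) * stepanov_op f c k Q * x ^ (j * p)\<close>, because \<open>x ^ p\<close> has derivative 0.
\<close>

fun stepanov_op :: "int poly \<Rightarrow> nat \<Rightarrow> nat \<Rightarrow> int poly \<Rightarrow> int poly" where
  "stepanov_op f c 0 Q = Q"
| "stepanov_op f c (Suc k) Q =
     smult (int c - int k) (pderiv f * stepanov_op f c k Q) + f * pderiv (stepanov_op f c k Q)"

lemma stepanov_op_diff:
  "stepanov_op f c k (Q1 - Q2) = stepanov_op f c k Q1 - stepanov_op f c k Q2"
  by (induction k) (simp_all add: pderiv_diff right_diff_distrib smult_diff_right)

lemma degree_stepanov_op: "degree (stepanov_op f c k Q) \<le> degree Q + k * degree f"
proof (induction k)
  case (Suc k)
  let ?T = "stepanov_op f c k Q"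
  have "degree (smult (int c - int k) (pderiv f * ?T)) \<le> degree (pderiv f * ?T)"
    by (rule degree_smult_le)
  also have "\<dots> \<le> degree f + degree ?T"
    using degree_mult_le[of "pderiv f" ?T] by (simp add: degree_pderiv)
  finally have 1: "degree (smult (int c - int k) (pderiv f * ?T)) \<le> degree f + degree ?T" .
  have 2: "degree (f * pderiv ?T) \<le> degree f + degree ?T"
    using degree_mult_le[of f "pderiv ?T"] by (simp add: degree_pderiv)
  show ?case using degree_add_le[OF 1 2] Suc.IH by simp
qed simp

lemma higher_pderiv_stepanov:
  fixes f Q :: "int poly"
  assumes "k \<le> c"
  shows "[:int p:] dvd (pderiv ^^ k) (f ^ c * Q * [:0, 1:] ^ (j * p))
           - f ^ (c - k) * stepanov_op f c k Q * [:0, 1:] ^ (j * p)"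
  using assms
proof (induction k)
  case (Suc k)
  let ?P = "[:int p:]" and ?T = "stepanov_op f c k Q" and ?Y = "[:0, 1:] ^ (j * p) :: int poly"
  define n where "n = c - Suc k"
  have ck: "c - k = Suc n" "int c - int k = int (Suc n)" using Suc.prems by (auto simp: n_def)
  have Y: "?P dvd pderiv ?Y"
  proof (cases "j * p")
    case (Suc i)
    have "pderiv ?Y = smult (int (j * p)) ([:0, 1:] ^ i)"
      unfolding Suc by (subst pderiv_power_Suc) (simp add: pderiv_pCons)
    thus ?thesis by (auto simp: const_poly_dvd_iff)
  next
    case 0
    show ?thesis unfolding 0 by simp
  qed
  have eq: "pderiv (f ^ Suc n * ?T * ?Y)
      = f ^ n * stepanov_op f c (Suc k) Q * ?Y + f ^ Suc n * ?T * pderiv ?Y"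
  proof -
    define Y where "Y = ?Y"
    show ?thesis unfolding Y_def[symmetric]
      unfolding pderiv_mult pderiv_power_Suc stepanov_op.simps ck
      by (simp add: algebra_simps)
  qed
  have "?P dvd pderiv ((pderiv ^^ k) (f ^ c * Q * ?Y) - f ^ (c - k) * ?T * ?Y)"
    using Suc by (intro const_poly_dvd_pderiv) auto
  hence "?P dvd (pderiv ^^ Suc k) (f ^ c * Q * ?Y) - pderiv (f ^ Suc n * ?T * ?Y)"
    unfolding pderiv_diff ck by simp
  from dvd_add[OF this dvd_mult[OF Y]]
  have "?P dvd (pderiv ^^ Suc k) (f ^ c * Q * ?Y) - pderiv (f ^ Suc n * ?T * ?Y) + f ^ Suc n * ?T * pderiv ?Y" .
  hence "?P dvd (pderiv ^^ Suc k) (f ^ c * Q * ?Y)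
      - (f ^ n * stepanov_op f c (Suc k) Q * ?Y + f ^ Suc n * ?T * pderiv ?Y) + f ^ Suc n * ?T * pderiv ?Y"
    unfolding eq .
  moreover have cancel: "b - (u + t) + t = b - u" for b u t :: "int poly" by simp
  ultimately show ?case unfolding cancel n_def by blast
qed simp

text \<open>
  The auxiliary polynomial below is meant to vanish to order \<open>m\<close> at every \<open>x\<close> with
  \<open>f(x) ^ h \<equiv> a\<close>, where \<open>h = (p - 1) / 2\<close>. At such points \<open>x ^ p \<equiv> x\<close> turns its \<open>k\<close>-th derivative
  into \<open>f(x) ^ (m - k)\<close> times the value of \<open>stepanov_sum\<close>, a polynomial of low degree, so its vanishing
  modulo \<open>p\<close> costs few linear conditions on \<open>A\<close> and \<open>B\<close>.
\<close>

definition stepanov_sum ::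
  "int poly \<Rightarrow> nat \<Rightarrow> nat \<Rightarrow> int \<Rightarrow> nat \<Rightarrow> (nat \<Rightarrow> int poly) \<Rightarrow> (nat \<Rightarrow> int poly) \<Rightarrow> nat \<Rightarrow> int poly" where
  "stepanov_sum f m h a J A B k =
     (\<Sum>j<J. (stepanov_op f m k (A j) + smult a (stepanov_op f (m + h) k (B j))) * [:0, 1:] ^ j)"

definition stepanov_poly ::
  "int poly \<Rightarrow> nat \<Rightarrow> nat \<Rightarrow> nat \<Rightarrow> nat \<Rightarrow> (nat \<Rightarrow> int poly) \<Rightarrow> (nat \<Rightarrow> int poly) \<Rightarrow> int poly" where
  "stepanov_poly f p m h J A B =
     (\<Sum>j<J. f ^ m * A j * [:0, 1:] ^ (j * p) + f ^ (m + h) * B j * [:0, 1:] ^ (j * p))"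

lemma fermat_int:
  assumes "prime (p::nat)"
  shows "[(x::int) ^ p = x] (mod int p)"
proof (cases "int p dvd x")
  case True
  hence "int p dvd x ^ p" using assms prime_gt_0_nat[OF assms] by (auto intro: dvd_power_le dvd_trans dvd_power)
  thus ?thesis using True by (simp add: Cong.cong_def dvd_eq_mod_eq_0)
next
  case False
  define y where "y = nat (x mod int p)"
  have y: "[x = int y] (mod int p)" using prime_gt_0_nat[OF assms] by (simp add: y_def)
  have "\<not> p dvd y" using False y by (metis cong_dvd_iff int_dvd_int_iff)
  from fermat_theorem[OF assms this] have "[int y ^ (p - 1) = 1] (mod int p)"
    by (metis cong_int_iff of_nat_1 of_nat_power)
  hence "[int y * int y ^ (p - 1) = int y * 1] (mod int p)" by (rule cong_scalar_left)
  hence "[int y ^ p = int y] (mod int p)" using prime_gt_0_nat[OF assms]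
    by (simp add: power_eq_if)
  thus ?thesis using y by (meson cong_pow cong_sym cong_trans)
qed

lemma poly_higher_pderiv_stepanov_poly:
  assumes p: "prime (p::nat)" and k: "k < m"
    and dv: "[:int p:] dvd stepanov_sum f m h a J A B k"
    and x: "[poly f x ^ h = a] (mod int p) \<or> int p dvd poly f x"
  shows "int p dvd poly ((pderiv ^^ k) (stepanov_poly f p m h J A B)) x"
proof -
  let ?y = "poly f x"
  let ?S = "\<lambda>j. stepanov_op f m k (A j)" and ?T = "\<lambda>j. stepanov_op f (m + h) k (B j)"
  have pw: "[x ^ (j * p) = x ^ j] (mod int p)" for j
    using cong_pow[OF fermat_int[OF p, of x], of j] by (simp add: power_mult [symmetric] mult.commute)
  have 1: "[poly ((pderiv ^^ k) (f ^ m * A j * [:0, 1:] ^ (j * p))) x = ?y ^ (m - k) * (poly (?S j) x * x ^ j)] (mod int p)" for j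
  proof -
    have "[poly ((pderiv ^^ k) (f ^ m * A j * [:0, 1:] ^ (j * p))) x
        = ?y ^ (m - k) * poly (?S j) x * x ^ (j * p)] (mod int p)"
      using const_poly_dvd_poly[OF higher_pderiv_stepanov[of k m p f "A j" j], of x] k
      by (simp add: cong_iff_dvd_diff poly_power)
    also have "[?y ^ (m - k) * poly (?S j) x * x ^ (j * p) = ?y ^ (m - k) * poly (?S j) x * x ^ j] (mod int p)"
      by (intro cong_scalar_left pw)
    finally show ?thesis by (simp add: mult.assoc)
  qed
  have 2: "[poly ((pderiv ^^ k) (f ^ (m + h) * B j * [:0, 1:] ^ (j * p))) x
       = ?y ^ (m - k) * (a * poly (?T j) x * x ^ j)] (mod int p)" for j
  proof -
    have e: "?y ^ (m + h - k) = ?y ^ (m - k) * ?y ^ h" using k by (simp flip: power_add)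
    have "[poly ((pderiv ^^ k) (f ^ (m + h) * B j * [:0, 1:] ^ (j * p))) x
        = (?y ^ (m - k) * ?y ^ h) * (poly (?T j) x * x ^ (j * p))] (mod int p)"
      using const_poly_dvd_poly[OF higher_pderiv_stepanov[of k "m + h" p f "B j" j], of x] k
      by (simp add: cong_iff_dvd_diff poly_power e mult.assoc)
    also have "[(?y ^ (m - k) * ?y ^ h) * (poly (?T j) x * x ^ (j * p))
        = (?y ^ (m - k) * a) * (poly (?T j) x * x ^ j)] (mod int p)"
    proof (rule cong_mult)
      show "[poly (?T j) x * x ^ (j * p) = poly (?T j) x * x ^ j] (mod int p)"
        by (intro cong_scalar_left pw)
      show "[?y ^ (m - k) * ?y ^ h = ?y ^ (m - k) * a] (mod int p)"
        using x
      proof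
        \<comment> \<open>Zeros of \<open>f\<close> are counted too: since \<open>k < m\<close>, the
          remaining factor \<open>f(x) ^ (m - k)\<close> vanishes there and both sides are
          0.\<close>
        assume "int p dvd ?y"
        hence "int p dvd ?y ^ (m - k)" using k by (intro dvd_trans[OF _ dvd_power]) auto
        thus ?thesis by (simp add: cong_iff_dvd_diff)
      qed (rule cong_scalar_left)
    qed
    finally show ?thesis by (simp add: mult.assoc)
  qed
  have e1: "poly ((pderiv ^^ k) (stepanov_poly f p m h J A B)) x
      = (\<Sum>j<J. poly ((pderiv ^^ k) (f ^ m * A j * [:0, 1:] ^ (j * p))) x
             + poly ((pderiv ^^ k) (f ^ (m + h) * B j * [:0, 1:] ^ (j * p))) x)"
    unfolding stepanov_poly_def by (simp add: higher_pderiv_sum higher_pderiv_add poly_sum)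
  have e2: "(\<Sum>j<J. ?y ^ (m - k) * (poly (?S j) x * x ^ j) + ?y ^ (m - k) * (a * poly (?T j) x * x ^ j))
      = ?y ^ (m - k) * poly (stepanov_sum f m h a J A B k) x"
    by (simp add: stepanov_sum_def poly_sum poly_power sum_distrib_left distrib_left distrib_right mult.assoc)
  have "[poly ((pderiv ^^ k) (stepanov_poly f p m h J A B)) x
      = ?y ^ (m - k) * poly (stepanov_sum f m h a J A B k) x] (mod int p)"
    unfolding e1 e2[symmetric] by (intro cong_sum cong_add 1 2)
  moreover have "int p dvd ?y ^ (m - k) * poly (stepanov_sum f m h a J A B k) x"
    using const_poly_dvd_poly[OF dv, of x] by simp
  ultimately show ?thesis by (simp add: cong_dvd_iff)
qed

text \<open>Pigeonhole in place of linear algebra over a field: there are \<open>2 * J * D\<close>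
  free coefficients modulo \<open>p\<close>, while each of the \<open>m\<close> polynomials to be
  annihilated has at most \<open>D + m * degree f + J\<close> coefficients. Two choices thus have
  the same image, and their difference is a solution.\<close>

lemma stepanov_coefficients_exist:
  assumes p: "prime (p::nat)" and less: "m * (D + m * degree f + J) < 2 * J * D"
  obtains A B :: "nat \<Rightarrow> int poly"
  where "\<And>j. degree (A j) < D" "\<And>j. degree (B j) < D"
    "\<And>k. k < m \<Longrightarrow> [:int p:] dvd stepanov_sum f m h a J A B k"
    "\<exists>j<J. \<not> [:int p:] dvd A j \<or> \<not> [:int p:] dvd B j"
proof -
  define E where "E = D + m * degree f + J"
  define I where "I = (UNIV :: bool set) \<times> {..<J} \<times> {..<D}"
  define U where "U = (\<Pi>\<^sub>E i\<in>I. {0..<int p})"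
  define V where "V = (\<Pi>\<^sub>E i\<in>{..<m} \<times> {..<E}. {0..<int p})"
  define pol where "pol = (\<lambda>(u :: bool \<times> nat \<times> nat \<Rightarrow> int) s j. \<Sum>i<D. monom (u (s, j, i)) i)"
  define \<sigma> where "\<sigma> = (\<lambda>u. stepanov_sum f m h a J (pol u True) (pol u False))"
  define \<Phi> where "\<Phi> = (\<lambda>u. restrict (\<lambda>(k, i). coeff (\<sigma> u k) i mod int p) ({..<m} \<times> {..<E}))"
  have p1: "p > 1" using p by (rule prime_gt_1_nat)
  have D0: "D > 0" "J > 0" using less by (auto intro: Nat.gr0I)
  have finI: "finite I" by (simp add: I_def)
  have cI: "card I = 2 * J * D" by (simp add: I_def card_cartesian_product)
  have cardU: "card U = p ^ (2 * J * D)" unfolding U_def using finI by (simp add: card_PiE cI)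
  have cardV: "card V = p ^ (m * E)" unfolding V_def by (simp add: card_PiE card_cartesian_product)
  have "finite V" unfolding V_def by (intro finite_PiE) auto
  have "\<Phi> ` U \<subseteq> V" using p1 unfolding \<Phi>_def V_def by (intro image_subsetI) (simp add: restrict_PiE_iff split: prod.split)
  hence "card (\<Phi> ` U) \<le> card V" using \<open>finite V\<close> by (rule card_mono[rotated])
  also have "\<dots> < card U" unfolding cardU cardV using less p1 by (simp add: E_def power_strict_increasing)
  finally have "\<not> inj_on \<Phi> U" by (rule pigeonhole)
  then obtain u v where uv: "u \<in> U" "v \<in> U" "u \<noteq> v" "\<Phi> u = \<Phi> v" by (auto simp: inj_on_def)
  define w where "w = (\<lambda>i. u i - v i)"
  have coeff_pol: "coeff (pol t s j) i = (if i < D then t (s, j, i) else 0)" for t s j i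
    by (simp add: pol_def coeff_sum)
  have degpol: "degree (pol t s j) < D" for t s j
  proof -
    have "degree (pol t s j) \<le> D - 1" by (rule degree_le) (auto simp: coeff_pol)
    thus ?thesis using D0 by simp
  qed
  have polw: "pol w s j = pol u s j - pol v s j" for s j
    by (rule poly_eqI) (simp add: coeff_pol w_def)
  have \<sigma>w: "\<sigma> w k = \<sigma> u k - \<sigma> v k" for k
    by (simp add: \<sigma>_def stepanov_sum_def polw stepanov_op_diff sum_subtractf algebra_simps smult_diff_right)
  have dvd: "[:int p:] dvd \<sigma> w k" if "k < m" for k
    unfolding const_poly_dvd_iff
  proof
    fix i
    show "int p dvd coeff (\<sigma> w k) i"
    proof (cases "i < E")
      case True
      have "\<Phi> u (k, i) = \<Phi> v (k, i)" using uv by simp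
      hence "coeff (\<sigma> u k) i mod int p = coeff (\<sigma> v k) i mod int p"
        using True that by (simp add: \<Phi>_def)
      thus ?thesis by (simp add: \<sigma>w mod_eq_dvd_iff)
    next
      case False
      have "degree (\<sigma> w k) \<le> E - 1"
        unfolding \<sigma>_def stepanov_sum_def
      proof (rule degree_sum_le)
        fix j assume j: "j \<in> {..<J}"
        have km: "k * degree f \<le> m * degree f" using that by simp
        have "degree (stepanov_op f c k (pol w s j)) \<le> D - 1 + m * degree f" for c s
          using degree_stepanov_op[of f c k "pol w s j"] degpol[of w s j] km by linarith
        hence "degree (stepanov_op f m k (pol w True j) + smult a (stepanov_op f (m + h) k (pol w False j))) \<le> D - 1 + m * degree f"
          by (intro degree_add_le order.trans[OF degree_smult_le]) auto
        moreover have "degree ([:0, 1:] ^ j :: int poly) = j" by (simp add: degree_linear_power[of 0, simplified])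
        ultimately show "degree ((stepanov_op f m k (pol w True j) + smult a (stepanov_op f (m + h) k (pol w False j))) * [:0, 1:] ^ j) \<le> E - 1"
          using j D0 by (intro order.trans[OF degree_mult_le]) (auto simp: E_def)
      qed simp
      hence "degree (\<sigma> w k) < i" using False D0 by (auto simp: E_def)
      thus ?thesis by (simp add: coeff_eq_0)
    qed
  qed
  \<comment> \<open>Both choices have entries in \<open>{0..<int p}\<close>, so an entry in which
    they differ stays nonzero modulo \<open>p\<close>.\<close>
  obtain z where "z \<in> I" "u z \<noteq> v z"
    using uv unfolding U_def by (metis PiE_ext)
  then obtain s j i where sji: "j < J" "i < D" "u (s, j, i) \<noteq> v (s, j, i)" "(s, j, i) \<in> I" by (auto simp: I_def)
  have "u (s, j, i) \<in> {0..<int p}" "v (s, j, i) \<in> {0..<int p}"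
    using uv sji(4) unfolding U_def by (blast dest: PiE_mem)+
  hence "\<not> int p dvd coeff (pol w s j) i"
    using sji by (auto simp: coeff_pol w_def simp flip: mod_eq_dvd_iff)
  hence "\<not> [:int p:] dvd pol w s j" by (auto simp: const_poly_dvd_iff)
  hence "\<exists>j<J. \<not> [:int p:] dvd pol w True j \<or> \<not> [:int p:] dvd pol w False j"
    using sji(1) by (cases s) auto
  thus ?thesis using that[of "pol w True" "pol w False"] degpol dvd unfolding \<sigma>_def by blast
qed

text \<open>After reduction of \<open>A\<close> and \<open>B\<close>, the degree of
  \<open>f A^2\<close> modulo \<open>p\<close> is odd and that of \<open>B^2\<close> is even, so
  their leading terms cannot cancel unless both vanish.\<close>

lemma odd_degree_mult_square_mod_prime:
  assumes p: "prime (p::nat)" and odd: "odd (degree f)" and lc: "\<not> int p dvd lead_coeff f"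
    and dv: "[:int p:] dvd f * A ^ 2 - B ^ 2"
  shows "[:int p:] dvd A \<and> [:int p:] dvd B"
proof -
  note pe = prime_elem_const_int_poly[OF p]
  obtain A' where A': "[:int p:] dvd A - A'" "A' = 0 \<or> \<not> int p dvd lead_coeff A'"
    using reduce_poly_mod_prime[OF p] .
  obtain B' where B': "[:int p:] dvd B - B'" "B' = 0 \<or> \<not> int p dvd lead_coeff B'"
    using reduce_poly_mod_prime[OF p] .
  have f0: "f \<noteq> 0" using odd by auto
  have "[:int p:] dvd (f * A ^ 2 - B ^ 2) - f * (A + A') * (A - A') + (B + B') * (B - B')"
    by (rule dvd_add[OF dvd_diff[OF dv dvd_mult[OF A'(1)]] dvd_mult[OF B'(1)]])
  also have "\<dots> = f * A' ^ 2 - B' ^ 2" by (simp add: power2_eq_square algebra_simps)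
  finally have dv': "[:int p:] dvd f * A' ^ 2 - B' ^ 2" .
  hence cf: "int p dvd coeff (f * A' ^ 2) i - coeff (B' ^ 2) i" for i
    by (simp add: const_poly_dvd_iff)
  have lcsq: "\<not> int p dvd lead_coeff (G ^ 2)" if "\<not> int p dvd lead_coeff G" for G :: "int poly"
    using that p by (simp add: lead_coeff_power prime_dvd_power_iff)
  have "A' = 0"
  proof (rule ccontr)
    assume A0: "A' \<noteq> 0"
    have lcA: "\<not> int p dvd lead_coeff (f * A' ^ 2)"
      using A0 A'(2) lc lcsq[of A'] p by (simp add: lead_coeff_mult prime_dvd_mult_iff)
    have dA: "degree (f * A' ^ 2) = degree f + 2 * degree A'"
      using A0 f0 by (simp add: degree_mult_eq degree_power_eq)
    have B0: "B' \<noteq> 0"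
    proof
      assume "B' = 0"
      thus False using cf[of "degree (f * A' ^ 2)"] lcA by simp
    qed
    have lcB: "\<not> int p dvd lead_coeff (B' ^ 2)" using B0 B'(2) lcsq by blast
    have dB: "degree (B' ^ 2) = 2 * degree B'" using B0 by (simp add: degree_power_eq)
    have "degree (f * A' ^ 2) \<noteq> degree (B' ^ 2)" using odd unfolding dA dB by presburger
    then consider "degree (f * A' ^ 2) < degree (B' ^ 2)" | "degree (B' ^ 2) < degree (f * A' ^ 2)" by linarith
    thus False
    proof cases
      case 1
      thus False using cf[of "degree (B' ^ 2)"] lcB by (simp add: coeff_eq_0)
    next
      case 2
      thus False using cf[of "degree (f * A' ^ 2)"] lcA by (simp add: coeff_eq_0)
    qed
  qed
  hence "[:int p:] dvd B' ^ 2" using dv' by simp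
  hence "[:int p:] dvd B'" using pe prime_elem_dvd_power by blast
  thus ?thesis using A'(1) B'(1) \<open>A' = 0\<close> by (simp add: dvd_diff_left_iff)
qed

text \<open>
  The lowest nonvanishing block gives \<open>A + B f ^ h \<equiv> 0\<close> modulo \<open>p\<close> and \<open>x ^ p\<close>. Squaring,
  multiplying by \<open>f\<close> and using \<open>f ^ p \<equiv> 1\<close> yields \<open>f A\<^sup>2 \<equiv> B\<^sup>2\<close>, which holds
  modulo \<open>p\<close> alone by the degree bounds and contradicts the odd degree of \<open>f\<close>.
\<close>

lemma stepanov_nonvanishing:
  assumes p: "prime (p::nat)" and ph: "p = 2 * h + 1"
    and odd: "odd (degree f)" and lc: "\<not> int p dvd lead_coeff f"
    and frob: "[:int p:] dvd f ^ p - 1 - [:0, 1:] ^ p * U"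
    and degA: "\<And>j. degree (A j) < D" and degB: "\<And>j. degree (B j) < D"
    and D: "2 * D + degree f \<le> p + 1"
    and dv: "[:int p:] dvd (\<Sum>j<J. (A j + B j * f ^ h) * [:0, 1:] ^ (j * p))"
  shows "j < J \<Longrightarrow> [:int p:] dvd A j \<and> [:int p:] dvd B j"
proof (induction j rule: less_induct)
  case (less j)
  let ?P = "[:int p:]"
  define X where "X = ([:0, 1:] :: int poly)"
  define G where "G = (\<lambda>j. A j + B j * f ^ h)"
  define W where "W = (\<Sum>i\<in>{j<..<J}. G i * X ^ ((i - j - 1) * p))"
  have "{..<J} = {..<j} \<union> {j..<J}" using less.prems by auto
  hence "(\<Sum>i<J. G i * X ^ (i * p)) = (\<Sum>i<j. G i * X ^ (i * p)) + (\<Sum>i\<in>{j..<J}. G i * X ^ (i * p))"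
    by (simp add: sum.union_disjoint ivl_disj_int)
  moreover have "?P dvd (\<Sum>i<j. G i * X ^ (i * p))"
    using less by (intro dvd_sum) (auto simp: G_def intro!: dvd_mult2 dvd_add)
  moreover have "?P dvd (\<Sum>i<J. G i * X ^ (i * p))" using dv by (simp only: G_def X_def)
  ultimately have "?P dvd (\<Sum>i\<in>{j..<J}. G i * X ^ (i * p))" by (simp only: dvd_add_right_iff)
  also have "{j..<J} = insert j {j<..<J}" using less.prems by auto
  also have "(\<Sum>i\<in>insert j {j<..<J}. G i * X ^ (i * p)) = X ^ (j * p) * (G j + X ^ p * W)"
  proof -
    have "(\<Sum>i\<in>{j<..<J}. G i * X ^ (i * p)) = X ^ (j * p) * (X ^ p * W)"
      unfolding W_def sum_distrib_left
    proof (rule sum.cong)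
      fix i assume "i \<in> {j<..<J}"
      hence "i = j + 1 + (i - j - 1)" by auto
      hence "i * p = j * p + (p + (i - j - 1) * p)" by (metis add_mult_distrib add.assoc mult_1)
      hence "X ^ (i * p) = X ^ (j * p) * (X ^ p * X ^ ((i - j - 1) * p))" by (simp only: power_add)
      thus "G i * X ^ (i * p) = X ^ (j * p) * (X ^ p * (G i * X ^ ((i - j - 1) * p)))"
        by (simp add: mult_ac)
    qed simp
    thus ?thesis by (simp add: algebra_simps)
  qed
  finally have Y: "?P dvd G j + X ^ p * W"
    using const_poly_dvd_linear_power_mult_cancel[OF p, of 0] unfolding X_def minus_zero by blast
  \<comment> \<open>Modulo \<open>p\<close>, \<open>A j + X^p W = - B j f^h\<close>. Squaring and
    multiplying by \<open>f\<close> gives \<open>B j^2 f^p = B j^2 (1 + X^p U)\<close> on the right;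
    \<open>Z\<close> collects all multiples of \<open>X^p\<close>.\<close>
  define Z where "Z = B j ^ 2 * U - f * (2 * A j * W + X ^ p * W ^ 2)"
  define Y where "Y = G j + X ^ p * W"
  have fp: "f ^ p = f * (f ^ h) ^ 2" unfolding ph by (simp add: power_mult[symmetric] mult.commute)
  have "f * A j ^ 2 - B j ^ 2 - X ^ p * Z
      = B j ^ 2 * (f ^ p - 1 - X ^ p * U) + f * (2 * (A j + X ^ p * W) - Y) * Y"
    unfolding fp Y_def G_def Z_def by (simp add: power2_eq_square algebra_simps)
  moreover have "?P dvd \<dots>"
    by (rule dvd_add[OF dvd_mult[OF frob[folded X_def]] dvd_mult[OF Y[folded Y_def]]])
  ultimately have dvZ: "?P dvd f * A j ^ 2 - B j ^ 2 - X ^ p * Z" by simp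
  have "?P dvd f * A j ^ 2 - B j ^ 2"
    unfolding const_poly_dvd_iff
  proof
    fix i
    show "int p dvd coeff (f * A j ^ 2 - B j ^ 2) i"
    proof (cases "i < p")
      case True
      have "X ^ p = monom 1 p" by (simp add: X_def monom_altdef)
      hence "coeff (X ^ p * Z) i = 0" using True by (simp add: coeff_monom_mult)
      thus ?thesis using dvZ by (auto simp: const_poly_dvd_iff dest!: spec[of _ i])
    next
      case False
      have "degree (A j ^ 2) \<le> 2 * (D - 1)" "degree (B j ^ 2) \<le> 2 * (D - 1)"
        using degree_power_le[of "A j" 2] degree_power_le[of "B j" 2] degA[of j] degB[of j] by auto
      moreover have "D > 0" using degA[of j] by simp
      ultimately have "degree (f * A j ^ 2) < p" "degree (B j ^ 2) < p"
        using D degree_mult_le[of f "A j ^ 2"] by linarith+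
      thus ?thesis using False by (simp add: coeff_eq_0)
    qed
  qed
  thus ?case by (rule odd_degree_mult_square_mod_prime[OF p odd lc])
qed

text \<open>Vanishing to order \<open>m\<close> on the set is weighed against the degree of the
  auxiliary polynomial. The cap on \<open>D\<close> serves its nonvanishing, the strict inequality
  its existence.\<close>

lemma stepanov_card_le:
  assumes p: "prime (p::nat)" and ph: "p = 2 * h + 1"
    and odd: "odd (degree f)" and lc: "\<not> int p dvd lead_coeff f"
    and frob: "[:int p:] dvd f ^ p - 1 - [:0, 1:] ^ p * U"
    and D: "2 * D + degree f \<le> p + 1" and mp: "m \<le> p"
    and less: "m * (D + m * degree f + J) < 2 * J * D"
  shows "m * card {x \<in> {0..<int p}. [poly f x ^ h = a] (mod int p) \<or> int p dvd poly f x}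
           \<le> (m + h) * degree f + D + J * p"
proof -
  obtain A B where AB: "\<And>j. degree (A j) < D" "\<And>j. degree (B j) < D"
    "\<And>k. k < m \<Longrightarrow> [:int p:] dvd stepanov_sum f m h a J A B k"
    "\<exists>j<J. \<not> [:int p:] dvd A j \<or> \<not> [:int p:] dvd B j"
    using stepanov_coefficients_exist[OF p less] by blast
  let ?R = "stepanov_poly f p m h J A B"
  have nf: "\<not> [:int p:] dvd f" using lc by (auto simp: const_poly_dvd_iff)
  have "\<not> [:int p:] dvd ?R"
  proof
    assume "[:int p:] dvd ?R"
    also have "?R = f ^ m * (\<Sum>j<J. (A j + B j * f ^ h) * [:0, 1:] ^ (j * p))"
      unfolding stepanov_poly_def sum_distrib_left by (intro sum.cong) (simp_all add: power_add algebra_simps)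
    finally have "[:int p:] dvd (\<Sum>j<J. (A j + B j * f ^ h) * [:0, 1:] ^ (j * p))"
      using nf prime_elem_const_int_poly[OF p] by (meson prime_elem_dvd_mult_iff prime_elem_dvd_power)
    from stepanov_nonvanishing[OF p ph odd lc frob AB(1,2) D this] AB(4) show False by blast
  qed
  hence "m * card {x \<in> {0..<int p}. [poly f x ^ h = a] (mod int p) \<or> int p dvd poly f x} \<le> degree ?R"
  proof (rule card_zeros_mod_prime_le[OF p])
    fix x y :: int assume "x \<in> {x \<in> {0..<int p}. [poly f x ^ h = a] (mod int p) \<or> int p dvd poly f x}"
      "y \<in> {x \<in> {0..<int p}. [poly f x ^ h = a] (mod int p) \<or> int p dvd poly f x}" "x \<noteq> y"
    thus "\<not> int p dvd x - y" by (auto simp flip: mod_eq_dvd_iff)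
  next
    fix x k assume "x \<in> {x \<in> {0..<int p}. [poly f x ^ h = a] (mod int p) \<or> int p dvd poly f x}" "k < m"
    thus "int p dvd poly ((pderiv ^^ k) ?R) x"
      using poly_higher_pderiv_stepanov_poly[OF p _ AB(3)] by blast
  next
    show "finite {x \<in> {0..<int p}. [poly f x ^ h = a] (mod int p) \<or> int p dvd poly f x}"
      by (rule finite_subset[of _ "{0..<int p}"]) auto
  qed (use mp in auto)
  also have "degree ?R \<le> (m + h) * degree f + D + J * p"
    unfolding stepanov_poly_def
  proof (rule degree_sum_le)
    fix j assume "j \<in> {..<J}"
    hence jp: "j * p \<le> J * p" by simp
    have dX: "degree ([:0, 1:] ^ n :: int poly) = n" for n by (simp add: degree_linear_power[of 0, simplified])
    have "degree (f ^ c * Q * [:0, 1:] ^ (j * p)) \<le> (m + h) * degree f + D + J * p"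
      if "c \<le> m + h" "degree Q < D" for c Q
    proof -
      have "degree (f ^ c * Q * [:0, 1:] ^ (j * p)) \<le> degree (f ^ c) + degree Q + j * p"
        using degree_mult_le[of "f ^ c * Q" "[:0, 1:] ^ (j * p)"] degree_mult_le[of "f ^ c" Q] dX[of "j * p"] by linarith
      moreover have "degree (f ^ c) \<le> (m + h) * degree f"
        using degree_power_le[of f c] mult_le_mono1[OF that(1), of "degree f"] by (simp only: mult.commute)
      ultimately show ?thesis using that jp by linarith
    qed
    thus "degree (f ^ m * A j * [:0, 1:] ^ (j * p) + f ^ (m + h) * B j * [:0, 1:] ^ (j * p)) \<le> (m + h) * degree f + D + J * p"
      using AB(1,2) by (intro degree_add_le) auto
  qed simp
  finally show ?thesis .
qed


section \<open>Complete Legendre symbol sums\<close>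

lemma Legendre_cong:
  assumes "[a = b] (mod p)"
  shows "Legendre a p = Legendre b p"
proof -
  have "[y = a] (mod p) \<longleftrightarrow> [y = b] (mod p)" for y
    using assms by (meson cong_sym cong_trans)
  moreover have "[a = 0] (mod p) \<longleftrightarrow> [b = 0] (mod p)"
    using assms by (meson cong_sym cong_trans)
  ultimately show ?thesis by (simp add: Legendre_def QuadRes_def)
qed

lemma Legendre_values: "Legendre a p \<in> {-1, 0, 1}"
  by (simp add: Legendre_def)

lemma abs_Legendre_le: "\<bar>Legendre a p\<bar> \<le> 1"
  by (simp add: Legendre_def)

lemma Legendre_eq_0_iff: "Legendre a p = 0 \<longleftrightarrow> p dvd a"
  by (simp add: Legendre_def cong_0_iff)

lemma Legendre_1: "prime (p::nat) \<Longrightarrow> Legendre 1 (int p) = 1"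
  unfolding Legendre_def QuadRes_def
  by (auto simp: cong_0_iff intro: exI[of _ 1])

lemma Legendre_euler:
  assumes "prime (p::nat)" "p = 2 * h + 1"
  shows "[Legendre a (int p) = a ^ h] (mod int p)"
proof -
  have "p > 2" using assms(2) prime_ge_2_nat[OF assms(1)] by presburger
  thus ?thesis using euler_criterion[OF assms(1), of a] assms(2) by simp
qed

text \<open>Euler's criterion gives the identity modulo \<open>p\<close>; both sides lie in
  \<open>{-1, 0, 1}\<close>, so their difference is at most 2 and hence below
  \<open>p\<close>.\<close>

lemma Legendre_mult:
  assumes p: "prime (p::nat)" "odd p"
  shows "Legendre (a * b) (int p) = Legendre a (int p) * Legendre b (int p)"
proof -
  obtain h where h: "p = 2 * h + 1" using p(2) by (rule oddE)
  have p2: "p > 2" using p prime_ge_2_nat[of p] by (cases "p = 2") auto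
  have "[Legendre (a * b) (int p) = (a * b) ^ h] (mod int p)" by (rule Legendre_euler[OF p(1) h])
  also have "(a * b) ^ h = a ^ h * b ^ h" by (rule power_mult_distrib)
  also have "[a ^ h * b ^ h = Legendre a (int p) * Legendre b (int p)] (mod int p)"
    by (intro cong_mult cong_sym[OF Legendre_euler[OF p(1) h]])
  finally have "int p dvd Legendre (a * b) (int p) - Legendre a (int p) * Legendre b (int p)"
    by (simp add: cong_iff_dvd_diff)
  moreover have "\<bar>Legendre (a * b) (int p) - Legendre a (int p) * Legendre b (int p)\<bar> < int p"
    using Legendre_values[of "a * b" "int p"] Legendre_values[of a "int p"] Legendre_values[of b "int p"] p2
    by auto
  ultimately have "Legendre (a * b) (int p) - Legendre a (int p) * Legendre b (int p) = 0"
    by (metis abs_of_nat dvd_imp_le_int not_le)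
  thus ?thesis by simp
qed

lemma Legendre_prod:
  assumes p: "prime (p::nat)" "odd p"
  shows "Legendre (\<Prod>i\<in>I. f i) (int p) = (\<Prod>i\<in>I. Legendre (f i) (int p))"
  by (induction I rule: infinite_finite_induct) (simp_all add: Legendre_1 Legendre_mult p)

lemma stepanov_card_le_sqrt:
  assumes p: "prime (p::nat)" and ph: "p = 2 * h + 1"
    and odd: "odd (degree f)" and lc: "\<not> int p dvd lead_coeff f"
    and frob: "[:int p:] dvd f ^ p - 1 - [:0, 1:] ^ p * U"
    and p16: "16 \<le> p" and d: "4 * degree f \<le> p"
  shows "real (card {x \<in> {0..<int p}. [poly f x ^ h = a] (mod int p) \<or> int p dvd poly f x})
           \<le> real p / 2 + 13 * real (degree f) * sqrt (real p)"
proof -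
  define N where "N = card {x \<in> {0..<int p}. [poly f x ^ h = a] (mod int p) \<or> int p dvd poly f x}"
  define d where "d = degree f"
  \<comment> \<open>\<open>D\<close> is the largest value that the nonvanishing admits. Existence
    then needs \<open>J\<close> above \<open>m / 2\<close>, and the excess \<open>2 d + 3\<close>
    pays for \<open>m^2 d + m J\<close>, which requires \<open>m^2\<close> to be at most of order
    \<open>p\<close>. Dividing the degree by \<open>m\<close> gives \<open>p / 2\<close> plus terms
    of order \<open>d p / m\<close>, so \<open>m\<close> is taken as large as possible, near
    \<open>sqrt p\<close>.\<close>
  define m where "m = floor_sqrt p"
  define D where "D = (p - d) div 2"
  define J where "J = m div 2 + 2 * d + 3"
  have dp: "4 * d \<le> p" using assms(7) by (simp add: d_def)
  have d1: "d \<ge> 1" using odd by (cases "degree f") (auto simp: d_def)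
  have D2: "2 * D = p - d" using odd ph dp by (simp add: D_def d_def)
  have m2: "m * m \<le> p" using floor_sqrt_power2_le[of p] by (simp add: m_def power2_eq_square)
  have m3: "p < (m + 1) * (m + 1)" using Suc_floor_sqrt_power2_gt[of p] by (simp add: m_def power2_eq_square)
  have "4 \<le> m" unfolding m_def using p16 by (intro le_floor_sqrtI) simp
  hence "4 * m \<le> m * m" by (rule mult_le_mono1)
  hence m4: "4 * m \<le> p" using m2 by linarith
  have "2 * J \<ge> m + 4 * d + 5" by (simp add: J_def)
  hence Jlow: "real J - real m / 2 \<ge> 2 * real d + 5 / 2" by linarith
  have Jup: "real J \<le> real m / 2 + 2 * real d + 3" unfolding J_def by simp
  have "real m * (real D + real m * real d + real J) < 2 * real J * real D"
  proof -
    have q: "real p / 2 \<le> real p - real d - real m" using m4 dp by linarith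
    have "(2 * real d + 5 / 2) * (real p / 2) \<le> (real J - real m / 2) * (real p - real d - real m)"
      using Jlow q by (intro mult_mono) auto
    also have "\<dots> = 2 * real J * ((real p - real d) / 2) - real m * ((real p - real d) / 2)
        - real m * real J + real m * real m / 2"
      by (simp add: field_simps)
    finally have 1: "real d * real p + 5 / 4 * real p \<le> \<dots>" by (simp add: algebra_simps)
    have 2: "real m * real m \<le> real p" using m2 by (metis of_nat_le_iff of_nat_mult)
    hence 3: "real d * (real m * real m) \<le> real d * real p" by (rule mult_left_mono) simp
    have "2 * D + d = p" using D2 dp by linarith
    hence "real (2 * D + d) = real p" by (rule arg_cong)
    hence D': "real D = (real p - real d) / 2" by simp
    have "real p > 0" using p16 by simp
    hence "real m * ((real p - real d) / 2) + real d * (real m * real m) + real m * real J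
        < 2 * real J * ((real p - real d) / 2)" using 1 2 3 by linarith
    thus ?thesis unfolding D' by (simp only: distrib_left mult.assoc mult.left_commute mult.commute)
  qed
  hence "real (m * (D + m * d + J)) < real (2 * J * D)" by simp
  hence less: "m * (D + m * d + J) < 2 * J * D" by linarith
  have "m * N \<le> (m + h) * d + D + J * p"
    unfolding N_def d_def
    by (rule stepanov_card_le[OF p ph odd lc frob])
       (use D2 dp m4 less in \<open>auto simp: d_def\<close>)
  hence "real m * real N \<le> (real m + real h) * real d + real D + real J * real p"
    by (metis of_nat_add of_nat_le_iff of_nat_mult)
  moreover have "real h * real d \<le> real p / 2 * real d" by (rule mult_right_mono) (use ph in auto)
  moreover have "real D \<le> real p / 2" using D2 by linarith
  moreover have "real J * real p \<le> (real m / 2 + 2 * real d + 3) * real p" by (rule mult_right_mono[OF Jup]) simp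
  moreover have "real p \<le> real p * real d" using d1 mult_left_mono[of 1 "real d" "real p"] by simp
  ultimately have main: "real m * (real N - real p / 2 - real d) \<le> 6 * real p * real d"
    by (simp add: algebra_simps)
  define s where "s = sqrt (real p)"
  have s2: "s * s = real p" by (simp add: s_def)
  have s4: "s \<ge> 4" unfolding s_def using p16 by (intro real_le_rsqrt) simp
  have "s < real m + 1"
  proof -
    have "real p < real ((m + 1) * (m + 1))" using m3 by (simp only: of_nat_less_iff)
    hence "s\<^sup>2 < (real m + 1)\<^sup>2" unfolding power2_eq_square s2 by (simp add: algebra_simps)
    thus ?thesis by (rule power2_less_imp_less) simp
  qed
  hence ms: "real m \<ge> s / 2" using s4 by linarith
  have "real N - real p / 2 - real d \<le> 12 * real d * s"
  proof (rule ccontr)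
    assume *: "\<not> ?thesis"
    have "0 \<le> real d * s" using s4 by simp
    hence "(s / 2) * (12 * real d * s) < real m * (real N - real p / 2 - real d)"
      using * ms s4 by (intro mult_le_less_imp_less) auto
    also note main
    also have "6 * real p * real d = (s / 2) * (12 * real d * s)" by (simp flip: s2)
    finally show False by simp
  qed
  moreover have "real d \<le> real d * s" using s4 by (simp add: mult_le_cancel_left1)
  ultimately show ?thesis unfolding N_def[symmetric] d_def[symmetric] s_def[symmetric] by linarith
qed

text \<open>Upper bounds alone suffice: the points with symbol 1 or 0 and those with symbol -1 or 0
  together cover all \<open>p\<close> residues. If neither set exceeds
  \<open>p / 2 + 13 d sqrt p\<close>, their sizes differ by at most
  \<open>26 d sqrt p\<close>.\<close>

lemma abs_sum_Legendre_odd_degree_le: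
  assumes p: "prime (p::nat)" "odd p"
    and odd: "odd (degree f)" and lc: "\<not> int p dvd lead_coeff f"
    and frob: "[:int p:] dvd f ^ p - 1 - [:0, 1:] ^ p * U"
  shows "\<bar>real_of_int (\<Sum>x\<in>{0..<int p}. Legendre (poly f x) (int p))\<bar> \<le> 30 * real (degree f) * sqrt (real p)"
proof -
  obtain h where h: "p = 2 * h + 1" using p(2) by (rule oddE)
  define d where "d = degree f"
  define L where "L = (\<lambda>x. Legendre (poly f x) (int p))"
  define s where "s = sqrt (real p)"
  have s2: "s * s = real p" by (simp add: s_def)
  have d1: "real d \<ge> 1" using odd by (cases "degree f") (auto simp: d_def)
  have s1: "s \<ge> 1" unfolding s_def using prime_gt_0_nat[OF p(1)] by simp
  have ds: "real d * s \<ge> real d" "real d * s \<ge> s" using s1 d1 by (simp_all add: mult_le_cancel_left1 mult_le_cancel_right1)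
  show ?thesis
  proof (cases "16 \<le> p \<and> 4 * d \<le> p")
    \<comment> \<open>For \<open>p < 16\<close> or \<open>4 d > p\<close> the trivial bound
      \<open>p\<close> is already below \<open>30 d sqrt p\<close>.\<close>
    case False
    have "\<bar>\<Sum>x\<in>{0..<int p}. L x\<bar> \<le> (\<Sum>x\<in>{0..<int p}. \<bar>L x\<bar>)" by (rule sum_abs)
    also have "\<dots> \<le> (\<Sum>x\<in>{0..<int p}. 1)" unfolding L_def by (intro sum_mono abs_Legendre_le)
    finally have "\<bar>\<Sum>x\<in>{0..<int p}. L x\<bar> \<le> int p" by simp
    hence "real_of_int \<bar>\<Sum>x\<in>{0..<int p}. L x\<bar> \<le> real_of_int (int p)" by (rule of_int_le_iff[THEN iffD2])
    hence "\<bar>real_of_int (\<Sum>x\<in>{0..<int p}. L x)\<bar> \<le> real p" by (simp only: of_int_abs of_int_of_nat_eq)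
    also have "real p \<le> 30 * real d * s"
    proof (cases "16 \<le> p")
      case True
      thus ?thesis using False ds by linarith
    next
      case False
      hence "s \<le> 4" unfolding s_def by (intro real_le_lsqrt) auto
      hence "s * s \<le> 4 * s" using s1 by (intro mult_right_mono) auto
      thus ?thesis using s2 ds s1 by linarith
    qed
    finally show ?thesis by (simp add: L_def d_def s_def)
  next
    case True
    define S where "S = (\<lambda>a. {x \<in> {0..<int p}. L x = a \<or> L x = 0})"
    have bound: "real (card (S a)) \<le> real p / 2 + 13 * real d * s" for a
    proof -
      have "S a \<subseteq> {x \<in> {0..<int p}. [poly f x ^ h = a] (mod int p) \<or> int p dvd poly f x}"
        using Legendre_euler[OF p(1) h] unfolding S_def L_def
        by (auto simp: Legendre_eq_0_iff cong_sym)
      hence "card (S a) \<le> card {x \<in> {0..<int p}. [poly f x ^ h = a] (mod int p) \<or> int p dvd poly f x}"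
        by (rule card_mono[rotated]) (rule finite_subset[of _ "{0..<int p}"], auto)
      thus ?thesis
        using stepanov_card_le_sqrt[OF p(1) h odd lc frob, of a] True unfolding d_def s_def by linarith
    qed
    have cS: "int (card (S a)) = (\<Sum>x\<in>{0..<int p}. if L x = a \<or> L x = 0 then 1 else 0)" for a
    proof -
      have "int (card (S a)) = (\<Sum>x\<in>S a. 1)" by simp
      also have "\<dots> = (\<Sum>x\<in>{0..<int p}. if L x = a \<or> L x = 0 then 1 else 0)"
        unfolding S_def by (rule sum.inter_filter) simp
      finally show ?thesis .
    qed
    have Lx: "L x = (if L x = 1 \<or> L x = 0 then 1 else 0) - (if L x = -1 \<or> L x = 0 then 1 else 0)" for x
      using Legendre_values[of "poly f x" "int p"] by (auto simp: L_def)
    have "(\<Sum>x\<in>{0..<int p}. L x) = (\<Sum>x\<in>{0..<int p}. (if L x = 1 \<or> L x = 0 then 1 else 0) - (if L x = -1 \<or> L x = 0 then 1 else 0))"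
      by (rule sum.cong[OF refl Lx])
    also have "\<dots> = int (card (S 1)) - int (card (S (-1)))"
      unfolding cS by (rule sum_subtractf)
    finally have sum: "(\<Sum>x\<in>{0..<int p}. L x) = int (card (S 1)) - int (card (S (-1)))" .
    have "S 1 \<union> S (-1) = {0..<int p}"
      using Legendre_values[of "poly f _" "int p"] by (auto simp: S_def L_def)
    hence "p \<le> card (S 1) + card (S (-1))"
      using card_Un_le[of "S 1" "S (-1)"] by simp
    hence "\<bar>real_of_int (\<Sum>x\<in>{0..<int p}. L x)\<bar> \<le> 26 * real d * s"
      unfolding sum using bound[of 1] bound[of "-1"] by simp
    thus ?thesis using ds s1 unfolding L_def d_def s_def by linarith
  qed
qed

text \<open>Factor by factor, \<open>(1 + w x)^p\<close> is congruent to \<open>1 + w^p x^p\<close>,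
  as \<open>p\<close> divides the inner binomial coefficients. This provides the hypothesis
  \<open>frob\<close> of Stepanov's bound, and it is the reason for normalising the constant terms
  to 1.\<close>

lemma linear_prod_power_prime_mod:
  assumes p: "prime (p::nat)"
  shows "\<exists>U. [:int p:] dvd (\<Prod>i\<in>I. [:1, w i:]) ^ p - 1 - [:0, 1:] ^ p * U"
proof (induction I rule: infinite_finite_induct)
  case (insert a I)
  define X where "X = ([:0, 1:] :: int poly)"
  obtain U where U: "[:int p:] dvd (\<Prod>i\<in>I. [:1, w i:]) ^ p - 1 - X ^ p * U" using insert.IH unfolding X_def by blast
  define c where "c = [:w a:] * X"
  have "[:1, w a:] = c + 1" by (simp add: c_def X_def one_pCons)
  have "[:int p:] dvd (c + 1) ^ p - 1 - X ^ p * [:w a:] ^ p"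
  proof -
    have "{..p} = insert 0 (insert p {1..<p})" by auto
    hence "(c + 1) ^ p = 1 + c ^ p + (\<Sum>k\<in>{1..<p}. of_nat (p choose k) * c ^ k)"
      using prime_gt_0_nat[OF p] by (simp add: binomial_ring)
    moreover have "[:int p:] dvd (\<Sum>k\<in>{1..<p}. of_nat (p choose k) * c ^ k)"
    proof (intro dvd_sum dvd_mult2)
      fix k assume "k \<in> {1..<p}"
      hence "p dvd p choose k" using p by (intro dvd_choose_prime) auto
      thus "[:int p:] dvd of_nat (p choose k)" by (simp add: of_nat_poly)
    qed
    moreover have "c ^ p = X ^ p * [:w a:] ^ p" unfolding c_def by (simp only: power_mult_distrib mult.commute)
    ultimately show ?thesis by simp
  qed
  hence V: "[:int p:] dvd [:1, w a:] ^ p - 1 - X ^ p * [:w a:] ^ p" by (simp only: \<open>[:1, w a:] = c + 1\<close>)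
  define F where "F = (\<Prod>i\<in>I. [:1, w i:]) ^ p"
  define G where "G = [:1, w a:] ^ p"
  define V' where "V' = [:w a:] ^ p"
  have "[:int p:] dvd G * (F - 1 - X ^ p * U) + (1 + X ^ p * U) * (G - 1 - X ^ p * V')"
    using U V unfolding F_def G_def V'_def by (intro dvd_add dvd_mult)
  also have "\<dots> = G * F - 1 - X ^ p * (U + V' + X ^ p * U * V')" by (simp add: algebra_simps)
  also have "G * F = (\<Prod>i\<in>insert a I. [:1, w i:]) ^ p"
    unfolding F_def G_def prod.insert[OF insert.hyps] power_mult_distrib ..
  finally show ?case unfolding X_def by blast
qed (auto intro: exI[of _ 0])

text \<open>
  The substitution \<open>x = 1 / y - v\<close> turns the product, up to the square factor \<open>y ^ (- card I)\<close>, into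
  the product of \<open>1 + (t i - v) y\<close>, which has odd degree since the factors with \<open>t i = v\<close> disappear.
\<close>

lemma abs_sum_Legendre_prod_shifts_le:
  assumes p: "prime (p::nat)" "odd p" and I: "finite I" "even (card I)"
    and v: "odd (card {i \<in> I. t i = v})"
    and dist: "\<And>i. i \<in> I \<Longrightarrow> t i \<noteq> v \<Longrightarrow> \<not> int p dvd t i - v"
  shows "\<bar>real_of_int (\<Sum>x\<in>{0..<int p}. Legendre (\<Prod>i\<in>I. x + t i) (int p))\<bar> \<le> 31 * real (card I) * sqrt (real p)"
proof -
  define I' where "I' = {i \<in> I. t i \<noteq> v}"
  define f where "f = (\<Prod>i\<in>I'. [:1, t i - v:])"
  define F where "F = (\<lambda>x. Legendre (\<Prod>i\<in>I. x + t i) (int p))"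
  \<comment> \<open>The one residue that \<open>1 / y - v\<close> never takes; the original product
    vanishes there.\<close>
  define x0 where "x0 = (- v) mod int p"
  have p0: "int p > 0" using prime_gt_0_nat[OF p(1)] by simp
  have pi: "prime (int p)" using p by simp
  have I': "finite I'" using I by (simp add: I'_def)
  have "card I = card {i \<in> I. t i = v} + card I'"
    unfolding I'_def using I by (subst card_Un_disjoint [symmetric]) (auto intro: arg_cong[of _ _ card])
  hence odd: "odd (card I')" and le: "card I' + 1 \<le> card I" using v I(2) by (auto intro: Suc_leI odd_pos)
  have deg: "degree f = card I'" unfolding f_def
    by (subst degree_prod_eq_sum_degree) (auto simp: I'_def)
  have "lead_coeff f = (\<Prod>i\<in>I'. t i - v)" unfolding f_def lead_coeff_prod
    by (intro prod.cong) (auto simp: I'_def)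
  hence lc: "\<not> int p dvd lead_coeff f"
    using pi I' dist by (auto simp: prime_dvd_prod_iff I'_def)
  obtain U where U: "[:int p:] dvd f ^ p - 1 - [:0, 1:] ^ p * U"
    unfolding f_def using linear_prod_power_prime_mod[OF p(1), of "\<lambda>i. t i - v" I'] by blast
  have bound: "\<bar>real_of_int (\<Sum>x\<in>{0..<int p}. Legendre (poly f x) (int p))\<bar> \<le> 30 * real (card I') * sqrt (real p)"
    using abs_sum_Legendre_odd_degree_le[OF p _ lc U] odd deg by simp
  have Fcong: "F x = F y" if "[x = y] (mod int p)" for x y
    unfolding F_def using that by (intro Legendre_cong cong_prod cong_add cong_refl)
  have "\<exists>z. [y * z = 1] (mod int p)" if "y \<in> {1..<int p}" for y
  proof -
    have "coprime y (int p)" using that pi by (metis atLeastLessThan_iff coprime_commute prime_imp_coprime zdvd_imp_le zero_less_one less_le_trans not_less)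
    thus ?thesis using cong_modular_inverse1 by blast
  qed
  then obtain iv where iv: "\<And>y. y \<in> {1..<int p} \<Longrightarrow> [y * iv y = 1] (mod int p)" by metis
  define g where "g = (\<lambda>y. (iv y - v) mod int p)"
  have inj: "inj_on g {1..<int p}"
  proof (rule inj_onI)
    fix y z assume y: "y \<in> {1..<int p}" and z: "z \<in> {1..<int p}" and "g y = g z"
    hence "[iv y - v = iv z - v] (mod int p)" by (simp add: g_def Cong.cong_def)
    hence e: "[iv y = iv z] (mod int p)" by (metis cong_add_rcancel diff_conv_add_uminus)
    have "[y = y * (z * iv z)] (mod int p)" using cong_scalar_left[OF cong_sym[OF iv[OF z]], of y] by simp
    also have "[y * (z * iv z) = y * (z * iv y)] (mod int p)" by (intro cong_scalar_left cong_sym[OF e])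
    also have "y * (z * iv y) = z * (y * iv y)" by simp
    also have "[\<dots> = z * 1] (mod int p)" by (intro cong_scalar_left iv y)
    finally show "y = z" using y z by (simp add: Cong.cong_def)
  qed
  have gsub: "g ` {1..<int p} \<subseteq> {0..<int p} - {x0}"
  proof
    fix x assume "x \<in> g ` {1..<int p}"
    then obtain y where y: "y \<in> {1..<int p}" "x = g y" by blast
    have "x \<noteq> x0"
    proof
      assume "x = x0"
      hence "[iv y - v = -v] (mod int p)" using y by (simp add: g_def x0_def Cong.cong_def)
      hence "int p dvd iv y" by (simp add: cong_iff_dvd_diff)
      hence "[y * iv y = 0] (mod int p)" by (simp add: cong_0_iff)
      hence "[1 = 0] (mod int p)" using iv[OF y(1)] by (meson cong_sym cong_trans)
      thus False using pi by (simp add: cong_0_iff)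
    qed
    thus "x \<in> {0..<int p} - {x0}" using y p0 by (simp add: g_def)
  qed
  have x0: "x0 \<in> {0..<int p}" using p0 by (simp add: x0_def)
  have "card (g ` {1..<int p}) = card ({0..<int p} - {x0})" using x0 by (simp add: card_image[OF inj])
  hence img: "g ` {1..<int p} = {0..<int p} - {x0}" using gsub by (intro card_subset_eq) auto
  have Fx0: "F x0 = 0"
  proof -
    have "{i \<in> I. t i = v} \<noteq> {}" using v by (metis card.empty even_zero)
    then obtain i where i: "i \<in> I" "t i = v" by blast
    have "F x0 = F (-v)" by (rule Fcong) (simp add: x0_def)
    also have "\<dots> = 0" 
    proof -
      have "(\<Prod>i\<in>I. - v + t i) = 0" using i I(1) by (intro prod_zero bexI[of _ i]) auto
      thus ?thesis by (simp add: F_def Legendre_eq_0_iff)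
    qed
    finally show ?thesis .
  qed
  have Fg: "F (g y) = Legendre (poly f y) (int p)" if y: "y \<in> {1..<int p}" for y
  proof -
    have ny: "\<not> int p dvd y" using y by (auto dest: zdvd_imp_le)
    have "Legendre y (int p) \<in> {-1, 1}" using ny Legendre_values[of y "int p"] by (auto simp: Legendre_eq_0_iff)
    hence one: "Legendre y (int p) ^ card I = 1" using I(2) by auto
    have "F (g y) = F (iv y - v)" by (rule Fcong) (simp add: g_def)
    also have "\<dots> = Legendre y (int p) ^ card I * Legendre (\<Prod>i\<in>I. iv y - v + t i) (int p)" by (simp add: F_def one)
    also have "\<dots> = Legendre (\<Prod>i\<in>I. y * (iv y - v + t i)) (int p)"
      unfolding Legendre_prod[OF p] Legendre_mult[OF p] prod.distrib by simp
    also have "\<dots> = Legendre (\<Prod>i\<in>I. 1 + (t i - v) * y) (int p)"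
    proof (intro Legendre_cong cong_prod)
      fix i
      have "[y * iv y + (t i - v) * y = 1 + (t i - v) * y] (mod int p)" by (intro cong_add iv y cong_refl)
      thus "[y * (iv y - v + t i) = 1 + (t i - v) * y] (mod int p)" by (simp add: algebra_simps)
    qed
    also have "(\<Prod>i\<in>I. 1 + (t i - v) * y) = (\<Prod>i\<in>I'. 1 + (t i - v) * y)"
      using I by (intro prod.mono_neutral_right) (auto simp: I'_def)
    also have "\<dots> = poly f y" by (simp add: f_def poly_prod mult.commute)
    finally show ?thesis .
  qed
  have "(\<Sum>x\<in>{0..<int p}. F x) = (\<Sum>x\<in>{0..<int p} - {x0}. F x)"
    using x0 Fx0 by (simp add: sum.remove)
  also have "\<dots> = (\<Sum>y\<in>{1..<int p}. Legendre (poly f y) (int p))"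
    unfolding img[symmetric] by (subst sum.reindex[OF inj]) (auto intro!: sum.cong simp: Fg)
  \<comment> \<open>The transformed sum lacks \<open>y = 0\<close>, where \<open>f\<close> is 1.
    This correction raises the constant from 30 to 31.\<close>
  also have "\<dots> = (\<Sum>y\<in>{0..<int p}. Legendre (poly f y) (int p)) - 1"
  proof -
    have "{0..<int p} = insert 0 {1..<int p}" using p0 by auto
    moreover have "poly f 0 = 1" by (simp add: f_def poly_prod)
    ultimately show ?thesis by (simp add: Legendre_1 p)
  qed
  finally have "\<bar>real_of_int (\<Sum>x\<in>{0..<int p}. F x)\<bar> \<le> 30 * real (card I') * sqrt (real p) + 1"
    using bound by linarith
  also have "\<dots> \<le> 30 * real (card I) * sqrt (real p) + real (card I) * sqrt (real p)"
  proof (rule add_mono)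
    show "30 * real (card I') * sqrt (real p) \<le> 30 * real (card I) * sqrt (real p)"
      using le by (intro mult_right_mono) auto
    have "1 * 1 \<le> real (card I) * sqrt (real p)" using le p0 by (intro mult_mono) auto
    thus "1 \<le> real (card I) * sqrt (real p)" by simp
  qed
  finally show ?thesis unfolding F_def by simp
qed


section \<open>Moments of short Legendre symbol sums\<close>

text \<open>Such a tuple takes at most \<open>r\<close> distinct values, so it factors through a set with \<open>r\<close> elements.\<close>

lemma card_even_tuples_le:
  assumes W: "finite W"
  shows "card {t \<in> {..<2 * r} \<rightarrow>\<^sub>E W. \<forall>v. even (card {i \<in> {..<2 * r}. t i = v})} \<le> card W ^ r * r ^ (2 * r)"
proof -
  define E where "E = {t \<in> {..<2 * r} \<rightarrow>\<^sub>E W. \<forall>v. even (card {i \<in> {..<2 * r}. t i = v})}"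
  define P where "P = ({..<r} \<rightarrow>\<^sub>E W) \<times> ({..<2 * r} \<rightarrow>\<^sub>E {..<r})"
  define F where "F = (\<lambda>(g :: nat \<Rightarrow> 'a, e :: nat \<Rightarrow> nat). restrict (\<lambda>i. g (e i)) {..<2 * r})"
  have finP: "finite P" unfolding P_def using W by (intro finite_cartesian_product finite_PiE) auto
  have "E \<subseteq> F ` P"
  proof
    fix t assume t: "t \<in> E"
    define V where "V = t ` {..<2 * r}"
    have tW: "t i \<in> W" if "i < 2 * r" for i using t that by (auto simp: E_def)
    have ge2: "2 \<le> card {i \<in> {..<2 * r}. t i = v}" if v: "v \<in> V" for v
    proof -
      have "{i \<in> {..<2 * r}. t i = v} \<noteq> {}" using v by (auto simp: V_def)
      hence "card {i \<in> {..<2 * r}. t i = v} \<noteq> 0" by (subst card_0_eq) auto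
      moreover have "even (card {i \<in> {..<2 * r}. t i = v})" using t by (auto simp: E_def)
      ultimately show ?thesis by presburger
    qed
    have "card V * 2 = (\<Sum>v\<in>V. 2)" by simp
    also have "\<dots> \<le> (\<Sum>v\<in>V. card {i \<in> {..<2 * r}. t i = v})" by (intro sum_mono ge2)
    also have "\<dots> = (\<Sum>i\<in>{..<2 * r}. 1)"
      by (subst sum_fun_comp[where g = t and R = V and f = "\<lambda>_. 1"]) (auto simp: V_def)
    finally have cV: "card V \<le> r" by simp
    obtain b where b: "bij_betw b {0..<card V} V" using ex_bij_betw_nat_finite[of V] by (auto simp: V_def)
    \<comment> \<open>If fewer than \<open>r\<close> values occur, the remaining slots are filled
      with \<open>t 0\<close>, which lies in \<open>W\<close> whenever there is a slot at
      all.\<close>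
    define g where "g = restrict (\<lambda>i. if i < card V then b i else t 0) {..<r}"
    define e where "e = restrict (\<lambda>i. inv_into {0..<card V} b (t i)) {..<2 * r}"
    have e: "inv_into {0..<card V} b (t i) < card V" "b (inv_into {0..<card V} b (t i)) = t i" if "i < 2 * r" for i
    proof -
      have "t i \<in> b ` {0..<card V}" using b that by (auto simp: bij_betw_def V_def)
      thus "inv_into {0..<card V} b (t i) < card V" "b (inv_into {0..<card V} b (t i)) = t i"
        using inv_into_into[of "t i" b "{0..<card V}"] f_inv_into_f[of "t i" b "{0..<card V}"] by auto
    qed
    have "b i \<in> W" if "i < card V" for i
    proof -
      have "b i \<in> V" using b that by (auto simp: bij_betw_def)
      thus ?thesis using tW by (auto simp: V_def)
    qed
    hence "g \<in> {..<r} \<rightarrow>\<^sub>E W" using tW by (auto simp: g_def)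
    moreover have "e \<in> {..<2 * r} \<rightarrow>\<^sub>E {..<r}" using e(1) cV by (auto simp: e_def intro: less_le_trans)
    moreover have "F (g, e) = t"
    proof
      fix i show "F (g, e) i = t i"
      proof (cases "i < 2 * r")
        case True
        thus ?thesis using e[OF True] cV by (simp add: F_def g_def e_def)
      next
        case False
        have "t \<in> extensional {..<2 * r}" using t by (auto simp: E_def PiE_iff)
        thus ?thesis using False by (simp add: F_def extensional_def)
      qed
    qed
    ultimately show "t \<in> F ` P" unfolding P_def by force
  qed
  hence "card E \<le> card (F ` P)" using finP by (intro card_mono) auto
  also have "\<dots> \<le> card P" using finP by (rule card_image_le)
  also have "card P = card W ^ r * r ^ (2 * r)" unfolding P_def by (simp add: card_cartesian_product card_PiE)
  finally show ?thesis by (simp add: E_def)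
qed

text \<open>The power expands over \<open>2 r\<close>-tuples of shifts. If every shift occurs an
  even number of times, the product is a square and only the trivial bound \<open>p\<close> is used,
  but such tuples are few. Any other tuple has a shift of odd multiplicity, and the complete sum is
  at most \<open>31 * 2 r * sqrt p\<close>. \<open>V \<le> p\<close> keeps distinct shifts
  incongruent.\<close>

lemma Legendre_moment_le:
  assumes p: "prime (p::nat)" "odd p" and V: "V \<le> p"
  shows "real_of_int (\<Sum>x\<in>{0..<int p}. (\<Sum>v\<in>{1..int V}. Legendre (x + v) (int p)) ^ (2 * r))
     \<le> real r ^ (2 * r) * real V ^ r * real p + 62 * real r * real V ^ (2 * r) * sqrt (real p)"
proof -
  define T where "T = ({..<2 * r} \<rightarrow>\<^sub>E {1..int V})"
  define E where "E = {t \<in> T. \<forall>v. even (card {i \<in> {..<2 * r}. t i = v})}"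
  define S where "S = (\<lambda>t. \<Sum>x\<in>{0..<int p}. Legendre (\<Prod>i<2 * r. x + t i) (int p))"
  have finT: "finite T" unfolding T_def by (intro finite_PiE) auto
  have cT: "card T = V ^ (2 * r)" by (simp add: T_def card_PiE)
  have "(\<Sum>x\<in>{0..<int p}. (\<Sum>v\<in>{1..int V}. Legendre (x + v) (int p)) ^ (2 * r))
      = (\<Sum>x\<in>{0..<int p}. \<Sum>t\<in>T. Legendre (\<Prod>i<2 * r. x + t i) (int p))"
  proof (rule sum.cong[OF refl])
    fix x
    have "(\<Sum>v\<in>{1..int V}. Legendre (x + v) (int p)) ^ (2 * r)
        = (\<Prod>i<2 * r. \<Sum>v\<in>{1..int V}. Legendre (x + v) (int p))" by simp
    also have "\<dots> = (\<Sum>t\<in>T. \<Prod>i<2 * r. Legendre (x + t i) (int p))"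
      unfolding T_def by (rule prod_sum_PiE) auto
    also have "\<dots> = (\<Sum>t\<in>T. Legendre (\<Prod>i<2 * r. x + t i) (int p))"
      by (simp add: Legendre_prod[OF p])
    finally show "(\<Sum>v\<in>{1..int V}. Legendre (x + v) (int p)) ^ (2 * r) = \<dots>" .
  qed
  also have "\<dots> = (\<Sum>t\<in>T. S t)" unfolding S_def by (rule sum.swap)
  also have "\<dots> = (\<Sum>t\<in>T - E. S t) + (\<Sum>t\<in>E. S t)"
    by (rule sum.subset_diff) (auto simp: E_def finT)
  finally have eq: "(\<Sum>x\<in>{0..<int p}. (\<Sum>v\<in>{1..int V}. Legendre (x + v) (int p)) ^ (2 * r))
      = (\<Sum>t\<in>T - E. S t) + (\<Sum>t\<in>E. S t)" .
  have "(\<Sum>t\<in>E. S t) \<le> (\<Sum>t\<in>E. int p)"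
  proof (rule sum_mono)
    fix t
    have "S t \<le> (\<Sum>x\<in>{0..<int p}. 1)" unfolding S_def
      by (intro sum_mono) (use abs_Legendre_le abs_le_D1 in blast)
    thus "S t \<le> int p" by simp
  qed
  hence "(\<Sum>t\<in>E. S t) \<le> int (card E * p)" by simp
  moreover have "card E * p \<le> V ^ r * r ^ (2 * r) * p"
    using card_even_tuples_le[of "{1..int V}" r] by (intro mult_le_mono1) (simp add: E_def T_def)
  hence "int (card E * p) \<le> int (V ^ r * r ^ (2 * r) * p)" by (rule of_nat_mono)
  ultimately have "(\<Sum>t\<in>E. S t) \<le> int (V ^ r * r ^ (2 * r) * p)" by (rule order.trans)
  hence "real_of_int (\<Sum>t\<in>E. S t) \<le> real_of_int (int (V ^ r * r ^ (2 * r) * p))" by (rule of_int_le_iff[THEN iffD2])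
  hence 1: "real_of_int (\<Sum>t\<in>E. S t) \<le> real r ^ (2 * r) * real V ^ r * real p" by (simp add: mult_ac)
  have "real_of_int (S t) \<le> 62 * real r * sqrt (real p)" if t: "t \<in> T - E" for t
  proof -
    obtain v where v: "odd (card {i \<in> {..<2 * r}. t i = v})" using t by (auto simp: E_def)
    have "{i \<in> {..<2 * r}. t i = v} \<noteq> {}"
    proof
      assume e: "{i \<in> {..<2 * r}. t i = v} = {}"
      show False using v unfolding e by simp
    qed
    moreover have tV: "t i \<in> {1..int V}" if "i < 2 * r" for i
    proof -
      have "t \<in> {..<2 * r} \<rightarrow>\<^sub>E {1..int V}" using t by (simp add: T_def)
      thus ?thesis using that by (intro PiE_mem[of t "{..<2 * r}"]) auto
    qed
    ultimately have vV: "v \<in> {1..int V}" by auto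
    have "\<bar>real_of_int (S t)\<bar> \<le> 31 * real (card {..<2 * r}) * sqrt (real p)"
      unfolding S_def
    proof (rule abs_sum_Legendre_prod_shifts_le[OF p])
      fix i assume i: "i \<in> {..<2 * r}" "t i \<noteq> v"
      have "\<bar>t i - v\<bar> < int p" using tV[of i] i vV V by auto
      moreover have "\<bar>int p\<bar> \<le> \<bar>t i - v\<bar>" if "int p dvd t i - v"
        by (rule dvd_imp_le_int[OF _ that]) (use i in auto)
      ultimately show "\<not> int p dvd t i - v" by auto
    qed (use v in auto)
    thus ?thesis by simp
  qed
  hence "(\<Sum>t\<in>T - E. real_of_int (S t)) \<le> (\<Sum>t\<in>T - E. 62 * real r * sqrt (real p))" by (intro sum_mono) auto
  also have "\<dots> = real (card (T - E)) * (62 * real r * sqrt (real p))" by simp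
  also have "\<dots> \<le> real (V ^ (2 * r)) * (62 * real r * sqrt (real p))"
    using card_mono[OF finT, of "T - E"] cT by (intro mult_right_mono) auto
  finally have 2: "real_of_int (\<Sum>t\<in>T - E. S t) \<le> 62 * real r * real V ^ (2 * r) * sqrt (real p)" by (simp add: mult_ac)
  show ?thesis unfolding eq of_int_add using 1 2 by linarith
qed

text \<open>Each induction step is Chebyshev's sum inequality:
  \<open>f y ^ Suc r - f z ^ Suc r\<close> and \<open>f y - f z\<close> have the same sign, and
  their products are summed over all pairs.\<close>

lemma power_mean_sum_le:
  fixes f :: "'a \<Rightarrow> real"
  assumes Z: "finite Z" and f: "\<And>z. z \<in> Z \<Longrightarrow> f z \<ge> 0"
  shows "(\<Sum>z\<in>Z. f z) ^ Suc r \<le> real (card Z) ^ r * (\<Sum>z\<in>Z. f z ^ Suc r)"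
proof (induction r)
  case (Suc r)
  define s where "s = (\<Sum>z\<in>Z. f z)"
  define q where "q = (\<Sum>z\<in>Z. f z ^ Suc r)"
  have "(0::real) \<le> (\<Sum>y\<in>Z. \<Sum>z\<in>Z. (f y ^ Suc r - f z ^ Suc r) * (f y - f z))"
  proof (intro sum_nonneg)
    fix y z assume yz: "y \<in> Z" "z \<in> Z"
    show "0 \<le> (f y ^ Suc r - f z ^ Suc r) * (f y - f z)"
    proof (cases "f y \<le> f z")
      case True
      hence "f y ^ Suc r \<le> f z ^ Suc r" using f yz by (intro power_mono) auto
      thus ?thesis using True by (intro mult_nonpos_nonpos) auto
    next
      case False
      hence "f z ^ Suc r \<le> f y ^ Suc r" using f yz by (intro power_mono) auto
      thus ?thesis using False by (intro mult_nonneg_nonneg) auto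
    qed
  qed
  also have "\<dots> = (\<Sum>y\<in>Z. \<Sum>z\<in>Z. f y ^ Suc (Suc r) - f y ^ Suc r * f z - (f y * f z ^ Suc r - f z ^ Suc (Suc r)))"
    by (intro sum.cong refl) (simp add: algebra_simps)
  also have "\<dots> = 2 * (real (card Z) * (\<Sum>z\<in>Z. f z ^ Suc (Suc r)) - q * s)"
    unfolding s_def q_def sum_subtractf sum_product
    by (simp add: sum_distrib_left sum_distrib_right sum.swap[of "\<lambda>y z. f y * (f z * f z ^ r)"] sum_negf mult_ac)
  finally have ch: "q * s \<le> real (card Z) * (\<Sum>z\<in>Z. f z ^ Suc (Suc r))" by simp
  have s0: "s \<ge> 0" unfolding s_def using f by (intro sum_nonneg) auto
  have "s ^ Suc (Suc r) = s ^ Suc r * s" by simp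
  also have "\<dots> \<le> (real (card Z) ^ r * q) * s" using Suc.IH s0 unfolding s_def q_def by (intro mult_right_mono) auto
  also have "\<dots> = real (card Z) ^ r * (q * s)" by simp
  also have "\<dots> \<le> real (card Z) ^ r * (real (card Z) * (\<Sum>z\<in>Z. f z ^ Suc (Suc r)))"
    by (intro mult_left_mono ch) simp
  finally show ?case by (simp add: s_def mult_ac)
qed simp


section \<open>Burgess' inequality\<close>

lemma abs_sum_shift_diff_le:
  fixes f :: "nat \<Rightarrow> int"
  assumes "\<And>n. \<bar>f n\<bar> \<le> 1"
  shows "\<bar>(\<Sum>n\<in>{1..H}. f (n + c)) - (\<Sum>n\<in>{1..H}. f n)\<bar> \<le> 2 * int c"
proof (induction c)
  case (Suc c)
  have "(\<Sum>n\<in>{1..H}. f (n + Suc c)) - (\<Sum>n\<in>{1..H}. f (n + c)) = (\<Sum>n\<in>{1..H}. f (Suc n + c) - f (n + c))"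
    by (simp add: sum_subtractf)
  also have "\<dots> = f (Suc H + c) - f (1 + c)" by (rule sum_Suc_diff) simp
  finally have "\<bar>(\<Sum>n\<in>{1..H}. f (n + Suc c)) - (\<Sum>n\<in>{1..H}. f (n + c))\<bar> \<le> 2"
    using assms[of "Suc H + c"] assms[of "1 + c"] by linarith
  moreover have "\<bar>x - z\<bar> \<le> 2 * int (Suc c)" if "\<bar>x - y\<bar> \<le> 2" "\<bar>y - z\<bar> \<le> 2 * int c" for x y z
    using that by simp
  ultimately show ?case using Suc.IH by blast
qed simp

lemma harmonic_sum_le: "A \<ge> 1 \<Longrightarrow> (\<Sum>k\<in>{1..A}. 1 / real k) \<le> 1 + ln (real A)"
proof (induction A rule: dec_induct)
  case (step n)
  have "ln (real n / real (Suc n)) \<le> real n / real (Suc n) - 1"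
    using step by (intro ln_le_minus_one) auto
  also have "\<dots> = - (1 / real (Suc n))" by (simp add: field_simps)
  finally have "1 / real (Suc n) \<le> ln (real (Suc n)) - ln (real n)"
    using step by (simp add: ln_div)
  thus ?case using step by simp
qed simp

text \<open>Equal cross products are equal fractions, so \<open>a = d \<alpha>\<close>,
  \<open>a' = d \<beta>\<close>, \<open>n = \<alpha> m\<close>, \<open>n' = \<beta> m\<close> with
  \<open>\<alpha>\<close>, \<open>\<beta>\<close> coprime. For each value \<open>\<mu>\<close> of
  their maximum there are at most \<open>2 \<mu>\<close> pairs and
  \<open>(A / \<mu>) (H / \<mu>)\<close> choices of \<open>d\<close> and \<open>m\<close>; a
  harmonic sum remains.\<close>

lemma card_equal_cross_products_le:
  fixes A H :: nat
  assumes A: "A \<ge> 1"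
  defines "Z \<equiv> {1..A} \<times> {1..H}"
  shows "real (card {(z, z'). z \<in> Z \<and> z' \<in> Z \<and> snd z * fst z' = snd z' * fst z})
    \<le> 2 * real A * real H * (1 + ln (real A))"
proof -
  define Q where "Q = {(z, z'). z \<in> Z \<and> z' \<in> Z \<and> snd z * fst z' = snd z' * fst z}"
  define X where "X = (\<lambda>\<mu>::nat. {\<mu>} \<times> {1..\<mu>} \<union> {1..\<mu>} \<times> {\<mu>})"
  define P where "P = (\<Union>\<mu>\<in>{1..A}. X \<mu> \<times> {1..A div \<mu>} \<times> {1..H div \<mu>})"
  define F where "F = (\<lambda>((\<alpha>, \<beta>), (d, m)). ((d * \<alpha>, \<alpha> * m), (d * \<beta>, \<beta> * m)) :: (nat \<times> nat) \<times> (nat \<times> nat))"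
  have finP: "finite P" unfolding P_def X_def by auto
  have "Q \<subseteq> F ` P"
  proof
    fix q assume "q \<in> Q"
    then obtain a n a' n' where q: "q = ((a, n), (a', n'))" and r: "a \<in> {1..A}" "n \<in> {1..H}" "a' \<in> {1..A}" "n' \<in> {1..H}"
      and eq: "n * a' = n' * a" by (auto simp: Q_def Z_def)
    define d where "d = gcd a a'"
    obtain \<alpha> \<beta> where ab: "a = d * \<alpha>" "a' = d * \<beta>" "coprime \<alpha> \<beta>"
      using gcd_coprime_exists[of a a'] r unfolding d_def by (auto simp: mult.commute)
    have d0: "d > 0" using r by (simp add: d_def)
    have "n * \<beta> = n' * \<alpha>" using eq d0 unfolding ab by simp
    hence "\<alpha> dvd n * \<beta>" by simp
    hence "\<alpha> dvd n" using ab(3) by (simp add: coprime_dvd_mult_left_iff)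
    then obtain m where m: "n = \<alpha> * m" by (elim dvdE)
    have a0: "\<alpha> > 0" "\<beta> > 0" using r ab by (auto intro: Nat.gr0I)
    have "\<alpha> * (m * \<beta>) = \<alpha> * n'" using \<open>n * \<beta> = n' * \<alpha>\<close> m by (simp add: mult_ac)
    hence n': "n' = \<beta> * m" using a0 by (simp add: mult.commute)
    define \<mu> where "\<mu> = max \<alpha> \<beta>"
    have \<mu>0: "\<mu> > 0" using a0 by (simp add: \<mu>_def)
    have dA: "d * \<mu> \<le> A" using r ab by (auto simp: \<mu>_def max_def)
    have mH: "m * \<mu> \<le> H" using r m n' by (auto simp: \<mu>_def max_def mult.commute)
    have "1 * \<mu> \<le> d * \<mu>" using d0 by (intro mult_le_mono1) simp
    hence "\<mu> \<le> A" using dA by linarith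
    hence "\<mu> \<in> {1..A}" using \<mu>0 by auto
    moreover have "(\<alpha>, \<beta>) \<in> X \<mu>" using a0 by (auto simp: X_def \<mu>_def max_def)
    moreover have "d \<in> {1..A div \<mu>}" using d0 dA \<mu>0 by (simp add: less_eq_div_iff_mult_less_eq Suc_le_eq)
    moreover have "m \<in> {1..H div \<mu>}"
    proof -
      have "m > 0" using r m by (auto intro: Nat.gr0I)
      thus ?thesis using mH \<mu>0 by (simp add: less_eq_div_iff_mult_less_eq Suc_le_eq)
    qed
    ultimately have "((\<alpha>, \<beta>), (d, m)) \<in> P" unfolding P_def by blast
    moreover have "F ((\<alpha>, \<beta>), (d, m)) = q" by (simp add: F_def q ab(1,2) m n')
    ultimately show "q \<in> F ` P" by force
  qed
  hence "card Q \<le> card P" using finP by (meson card_image_le card_mono finite_imageI order.trans)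
  also have "\<dots> \<le> (\<Sum>\<mu>\<in>{1..A}. card (X \<mu> \<times> {1..A div \<mu>} \<times> {1..H div \<mu>}))"
    unfolding P_def by (rule card_UN_le) simp
  also have "\<dots> \<le> (\<Sum>\<mu>\<in>{1..A}. 2 * \<mu> * ((A div \<mu>) * (H div \<mu>)))"
  proof (rule sum_mono)
    fix \<mu> :: nat
    have "card (X \<mu>) \<le> card ({\<mu>} \<times> {1..\<mu>}) + card ({1..\<mu>} \<times> {\<mu>})" unfolding X_def by (rule card_Un_le)
    hence "card (X \<mu>) \<le> 2 * \<mu>" by (simp add: card_cartesian_product)
    thus "card (X \<mu> \<times> {1..A div \<mu>} \<times> {1..H div \<mu>}) \<le> 2 * \<mu> * ((A div \<mu>) * (H div \<mu>))"
      by (simp only: card_cartesian_product card_atLeastAtMost diff_Suc_1 mult_le_mono1)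
  qed
  finally have "real (card Q) \<le> (\<Sum>\<mu>\<in>{1..A}. real (2 * \<mu> * ((A div \<mu>) * (H div \<mu>))))"
    by (metis of_nat_le_iff of_nat_sum)
  also have "\<dots> \<le> (\<Sum>\<mu>\<in>{1..A}. 2 * real A * real H * (1 / real \<mu>))"
  proof (rule sum_mono)
    fix \<mu> assume "\<mu> \<in> {1..A}"
    hence \<mu>: "real \<mu> > 0" by simp
    have "real (2 * \<mu> * ((A div \<mu>) * (H div \<mu>))) \<le> 2 * real \<mu> * ((real A / real \<mu>) * (real H / real \<mu>))"
      unfolding of_nat_mult by (intro mult_mono of_nat_div_le_of_nat order.refl) auto
    also have "\<dots> = 2 * real A * real H * (1 / real \<mu>)" using \<mu> by (simp add: field_simps)
    finally show "real (2 * \<mu> * ((A div \<mu>) * (H div \<mu>))) \<le> \<dots>" .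
  qed
  also have "\<dots> = 2 * real A * real H * (\<Sum>\<mu>\<in>{1..A}. 1 / real \<mu>)" by (rule sum_distrib_left[symmetric])
  also have "\<dots> \<le> 2 * real A * real H * (1 + ln (real A))"
    by (intro mult_left_mono harmonic_sum_le A) simp
  finally show ?thesis by (simp add: Q_def)
qed

text \<open>The power mean inequality gives the exponent \<open>r\<close>, and Cauchy-Schwarz
  doubles it. The weight \<open>\<nu> x\<close> is the number of preimages of \<open>x\<close>, so
  the sum of its squares counts the pairs with equal image.\<close>

lemma burgess_holder:
  fixes \<phi> :: "'a \<Rightarrow> 'b" and T :: "'b \<Rightarrow> real"
  assumes Z: "finite Z" and R: "finite R" and sub: "\<phi> ` Z \<subseteq> R" and T: "\<And>x. T x \<ge> 0" and r: "r \<ge> 1"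
  shows "(\<Sum>z\<in>Z. T (\<phi> z)) ^ (2 * r) \<le> real (card Z) ^ (2 * (r - 1))
     * real (card {(z, z'). z \<in> Z \<and> z' \<in> Z \<and> \<phi> z = \<phi> z'}) * (\<Sum>x\<in>R. T x ^ (2 * r))"
proof -
  obtain k where k: "r = Suc k" using r by (cases r) auto
  define \<nu> where "\<nu> = (\<lambda>x. real (card {z \<in> Z. \<phi> z = x}))"
  have "(\<Sum>z\<in>Z. T (\<phi> z)) ^ r \<le> real (card Z) ^ k * (\<Sum>z\<in>Z. T (\<phi> z) ^ r)"
    unfolding k using power_mean_sum_le[OF Z, of "\<lambda>z. T (\<phi> z)" k] T by blast
  also have "(\<Sum>z\<in>Z. T (\<phi> z) ^ r) = (\<Sum>x\<in>R. \<nu> x * T x ^ r)"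
    unfolding \<nu>_def by (rule sum_fun_comp[OF Z R sub, of "\<lambda>x. T x ^ r"])
  finally have 1: "(\<Sum>z\<in>Z. T (\<phi> z)) ^ r \<le> real (card Z) ^ k * (\<Sum>x\<in>R. \<nu> x * T x ^ r)" .
  have "((\<Sum>z\<in>Z. T (\<phi> z)) ^ r)\<^sup>2 \<le> (real (card Z) ^ k * (\<Sum>x\<in>R. \<nu> x * T x ^ r))\<^sup>2"
    using 1 T by (intro power_mono) (auto intro: sum_nonneg zero_le_power)
  also have "\<dots> = (real (card Z) ^ k)\<^sup>2 * (\<Sum>x\<in>R. \<nu> x * T x ^ r)\<^sup>2" by (rule power_mult_distrib)
  also have "\<dots> \<le> (real (card Z) ^ k)\<^sup>2 * ((\<Sum>x\<in>R. (\<nu> x)\<^sup>2) * (\<Sum>x\<in>R. (T x ^ r)\<^sup>2))"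
    by (intro mult_left_mono Cauchy_Schwarz_ineq_sum) simp
  also have "(\<Sum>x\<in>R. (\<nu> x)\<^sup>2) = real (card {(z, z'). z \<in> Z \<and> z' \<in> Z \<and> \<phi> z = \<phi> z'})"
  proof -
    have "(\<Sum>x\<in>R. (\<nu> x)\<^sup>2) = (\<Sum>x\<in>R. real (card {z \<in> Z. \<phi> z = x}) * \<nu> x)"
      by (simp add: \<nu>_def power2_eq_square)
    also have "\<dots> = (\<Sum>z\<in>Z. \<nu> (\<phi> z))" by (rule sum_fun_comp[OF Z R sub, symmetric])
    also have "\<dots> = real (\<Sum>z\<in>Z. card {z' \<in> Z. \<phi> z' = \<phi> z})" by (simp add: \<nu>_def)
    also have "(\<Sum>z\<in>Z. card {z' \<in> Z. \<phi> z' = \<phi> z}) = card (SIGMA z:Z. {z' \<in> Z. \<phi> z' = \<phi> z})"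
      using Z by (subst card_SigmaI) auto
    also have "(SIGMA z:Z. {z' \<in> Z. \<phi> z' = \<phi> z}) = {(z, z'). z \<in> Z \<and> z' \<in> Z \<and> \<phi> z = \<phi> z'}" by auto
    finally show ?thesis .
  qed
  finally show ?thesis unfolding k by (simp only: power_even_eq[symmetric] diff_Suc_1 mult.assoc)
qed

text \<open>Shifting \<open>n\<close> by \<open>a b\<close> changes the sum by at most
  \<open>2 A B\<close>, and \<open>n + a b = a (n / a + b)\<close> modulo \<open>p\<close> lets the
  symbol of \<open>a\<close> factor out. Averaging over \<open>a\<close> and \<open>b\<close> leaves
  short sums over \<open>b\<close> starting at the residues \<open>n / a\<close>, to which Hoelder's
  inequality and the moment bound apply. As \<open>A * H < p\<close>, two such residues agree only
  if the fractions \<open>n / a\<close> are equal as rational numbers.\<close>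

lemma burgess_inequality:
  assumes p: "prime (p::nat)" "odd p" and r: "r \<ge> 1" and A: "A \<ge> 1" and B: "B \<ge> 1" "B \<le> p"
    and H: "H \<ge> 1" "A * H < p"
  obtains W :: real where "W \<ge> 0"
    "\<bar>real_of_int (\<Sum>n\<in>{1..H}. Legendre (int n) (int p))\<bar> \<le> 2 * real A * real B + W"
    "(real A * real B * W) ^ (2 * r) \<le> (real A * real H) ^ (2 * (r - 1)) * (2 * real A * real H * (1 + ln (real A)))
       * (real r ^ (2 * r) * real B ^ r * real p + 62 * real r * real B ^ (2 * r) * sqrt (real p))"
proof -
  define S where "S = (\<Sum>n\<in>{1..H}. Legendre (int n) (int p))"
  define Z where "Z = {1..A} \<times> {1..H}"
  define R where "R = {0..<int p}"
  define T where "T = (\<lambda>x. \<bar>\<Sum>b\<in>{1..int B}. Legendre (x + b) (int p)\<bar>)"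
  have pi: "prime (int p)" using p by simp
  have p0: "int p > 0" using prime_gt_0_nat[OF p(1)] by simp
  have "A * 1 \<le> A * H" using H by (intro mult_le_mono2)
  hence Ap: "A < p" using H by linarith
  have nd: "\<not> int p dvd int a" if "a \<in> {1..A}" for a
    using that Ap by (auto dest: dvd_imp_le)
  have "\<exists>z. [int a * z = 1] (mod int p)" if "a \<in> {1..A}" for a
  proof -
    have "coprime (int a) (int p)" using prime_imp_coprime[OF pi nd[OF that]] by (simp only: coprime_commute)
    thus ?thesis using cong_modular_inverse1 by blast
  qed
  then obtain iv where iv: "\<And>a. a \<in> {1..A} \<Longrightarrow> [int a * iv a = 1] (mod int p)" by metis
  define \<phi> where "\<phi> = (\<lambda>(a, n). (int n * iv a) mod int p)"
  have sub: "\<phi> ` Z \<subseteq> R" using p0 by (auto simp: \<phi>_def R_def)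
  have Tphi: "\<bar>\<Sum>b\<in>{1..B}. Legendre (int (n + a * b)) (int p)\<bar> = T (\<phi> (a, n))" if a: "a \<in> {1..A}" for a n
  proof -
    have e: "Legendre (int n + int a * b) (int p) = Legendre (int a) (int p) * Legendre (\<phi> (a, n) + b) (int p)" for b
    proof -
      have "[int n * 1 + int a * b = int n * (int a * iv a) + int a * b] (mod int p)"
        by (intro cong_add cong_scalar_left cong_sym[OF iv[OF a]] cong_refl)
      hence "[int n + int a * b = int a * (int n * iv a + b)] (mod int p)" by (simp add: algebra_simps)
      moreover have "[int a * (int n * iv a + b) = int a * (\<phi> (a, n) + b)] (mod int p)"
        by (intro cong_add cong_scalar_left cong_refl) (simp add: \<phi>_def cong_sym)
      ultimately have "Legendre (int n + int a * b) (int p) = Legendre (int a * (\<phi> (a, n) + b)) (int p)"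
        by (intro Legendre_cong) (rule cong_trans)
      thus ?thesis by (simp add: Legendre_mult[OF p])
    qed
    have "(\<Sum>b\<in>{1..B}. Legendre (int (n + a * b)) (int p)) = (\<Sum>b\<in>{1..int B}. Legendre (int n + int a * b) (int p))"
      by (rule sum.reindex_bij_witness[of _ nat int]) auto
    also have "\<dots> = Legendre (int a) (int p) * (\<Sum>b\<in>{1..int B}. Legendre (\<phi> (a, n) + b) (int p))"
      unfolding e by (rule sum_distrib_left[symmetric])
    finally have "\<bar>\<Sum>b\<in>{1..B}. Legendre (int (n + a * b)) (int p)\<bar> = \<bar>Legendre (int a) (int p)\<bar> * T (\<phi> (a, n))"
      by (simp add: T_def abs_mult)
    moreover have "\<bar>Legendre (int a) (int p)\<bar> = 1"
      using nd[OF a] Legendre_values[of "int a" "int p"] by (auto simp: Legendre_eq_0_iff)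
    ultimately show ?thesis by simp
  qed
  define U where "U = (\<Sum>z\<in>Z. T (\<phi> z))"
  have "\<bar>int (A * B) * S\<bar> \<le> U + int (A * B) * (2 * int (A * B))"
  proof -
    define G where "G = (\<lambda>a b. \<Sum>n\<in>{1..H}. Legendre (int (n + a * b)) (int p))"
    have "int (A * B) * S = (\<Sum>a\<in>{1..A}. \<Sum>b\<in>{1..B}. S)" by simp
    also have "\<dots> = (\<Sum>a\<in>{1..A}. \<Sum>b\<in>{1..B}. G a b) - (\<Sum>a\<in>{1..A}. \<Sum>b\<in>{1..B}. G a b - S)"
      by (simp add: sum_subtractf)
    finally have "\<bar>int (A * B) * S\<bar> \<le> \<bar>\<Sum>a\<in>{1..A}. \<Sum>b\<in>{1..B}. G a b\<bar> + \<bar>\<Sum>a\<in>{1..A}. \<Sum>b\<in>{1..B}. G a b - S\<bar>"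
      by linarith
    also have "\<bar>\<Sum>a\<in>{1..A}. \<Sum>b\<in>{1..B}. G a b - S\<bar> \<le> (\<Sum>a\<in>{1..A}. \<Sum>b\<in>{1..B}. 2 * int (A * B))"
    proof (intro order.trans[OF sum_abs] sum_mono)
      fix a b assume ab: "a \<in> {1..A}" "b \<in> {1..B}"
      have "\<bar>G a b - S\<bar> \<le> 2 * int (a * b)"
        unfolding G_def S_def by (rule abs_sum_shift_diff_le[where f = "\<lambda>n. Legendre (int n) (int p)"]) (rule abs_Legendre_le)
      also have "a * b \<le> A * B" using ab by (intro mult_le_mono) auto
      finally show "\<bar>G a b - S\<bar> \<le> 2 * int (A * B)" by simp
    qed
    also have "\<dots> = int (A * B) * (2 * int (A * B))" by simp
    also have "\<bar>\<Sum>a\<in>{1..A}. \<Sum>b\<in>{1..B}. G a b\<bar> \<le> U"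
    proof -
      have "(\<Sum>a\<in>{1..A}. \<Sum>b\<in>{1..B}. G a b) = (\<Sum>a\<in>{1..A}. \<Sum>n\<in>{1..H}. \<Sum>b\<in>{1..B}. Legendre (int (n + a * b)) (int p))"
        unfolding G_def by (intro sum.cong refl sum.swap)
      also have "\<bar>\<dots>\<bar> \<le> (\<Sum>a\<in>{1..A}. \<bar>\<Sum>n\<in>{1..H}. \<Sum>b\<in>{1..B}. Legendre (int (n + a * b)) (int p)\<bar>)"
        by (rule sum_abs)
      also have "\<dots> \<le> (\<Sum>a\<in>{1..A}. \<Sum>n\<in>{1..H}. \<bar>\<Sum>b\<in>{1..B}. Legendre (int (n + a * b)) (int p)\<bar>)"
        by (rule sum_mono) (rule sum_abs)
      also have "\<dots> = (\<Sum>a\<in>{1..A}. \<Sum>n\<in>{1..H}. T (\<phi> (a, n)))"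
        by (intro sum.cong refl Tphi)
      also have "\<dots> = U" unfolding U_def Z_def by (simp add: sum.cartesian_product)
      finally show ?thesis .
    qed
    finally show ?thesis by simp
  qed
  hence "real_of_int \<bar>int (A * B) * S\<bar> \<le> real_of_int (U + int (A * B) * (2 * int (A * B)))"
    by (rule of_int_le_iff[THEN iffD2])
  hence S1: "real A * real B * \<bar>real_of_int S\<bar> \<le> real_of_int U + real A * real B * (2 * real A * real B)"
    by (simp add: abs_mult)
  define W where "W = real_of_int U / (real A * real B)"
  have AB: "real A * real B > 0" using A B by simp
  have U0: "U \<ge> 0" unfolding U_def T_def by (intro sum_nonneg) simp
  have ABW: "real A * real B * W = real_of_int U" using A B by (simp add: W_def)
  have "real A * real B * \<bar>real_of_int S\<bar> \<le> real A * real B * (2 * real A * real B + W)"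
    using S1 unfolding distrib_left ABW by linarith
  hence 1: "\<bar>real_of_int S\<bar> \<le> 2 * real A * real B + W" using AB by (simp only: mult_le_cancel_left_pos)
  have cardZ: "real (card Z) = real A * real H" by (simp add: Z_def card_cartesian_product)
  define Q where "Q = {(z, z'). z \<in> Z \<and> z' \<in> Z \<and> \<phi> z = \<phi> z'}"
  define Q' where "Q' = {(z, z'). z \<in> Z \<and> z' \<in> Z \<and> snd z * fst z' = snd z' * fst z}"
  have "Q \<subseteq> Q'"
  proof
    fix q assume "q \<in> Q"
    then obtain a n a' n' where q: "q = ((a, n), (a', n'))" and r: "a \<in> {1..A}" "n \<in> {1..H}" "a' \<in> {1..A}" "n' \<in> {1..H}"
      and eq: "[int n * iv a = int n' * iv a'] (mod int p)" by (auto simp: Q_def Z_def \<phi>_def Cong.cong_def)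
    have "[(int n * int a') * 1 = (int n * int a') * (int a * iv a)] (mod int p)"
      by (intro cong_scalar_left cong_sym[OF iv] r)
    also have "(int n * int a') * (int a * iv a) = (int a * int a') * (int n * iv a)" by simp
    also have "[(int a * int a') * (int n * iv a) = (int a * int a') * (int n' * iv a')] (mod int p)"
      by (intro cong_scalar_left eq)
    also have "(int a * int a') * (int n' * iv a') = (int n' * int a) * (int a' * iv a')" by simp
    also have "[(int n' * int a) * (int a' * iv a') = (int n' * int a) * 1] (mod int p)"
      by (intro cong_scalar_left iv r)
    finally have "[int (n * a') = int (n' * a)] (mod int p)" by simp
    hence c: "[n * a' = n' * a] (mod p)" by (simp only: cong_int_iff)
    have "n * a' \<le> H * A" "n' * a \<le> H * A" using r by (auto intro!: mult_le_mono)
    hence "n * a' < p" "n' * a < p" using H(2) by (simp_all add: mult.commute)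
    hence "n * a' = n' * a" using c by (simp add: cong_less_modulus_unique_nat)
    thus "q \<in> Q'" using r by (simp add: q Q'_def Z_def)
  qed
  moreover have "finite Q'" by (rule finite_subset[of _ "Z \<times> Z"]) (auto simp: Q'_def Z_def)
  ultimately have "card Q \<le> card Q'" by (intro card_mono)
  moreover have "real (card Q') \<le> 2 * real A * real H * (1 + ln (real A))"
    unfolding Q'_def Z_def by (rule card_equal_cross_products_le[OF A])
  ultimately have cardQ: "real (card Q) \<le> 2 * real A * real H * (1 + ln (real A))" by linarith
  have mom: "(\<Sum>x\<in>R. real_of_int (T x) ^ (2 * r)) \<le> real r ^ (2 * r) * real B ^ r * real p + 62 * real r * real B ^ (2 * r) * sqrt (real p)"
    using Legendre_moment_le[OF p B(2), of r] unfolding R_def T_def by (simp add: power_even_abs)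
  have "real_of_int U ^ (2 * r) = (\<Sum>z\<in>Z. real_of_int (T (\<phi> z))) ^ (2 * r)" by (simp add: U_def)
  also have "\<dots> \<le> real (card Z) ^ (2 * (r - 1)) * real (card Q) * (\<Sum>x\<in>R. real_of_int (T x) ^ (2 * r))"
    unfolding Q_def by (rule burgess_holder[OF _ _ sub _ r, where T = "\<lambda>x. real_of_int (T x)"]) (auto simp: Z_def R_def T_def)
  also have "\<dots> \<le> (real A * real H) ^ (2 * (r - 1)) * (2 * real A * real H * (1 + ln (real A)))
       * (real r ^ (2 * r) * real B ^ r * real p + 62 * real r * real B ^ (2 * r) * sqrt (real p))"
    unfolding cardZ using cardQ mom A
    by (intro mult_mono mult_nonneg_nonneg sum_nonneg) (auto simp: zero_le_even_power)
  finally show ?thesis using that[of W] 1 U0 AB unfolding S_def ABW by (simp add: W_def)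
qed


section \<open>Optimising the parameters\<close>

lemma power_le_of_le_exp:
  fixes W N :: real
  assumes "W \<ge> 0" "N \<ge> 0" "r \<ge> 1" "W ^ (2 * r) \<le> N ^ (2 * r) * exp u" "u \<le> 2 * real r * v"
  shows "W \<le> N * exp v"
proof -
  have "exp u \<le> exp (2 * real r * v)" using assms(5) by simp
  also have "\<dots> = exp v ^ (2 * r)" by (simp flip: exp_of_nat_mult)
  finally have "N ^ (2 * r) * exp u \<le> N ^ (2 * r) * exp v ^ (2 * r)"
    using assms(2) by (intro mult_left_mono) auto
  hence "W ^ (2 * r) \<le> (N * exp v) ^ (2 * r)" using assms(4) by (simp add: power_mult_distrib)
  thus ?thesis using assms by (intro power_mono_iff[THEN iffD1, of W "N * exp v" "2 * r"]) auto
qed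

lemma nat_floor_bounds:
  fixes y :: real
  assumes "y \<ge> 1"
  shows "real (nat \<lfloor>y\<rfloor>) \<le> y" "y / 2 \<le> real (nat \<lfloor>y\<rfloor>)" "y - 1 \<le> real (nat \<lfloor>y\<rfloor>)" "nat \<lfloor>y\<rfloor> \<ge> 1"
proof -
  have f: "\<lfloor>y\<rfloor> \<ge> 1" using assms by simp
  hence "real (nat \<lfloor>y\<rfloor>) = of_int \<lfloor>y\<rfloor>" by simp
  moreover have "real_of_int \<lfloor>y\<rfloor> \<ge> 1" using f by simp
  ultimately show "real (nat \<lfloor>y\<rfloor>) \<le> y" "y / 2 \<le> real (nat \<lfloor>y\<rfloor>)" "y - 1 \<le> real (nat \<lfloor>y\<rfloor>)" "nat \<lfloor>y\<rfloor> \<ge> 1"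
    using floor_correct[of y] f by linarith+
qed

text \<open>
  As a function of \<open>s = 1 / r\<close>, the exponent divided by \<open>2 r\<close> is \<open>2 l s + L / 4 * (s - 1 / r0)\<^sup>2 - l\<close>.
\<close>

lemma burgess_exponent_le:
  fixes L l r r0 :: real
  assumes L: "L > 0" and l: "l > 0" and r0: "r0 = sqrt (L / l) / 2" and r: "r0 \<le> r" "r \<le> r0 + 1"
    and small: "4 * l * sqrt (l / L) \<le> 1" "4 * l ^ 2 \<le> L"
  shows "4 * l + L / (2 * r) - 2 * sqrt (L * l) \<le> 2 * r * (2 - l)"
proof -
  define a b where "a = sqrt L" and "b = sqrt l"
  have a: "a > 0" "L = a * a" and b: "b > 0" "l = b * b" using L l by (simp_all add: a_def b_def)
  have r0': "r0 = a / (2 * b)" unfolding r0 a_def b_def by (simp add: real_sqrt_divide)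
  have r00: "r0 > 0" using a b by (simp add: r0')
  define s s0 where "s = 1 / r" and "s0 = 1 / r0"
  have s0: "s0 = 2 * b / a" using a b by (simp add: s0_def r0')
  have s: "s > 0" "s \<le> s0" using r r00 by (auto simp: s_def s0_def frac_le)
  \<comment> \<open>Rounding \<open>r0\<close> up to an integer moves \<open>1 / r\<close> by at
    most \<open>s0^2\<close>; in the quadratic part of the exponent this costs at most
    \<open>4 l^2 / L\<close>.\<close>
  have "s0 - s = (r - r0) * (1 / (r * r0))" using r r00 by (simp add: s_def s0_def field_simps)
  also have "\<dots> \<le> 1 * (1 / (r0 * r0))"
    using r r00 by (intro mult_mono divide_left_mono) auto
  finally have d: "s0 - s \<le> s0 * s0" by (simp add: s0_def)
  have "(s0 - s)\<^sup>2 \<le> (s0 * s0)\<^sup>2" using d s by (intro power_mono) auto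
  hence "L / 4 * (s0 - s)\<^sup>2 \<le> L / 4 * (s0 * s0)\<^sup>2" using L by (intro mult_left_mono) auto
  also have "\<dots> = 4 * l ^ 2 / L" using a b by (simp add: s0 a(2) b(2) field_simps power2_eq_square)
  also have "\<dots> \<le> 1" using small(2) L by simp
  finally have 1: "L / 4 * (s0 - s)\<^sup>2 \<le> 1" .
  have "2 * l * s \<le> 2 * l * s0" using s l by simp
  also have "\<dots> = 4 * l * sqrt (l / L)" by (simp add: s0 a_def b_def real_sqrt_divide)
  finally have 2: "2 * l * s \<le> 1" using small(1) by linarith
  have sq: "sqrt (L * l) = a * b" by (simp add: a_def b_def real_sqrt_mult)
  have "L / 4 * (s0 - s)\<^sup>2 = l - a * b * s + L / 4 * s\<^sup>2"
    using a b by (simp add: s0 a(2) b(2) field_simps power2_eq_square)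
  hence "2 * l * s + (L / 4 * s\<^sup>2 - a * b * s) \<le> 2 - l" using 1 2 by linarith
  hence "2 * r * (2 * l * s + (L / 4 * s\<^sup>2 - a * b * s)) \<le> 2 * r * (2 - l)"
    using r r00 by (intro mult_left_mono) auto
  moreover have "2 * r * (2 * l * s + (L / 4 * s\<^sup>2 - a * b * s)) = 4 * l + L / (2 * r) - 2 * sqrt (L * l)"
    unfolding sq using r r00 by (simp add: s_def field_simps power2_eq_square)
  ultimately show ?thesis by simp
qed

definition burgess_length :: "real \<Rightarrow> real" where
  "burgess_length L = exp (L / 4 + sqrt (L * ln L))"

lemma burgess_bound_aux:
  fixes p :: nat
  defines "L \<equiv> ln (real p)"
  assumes p: "prime p" "odd p"
    and L: "L \<ge> 3"
    and e2: "sqrt (L / ln L) / 2 + 1 \<le> sqrt L" and e3: "2016 * sqrt L \<le> L"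
    and e4: "2 * L * exp (sqrt (L * ln L)) \<le> exp L" and e5: "2 * L ^ 2 \<le> exp (L / 4)"
    and e6: "L / 2 + 2 * sqrt (L * ln L) < L"
    and e7: "4 * ln L * sqrt (ln L / L) \<le> 1" and e8: "4 * ln L ^ 2 \<le> L"
  shows "\<bar>real_of_int (\<Sum>n\<in>{1..nat \<lfloor>burgess_length L\<rfloor>}. Legendre (int n) (int p))\<bar> \<le> 11 * burgess_length L / L"
proof -
  define l where "l = ln L"
  define E where "E = sqrt (L * l)"
  define r0 where "r0 = sqrt (L / l) / 2"
  define r where "r = nat \<lceil>r0\<rceil>"
  define h where "h = burgess_length L"
  \<comment> \<open>\<open>t\<close> is \<open>p^(1 / (2 r))\<close>. With \<open>B\<close> about
    \<open>r^2 t\<close> the two terms \<open>r^(2 r) B^r p\<close> and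
    \<open>B^(2 r) sqrt p\<close> of the moment bound balance, apart from the factor
    \<open>62 r\<close>. \<open>A\<close> is then as large as a shift error \<open>2 A B\<close> of
    at most \<open>2 h / L\<close> permits.\<close>
  define t where "t = exp (L / (2 * real r))"
  define B where "B = nat \<lceil>real r ^ 2 * t\<rceil>"
  define y where "y = h / (real B * L)"
  define A where "A = nat \<lfloor>y\<rfloor>"
  define H where "H = nat \<lfloor>h\<rfloor>"
  have p0: "real p > 0" using prime_gt_0_nat[OF p(1)] by simp
  have pL: "real p = exp L" using p0 by (simp add: L_def)
  have l0: "l > 0" unfolding l_def using L by (intro ln_gt_zero) auto
  have r00: "r0 > 0" using L l0 by (simp add: r0_def)
  have r: "r0 \<le> real r" "real r \<le> r0 + 1" "r \<ge> 1" using r00 unfolding r_def by linarith+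
  have rL: "real r \<le> sqrt L" using r(2) e2 by (simp add: r0_def l_def)
  have "real r ^ 2 \<le> sqrt L ^ 2" using rL by (intro power_mono) auto
  hence r2: "real r ^ 2 \<le> L" using L by simp
  have r2016: "2016 * real r \<le> L" using rL e3 by linarith
  have h: "h = exp (L / 4) * exp E" by (simp add: h_def burgess_length_def E_def l_def exp_add)
  have "L / (2 * real r) \<le> L / (2 * r0)" using r r00 L by (intro divide_left_mono) auto
  also have "\<dots> = E" using L l0 by (simp add: r0_def E_def real_sqrt_divide real_sqrt_mult field_simps)
  finally have tE: "t \<le> exp E" by (simp add: t_def)
  have t1: "t \<ge> 1" using L by (simp add: t_def)
  have "1 * 1 \<le> real r ^ 2 * t" using r(3) t1 by (intro mult_mono) auto
  hence B: "real r ^ 2 * t \<le> real B" "real B \<le> 2 * (real r ^ 2 * t)" "B \<ge> 1"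
    unfolding B_def by linarith+
  have "real r ^ 2 * t \<le> L * exp E" using r2 tE t1 L by (intro mult_mono) auto
  hence BE: "real B \<le> 2 * L * exp E" using B(2) by linarith
  hence "real B \<le> real p" using e4 unfolding pL E_def l_def by linarith
  hence Bp: "B \<le> p" by simp
  have BL1: "1 \<le> real B * L" using B(3) L mult_mono[of 1 "real B" 1 L] by simp
  have h1: "h \<ge> 1" unfolding h_def burgess_length_def using L by (simp add: ln_ge_zero)
  have "real B * L \<le> 2 * L * exp E * L" using BE L by (intro mult_right_mono) auto
  also have "\<dots> = 2 * L ^ 2 * exp E" by (simp add: power2_eq_square)
  also have "\<dots> \<le> h" unfolding h using e5 by (intro mult_right_mono) auto
  finally have y1: "y \<ge> 1" unfolding y_def using BL1 by (simp add: le_divide_eq)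
  have A: "real A \<le> y" "y / 2 \<le> real A" "A \<ge> 1" using nat_floor_bounds[OF y1] unfolding A_def by blast+
  have H: "real H \<le> h" "h / 2 \<le> real H" "H \<ge> 1" using nat_floor_bounds[OF h1] unfolding H_def by blast+
  have "h / (real B * L) \<le> h / 1" using BL1 h1 by (intro divide_left_mono) auto
  hence yh: "y \<le> h" by (simp add: y_def)
  have "real A * real H \<le> h * h" using A H yh by (intro mult_mono) auto
  also have "h * h = exp (L / 2 + 2 * sqrt (L * ln L))" by (simp add: h_def burgess_length_def flip: exp_add)
  also have "\<dots> < real p" unfolding pL using e6 by simp
  finally have "real (A * H) < real p" by simp
  hence AH: "A * H < p" by linarith
  have "real A \<le> real (A * H)" using H(3) mult_mono[of "real A" "real A" 1 "real H"] by simp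
  hence "real A \<le> real p" using AH by linarith
  hence "ln (real A) \<le> L" unfolding L_def using A(3) p0 by simp
  hence lnA: "1 + ln (real A) \<le> 2 * L" using L by linarith
  obtain W where W: "W \<ge> 0"
    "\<bar>real_of_int (\<Sum>n\<in>{1..H}. Legendre (int n) (int p))\<bar> \<le> 2 * real A * real B + W"
    "(real A * real B * W) ^ (2 * r) \<le> (real A * real H) ^ (2 * (r - 1)) * (2 * real A * real H * (1 + ln (real A)))
       * (real r ^ (2 * r) * real B ^ r * real p + 62 * real r * real B ^ (2 * r) * sqrt (real p))"
    using burgess_inequality[OF p r(3) A(3) B(3) Bp H(3) AH] .
  define q where "q = exp (L / 2)"
  have q: "q > 0" "real p = q * q" "sqrt (real p) = q"
    by (simp_all add: q_def pL flip: exp_add) (simp add: real_sqrt_unique power2_eq_square flip: exp_add)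
  have "t ^ r = q" using r(3) by (simp add: t_def q_def flip: exp_of_nat_mult)
  hence "real r ^ (2 * r) * q = (real r ^ 2 * t) ^ r" by (simp add: power_mult_distrib power_mult)
  also have "\<dots> \<le> real B ^ r" using B(1) t1 by (intro power_mono) auto
  finally have "real r ^ (2 * r) * q * (real B ^ r * q) \<le> real B ^ r * (real B ^ r * q)"
    using q by (intro mult_right_mono) auto
  hence m1: "real r ^ (2 * r) * real B ^ r * real p \<le> real B ^ (2 * r) * q"
    unfolding q(2) mult_2 power_add by (simp add: mult_ac)
  have "real B ^ (2 * r) * q \<le> real r * (real B ^ (2 * r) * q)"
    using r(3) q mult_right_mono[of 1 "real r" "real B ^ (2 * r) * q"] by simp
  hence m2: "real r ^ (2 * r) * real B ^ r * real p + 62 * real r * real B ^ (2 * r) * sqrt (real p)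
      \<le> 63 * real r * real B ^ (2 * r) * q"
    using m1 unfolding q(3) by linarith
  define a where "a = real A * real H"
  have a0: "a > 0" using A(3) H(3) by (simp add: a_def)
  have "(real A * real B * W) ^ (2 * r) \<le> a ^ (2 * (r - 1)) * (2 * a * (2 * L)) * (63 * real r * real B ^ (2 * r) * q)"
  proof (rule order.trans[OF W(3)])
    have "2 * a * (1 + ln (real A)) \<le> 2 * a * (2 * L)" using lnA a0 by (intro mult_left_mono) auto
    hence "2 * real A * real H * (1 + ln (real A)) \<le> 2 * a * (2 * L)" by (simp only: a_def mult.assoc)
    hence "(real A * real H) ^ (2 * (r - 1)) * (2 * real A * real H * (1 + ln (real A)))
        \<le> a ^ (2 * (r - 1)) * (2 * a * (2 * L))"
      unfolding a_def by (rule mult_left_mono) simp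
    thus "(real A * real H) ^ (2 * (r - 1)) * (2 * real A * real H * (1 + ln (real A)))
        * (real r ^ (2 * r) * real B ^ r * real p + 62 * real r * real B ^ (2 * r) * sqrt (real p))
      \<le> a ^ (2 * (r - 1)) * (2 * a * (2 * L)) * (63 * real r * real B ^ (2 * r) * q)"
      using m2 a0 L by (intro mult_mono[OF _ m2]) auto
  qed
  also have "\<dots> = a ^ (2 * (r - 1)) * a * (252 * L * real r * q * real B ^ (2 * r))" by simp
  finally have "(real A * real B * W) ^ (2 * r) * a \<le> a ^ (2 * (r - 1)) * a * (252 * L * real r * q * real B ^ (2 * r)) * a"
    using a0 by (intro mult_right_mono) auto
  also have "\<dots> = a ^ (2 * r) * (252 * L * real r * q * real B ^ (2 * r))"
  proof -
    have "2 * r = 2 * (r - 1) + 2" using r(3) by simp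
    hence "a ^ (2 * r) = a ^ (2 * (r - 1)) * a * a" by (metis power_add power2_eq_square mult.assoc)
    thus ?thesis by simp
  qed
  finally have "(real A * real B) ^ (2 * r) * (W ^ (2 * r) * a) \<le> (real A * real B) ^ (2 * r) * (real H ^ (2 * r) * (252 * L * real r * q))"
    by (simp add: a_def power_mult_distrib mult_ac)
  moreover have "(real A * real B) ^ (2 * r) > 0" using A(3) B(3) by simp
  ultimately have Wa: "W ^ (2 * r) * a \<le> real H ^ (2 * r) * (252 * L * real r * q)"
    by (simp only: mult_le_cancel_left_pos)
  have alow: "h * h \<le> a * (8 * real r ^ 2 * t * L)"
  proof -
    have "y / 2 * (h / 2) \<le> a" unfolding a_def using A H y1 h1 by (intro mult_mono) auto
    hence "y / 2 * (h / 2) * (4 * (real B * L)) \<le> a * (4 * (real B * L))" using L by (intro mult_right_mono) auto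
    moreover have "y / 2 * (h / 2) * (4 * (real B * L)) = h * h" using B(3) L unfolding y_def by (simp add: field_simps)
    moreover have "a * (4 * (real B * L)) \<le> a * (4 * (2 * (real r ^ 2 * t) * L))"
      using B(2) L a0 by (intro mult_left_mono mult_right_mono) auto
    moreover have "a * (4 * (2 * (real r ^ 2 * t) * L)) = a * (8 * real r ^ 2 * t * L)" by simp
    ultimately show ?thesis by linarith
  qed
  have "W ^ (2 * r) * (h * h) \<le> W ^ (2 * r) * (a * (8 * real r ^ 2 * t * L))" using W(1) alow by (intro mult_left_mono) auto
  also have "\<dots> = W ^ (2 * r) * a * (8 * real r ^ 2 * t * L)" by simp
  also have "\<dots> \<le> real H ^ (2 * r) * (252 * L * real r * q) * (8 * real r ^ 2 * t * L)"
    using Wa t1 L by (intro mult_right_mono) auto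
  also have "\<dots> = real H ^ (2 * r) * ((2016 * real r) * real r ^ 2 * L ^ 2 * (q * t))"
    by (simp add: power2_eq_square)
  \<comment> \<open>Here \<open>2016 = 252 * 8\<close>. Both \<open>2016 r\<close> and
    \<open>r^2\<close> are at most \<open>L\<close>, so all losses outside \<open>q t\<close> fit
    into \<open>L^4\<close>, the \<open>4 l\<close> of the exponent.\<close>
  also have "\<dots> \<le> real H ^ (2 * r) * (L * L * L ^ 2 * (q * t))"
    using r2016 r2 L q t1 by (intro mult_left_mono mult_right_mono mult_mono) auto
  also have "L * L * L ^ 2 = exp (4 * l)"
  proof -
    have "exp (4 * l) = exp l ^ 4" by (simp flip: exp_of_nat_mult)
    thus ?thesis using L by (simp add: l_def power4_eq_xxxx power2_eq_square)
  qed
  finally have "W ^ (2 * r) * (h * h) \<le> real H ^ (2 * r) * (exp (4 * l) * (q * t))" by simp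
  hence "W ^ (2 * r) * (h * h) / (h * h) \<le> real H ^ (2 * r) * (exp (4 * l) * (q * t)) / (h * h)"
    using h1 by (intro divide_right_mono) auto
  also have "W ^ (2 * r) * (h * h) / (h * h) = W ^ (2 * r)" using h1 by simp
  also have "real H ^ (2 * r) * (exp (4 * l) * (q * t)) / (h * h) = real H ^ (2 * r) * exp (4 * l + L / (2 * real r) - 2 * E)"
  proof -
    have "exp (4 * l) * (q * t) / (h * h) = exp (4 * l + L / (2 * real r) - 2 * E)"
      unfolding q_def t_def h by (simp flip: exp_add exp_diff)
    thus ?thesis by (metis times_divide_eq_right)
  qed
  finally have Wexp: "W ^ (2 * r) \<le> real H ^ (2 * r) * exp (4 * l + L / (2 * real r) - 2 * E)" .
  \<comment> \<open>After taking the root of order \<open>2 r\<close> this gives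
    \<open>W \<le> e^2 h / L \<le> 9 h / L\<close>; the shift error contributes the other 2 of the
    constant 11.\<close>
  have "4 * l + L / (2 * real r) - 2 * E \<le> 2 * real r * (2 - l)"
    unfolding E_def by (rule burgess_exponent_le[OF _ l0 r0_def r(1,2)]) (use L e7 e8 in \<open>auto simp: l_def\<close>)
  hence "W \<le> real H * exp (2 - l)" by (rule power_le_of_le_exp[OF W(1) _ r(3) Wexp, rotated]) simp
  also have "exp (2 - l) = exp 1 * exp 1 / L" using L by (simp add: exp_diff l_def flip: exp_add)
  also have "real H * (exp 1 * exp 1 / L) \<le> h * (3 * 3 / L)"
    using H L h1 exp_le by (intro mult_mono divide_right_mono) auto
  finally have "W \<le> 9 * (h / L)" by (simp add: mult.commute)
  moreover have "real A * real B \<le> h / L"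
  proof -
    have "real A * real B \<le> y * real B" using A by (intro mult_right_mono) auto
    also have "\<dots> = h / L" using B(3) by (simp add: y_def)
    finally show ?thesis .
  qed
  ultimately have "2 * (real A * real B) + W \<le> 11 * (h / L)" by linarith
  hence "2 * real A * real B + W \<le> 11 * h / L" by simp
  with W(2) show ?thesis unfolding H_def h_def by (rule order.trans)
qed

lemma burgess_bound:
  "eventually (\<lambda>p::nat. prime p \<longrightarrow> odd p \<longrightarrow>
     \<bar>real_of_int (\<Sum>n\<in>{1..nat \<lfloor>burgess_length (ln (real p))\<rfloor>}. Legendre (int n) (int p))\<bar>
        \<le> 11 * burgess_length (ln (real p)) / ln (real p)) sequentially"
proof -
  have "eventually (\<lambda>L::real. L \<ge> 3) at_top" by real_asymp
  moreover have "eventually (\<lambda>L::real. sqrt (L / ln L) / 2 + 1 \<le> sqrt L) at_top" by real_asymp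
  moreover have "eventually (\<lambda>L::real. 2016 * sqrt L \<le> L) at_top" by real_asymp
  moreover have "eventually (\<lambda>L::real. 2 * L * exp (sqrt (L * ln L)) \<le> exp L) at_top" by real_asymp
  moreover have "eventually (\<lambda>L::real. 2 * L ^ 2 \<le> exp (L / 4)) at_top" by real_asymp
  moreover have "eventually (\<lambda>L::real. L / 2 + 2 * sqrt (L * ln L) < L) at_top" by real_asymp
  moreover have "eventually (\<lambda>L::real. 4 * ln L * sqrt (ln L / L) \<le> 1) at_top" by real_asymp
  moreover have "eventually (\<lambda>L::real. 4 * ln L ^ 2 \<le> L) at_top" by real_asymp
  ultimately have "eventually (\<lambda>L::real. L \<ge> 3 \<and> sqrt (L / ln L) / 2 + 1 \<le> sqrt L \<and> 2016 * sqrt L \<le> L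
      \<and> 2 * L * exp (sqrt (L * ln L)) \<le> exp L \<and> 2 * L ^ 2 \<le> exp (L / 4)
      \<and> L / 2 + 2 * sqrt (L * ln L) < L \<and> 4 * ln L * sqrt (ln L / L) \<le> 1 \<and> 4 * ln L ^ 2 \<le> L) at_top"
    by (intro eventually_conj)
  moreover have "filterlim (\<lambda>p::nat. ln (real p)) at_top sequentially" by real_asymp
  ultimately have "eventually (\<lambda>p::nat. ln (real p) \<ge> 3 \<and> sqrt (ln (real p) / ln (ln (real p))) / 2 + 1 \<le> sqrt (ln (real p))
      \<and> 2016 * sqrt (ln (real p)) \<le> ln (real p)
      \<and> 2 * ln (real p) * exp (sqrt (ln (real p) * ln (ln (real p)))) \<le> exp (ln (real p))
      \<and> 2 * ln (real p) ^ 2 \<le> exp (ln (real p) / 4)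
      \<and> ln (real p) / 2 + 2 * sqrt (ln (real p) * ln (ln (real p))) < ln (real p)
      \<and> 4 * ln (ln (real p)) * sqrt (ln (ln (real p)) / ln (real p)) \<le> 1
      \<and> 4 * ln (ln (real p)) ^ 2 \<le> ln (real p)) sequentially"
    by (rule eventually_compose_filterlim)
  thus ?thesis by eventually_elim (use burgess_bound_aux in blast)
qed


section \<open>Mertens' estimates\<close>

lemma prod_primes_dvd:
  assumes "finite S" "\<And>q. q \<in> S \<Longrightarrow> prime (q::nat)" "\<And>q. q \<in> S \<Longrightarrow> q dvd N"
  shows "\<Prod>S dvd N"
  using assms
proof (induction S rule: finite_induct)
  case (insert q S)
  have "coprime q (\<Prod>S)"
    using insert by (intro prod_coprime_right) (metis insert_iff primes_coprime)
  moreover have "q dvd N" "\<Prod>S dvd N" using insert by auto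
  ultimately have "q * \<Prod>S dvd N" by (rule divides_mult[rotated 2])
  thus ?case using insert by simp
qed simp

text \<open>Erdos' argument: for \<open>n = 2 m + 1\<close> all primes in \<open>(m + 1, n]\<close>
  divide \<open>n choose m\<close>, which is at most \<open>4^m\<close> since it occurs twice in a
  row of sum \<open>2 * 4^m\<close>. An even \<open>n > 2\<close> contributes no prime.\<close>

lemma primorial_le: "(\<Prod>q | prime q \<and> q \<le> n. q) \<le> (4::nat) ^ n"
proof (induction n rule: less_induct)
  case (less n)
  consider "n \<le> 2" | "n > 2" "even n" | "n > 2" "odd n" by linarith
  thus ?case
  proof cases
    case 1
    have "{q::nat. prime q \<and> q \<le> n} \<subseteq> {2}"
    proof
      fix q assume "q \<in> {q::nat. prime q \<and> q \<le> n}"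
      thus "q \<in> {2}" using prime_ge_2_nat[of q] 1 by auto
    qed
    moreover have "{q::nat. prime q \<and> q \<le> n} = {} \<or> n = 2"
      using 1 by (auto dest: prime_ge_2_nat)
    ultimately consider "{q::nat. prime q \<and> q \<le> n} = {}" | "n = 2" "{q::nat. prime q \<and> q \<le> n} = {2}"
      by blast
    thus ?thesis
    proof cases
      case 1
      show ?thesis unfolding 1 by simp
    next
      case 2
      show ?thesis unfolding 2(2) unfolding 2(1) by simp
    qed
  next
    case 2
    have "\<not> prime n" using 2 by (metis prime_odd_nat)
    have "{q. prime q \<and> q \<le> n} = {q. prime q \<and> q \<le> n - 1}"
    proof (rule Collect_cong, rule conj_cong[OF refl])
      fix q :: nat assume "prime q"
      hence "q \<noteq> n" using \<open>\<not> prime n\<close> by blast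
      thus "q \<le> n \<longleftrightarrow> q \<le> n - 1" using 2(1) by linarith
    qed
    hence "(\<Prod>q | prime q \<and> q \<le> n. q) \<le> 4 ^ (n - 1)" using less.IH[of "n - 1"] 2 by simp
    also have "\<dots> \<le> 4 ^ n" by (intro power_increasing) auto
    finally show ?thesis .
  next
    case 3
    then obtain m where m: "n = 2 * m + 1" by (elim oddE)
    let ?S = "{q. prime q \<and> m + 1 < q \<and> q \<le> n}"
    have finS: "finite ?S" by (rule finite_subset[of _ "{..n}"]) auto
    have "{q. prime q \<and> q \<le> n} = {q. prime q \<and> q \<le> m + 1} \<union> ?S" using m by auto
    moreover have "finite {q. prime q \<and> q \<le> m + 1}" by (rule finite_subset[of _ "{..m + 1}"]) auto
    ultimately have eq: "(\<Prod>q | prime q \<and> q \<le> n. q) = (\<Prod>q | prime q \<and> q \<le> m + 1. q) * \<Prod>?S"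
      using finS by (simp add: prod.union_disjoint Int_def)
    have "\<Prod>?S dvd n choose m"
    proof (rule prod_primes_dvd[OF finS])
      fix q assume q: "q \<in> ?S"
      have "fact m * fact (n - m) * (n choose m) = (fact n :: nat)" using m by (intro binomial_fact_lemma) auto
      moreover have "q dvd (fact n :: nat)" using q by (auto simp: prime_dvd_fact_iff)
      ultimately have d: "q dvd fact m * fact (n - m) * (n choose m)" by simp
      have qp: "prime q" using q by simp
      have nd: "\<not> q dvd (fact j :: nat)" if "j < q" for j
        using qp that prime_dvd_fact_iff[of q j] by auto
      have "\<not> q dvd (fact m :: nat)" "\<not> q dvd (fact (n - m) :: nat)"
        by (rule nd, use q m in simp)+
      thus "q dvd n choose m" using d prime_dvd_mult_iff[OF qp] by blast
    qed auto
    moreover have "n choose m > 0" using m by (intro zero_less_binomial) auto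
    ultimately have S: "\<Prod>?S \<le> n choose m" by (rule dvd_imp_le)
    have "2 * (n choose m) = (n choose m) + (n choose Suc m)"
      using binomial_symmetric[of m n] m by simp
    also have "\<dots> = (\<Sum>k\<in>{m, Suc m}. n choose k)" by simp
    also have "\<dots> \<le> (\<Sum>k\<le>n. n choose k)" using m by (intro sum_mono2) auto
    also have "\<dots> = 2 * 4 ^ m" unfolding choose_row_sum m by (simp add: power_mult)
    finally have "\<Prod>?S \<le> 4 ^ m" using S by simp
    moreover have "(\<Prod>q | prime q \<and> q \<le> m + 1. q) \<le> 4 ^ (m + 1)" using 3 m by (intro less.IH) auto
    ultimately have "(\<Prod>q | prime q \<and> q \<le> n. q) \<le> 4 ^ (m + 1) * 4 ^ m" unfolding eq by (rule mult_le_mono[rotated])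
    also have "\<dots> = 4 ^ n" unfolding m by (simp flip: power_add add: mult_2)
    finally show ?thesis .
  qed
qed

lemma finite_primes_le: "finite {q::nat. prime q \<and> q \<le> n}"
  by (rule finite_subset[of _ "{..n}"]) auto

lemma sum_ln_primes_le: "(\<Sum>q | prime q \<and> q \<le> n. ln (real q)) \<le> real n * ln 4"
proof -
  have "(\<Sum>q | prime q \<and> q \<le> n. ln (real q)) = ln (\<Prod>q | prime q \<and> q \<le> n. real q)"
    using finite_primes_le by (subst ln_prod) (auto dest: prime_gt_0_nat)
  also have "(\<Prod>q | prime q \<and> q \<le> n. real q) = real (\<Prod>q | prime q \<and> q \<le> n. q)" by simp
  also have "ln \<dots> \<le> ln (real (4 ^ n))"
  proof (subst ln_le_cancel_iff)
    show "0 < real (\<Prod>q | prime q \<and> q \<le> n. q)" by (auto intro!: prod_pos dest: prime_gt_0_nat)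
    show "real (\<Prod>q | prime q \<and> q \<le> n. q) \<le> real (4 ^ n)" using primorial_le[of n] by (rule of_nat_mono)
  qed simp
  also have "\<dots> = real n * ln 4" by (simp add: ln_realpow)
  finally show ?thesis .
qed

section \<open>Factorisation of factorials and Mertens' first theorem\<close>

lemma ln_eq_sum_multiplicity:
  assumes "k \<ge> 1" "k \<le> n"
  shows "ln (real k) = (\<Sum>q | prime q \<and> q \<le> n. real (multiplicity q k) * ln (real q))"
proof -
  have "k = (\<Prod>q\<in>prime_factors k. q ^ multiplicity q k)"
    using assms by (intro prime_factorization_nat) auto
  hence "ln (real k) = ln (\<Prod>q\<in>prime_factors k. real q ^ multiplicity q k)"
    by (metis (no_types, lifting) of_nat_power of_nat_prod prod.cong)
  also have "\<dots> = (\<Sum>q\<in>prime_factors k. ln (real q ^ multiplicity q k))"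
    by (subst ln_prod) (auto dest: in_prime_factors_imp_prime prime_gt_0_nat)
  also have "\<dots> = (\<Sum>q\<in>prime_factors k. real (multiplicity q k) * ln (real q))"
    by (intro sum.cong refl ln_realpow)
  also have "\<dots> = (\<Sum>q | prime q \<and> q \<le> n. real (multiplicity q k) * ln (real q))"
  proof (rule sum.mono_neutral_left[OF finite_primes_le])
    show "prime_factors k \<subseteq> {q. prime q \<and> q \<le> n}"
      using assms by (auto simp: prime_factors_dvd dest: dvd_imp_le)
    show "\<forall>q\<in>{q. prime q \<and> q \<le> n} - prime_factors k. real (multiplicity q k) * ln (real q) = 0"
      using assms by (auto simp: prime_factors_dvd not_dvd_imp_multiplicity_0)
  qed
  finally show ?thesis .
qed

lemma card_multiples: "q > 0 \<Longrightarrow> card {k \<in> {1..n}. q dvd k} = n div (q::nat)"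
proof -
  assume q: "q > 0"
  have "{k \<in> {1..n}. q dvd k} = (\<lambda>j. q * j) ` {1..n div q}"
  proof (intro equalityI subsetI)
    fix k assume "k \<in> {k \<in> {1..n}. q dvd k}"
    then obtain j where "k = q * j" "1 \<le> k" "k \<le> n" by (auto elim!: dvdE)
    thus "k \<in> (\<lambda>j. q * j) ` {1..n div q}" using q
      by (intro image_eqI[of _ _ j]) (auto simp: less_eq_div_iff_mult_less_eq mult.commute Suc_le_eq)
  next
    fix k assume "k \<in> (\<lambda>j. q * j) ` {1..n div q}"
    thus "k \<in> {k \<in> {1..n}. q dvd k}" using q
      by (auto simp: less_eq_div_iff_mult_less_eq mult.commute Suc_le_eq)
  qed
  moreover have "inj_on (\<lambda>j. q * j) {1..n div q}" using q by (auto simp: inj_on_def)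
  ultimately show ?thesis by (simp add: card_image)
qed

lemma prime_power_dvd_iff_le_multiplicity:
  assumes "prime (q::nat)" "k \<ge> 1"
  shows "q ^ j dvd k \<longleftrightarrow> j \<le> multiplicity q k"
proof (rule power_dvd_iff_le_multiplicity)
  show "k \<noteq> 0" using assms(2) by simp
  show "\<not> is_unit q" using prime_gt_1_nat[OF assms(1)] by simp
qed

lemma sum_multiplicity_ge:
  assumes "prime (q::nat)"
  shows "real n / real q - 1 \<le> (\<Sum>k\<in>{1..n}. real (multiplicity q k))"
proof -
  have q0: "q > 0" using assms by (rule prime_gt_0_nat)
  have "n < q * (n div q + 1)" using dividend_less_times_div[OF q0, of n] by simp
  hence "real n < real (q * (n div q + 1))" by (simp only: of_nat_less_iff)
  hence "real n / real q - 1 \<le> real (n div q)" using q0 by (simp add: field_simps)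
  also have "n div q = card {k \<in> {1..n}. q dvd k}" using card_multiples[of q n] prime_gt_0_nat[OF assms] by simp
  also have "real \<dots> = (\<Sum>k\<in>{1..n}. if q dvd k then 1 else 0)" by (simp add: sum.inter_filter flip: sum.inter_filter)
  also have "\<dots> \<le> (\<Sum>k\<in>{1..n}. real (multiplicity q k))"
  proof (rule sum_mono)
    fix k assume "k \<in> {1..n}"
    hence "q dvd k \<longleftrightarrow> 1 \<le> multiplicity q k"
      using prime_power_dvd_iff_le_multiplicity[OF assms, of k 1] by simp
    thus "(if q dvd k then 1 else 0) \<le> real (multiplicity q k)" by auto
  qed
  finally show ?thesis .
qed

text \<open>A multiplicity counts the powers \<open>q^j\<close> dividing \<open>k\<close>. After
  exchanging the sums, the multiples of \<open>q^j\<close> number at most \<open>n / q^j\<close>,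
  and the geometric series is below \<open>1 / (q - 1)\<close>.\<close>

lemma sum_multiplicity_le:
  assumes q: "prime (q::nat)"
  shows "(\<Sum>k\<in>{1..n}. real (multiplicity q k)) \<le> real n / (real q - 1)"
proof -
  have q1: "real q > 1" using prime_gt_1_nat[OF q] by simp
  have "multiplicity q k = card {j \<in> {1..n}. q ^ j dvd k}" if k: "k \<in> {1..n}" for k
  proof -
    have "q ^ multiplicity q k dvd k" by (rule multiplicity_dvd)
    hence "q ^ multiplicity q k \<le> k" using k by (intro dvd_imp_le) auto
    moreover have "multiplicity q k < q ^ multiplicity q k" using prime_gt_1_nat[OF q] by (simp add: power_gt_expt)
    ultimately have le: "multiplicity q k \<le> n" using k by simp
    have iff: "q ^ j dvd k \<longleftrightarrow> j \<le> multiplicity q k" for j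
      using k by (intro prime_power_dvd_iff_le_multiplicity q) auto
    have "{j \<in> {1..n}. q ^ j dvd k} = {1..multiplicity q k}" unfolding iff using le by auto
    thus ?thesis by simp
  qed
  hence "(\<Sum>k\<in>{1..n}. real (multiplicity q k)) = (\<Sum>k\<in>{1..n}. \<Sum>j\<in>{1..n}. if q ^ j dvd k then 1 else 0)"
    by (intro sum.cong refl) (simp flip: sum.inter_filter)
  also have "\<dots> = (\<Sum>j\<in>{1..n}. \<Sum>k\<in>{1..n}. if q ^ j dvd k then 1 else 0)" by (rule sum.swap)
  also have "\<dots> = (\<Sum>j\<in>{1..n}. real (n div q ^ j))"
    using card_multiples[of "q ^ _" n] prime_gt_0_nat[OF q]
    by (intro sum.cong refl) (simp flip: sum.inter_filter)
  also have "\<dots> \<le> (\<Sum>j\<in>{1..n}. real n / real q ^ j)"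
    by (intro sum_mono) (metis of_nat_div_le_of_nat of_nat_power)
  also have "\<dots> = real n * (\<Sum>j\<in>{1..n}. 1 / real q ^ j)" by (simp add: sum_distrib_left)
  also have "(\<Sum>j\<in>{1..m}. 1 / real q ^ j) = (1 - 1 / real q ^ m) / (real q - 1)" for m
  proof (induction m)
    case (Suc m)
    hence "(\<Sum>j\<in>{1..Suc m}. 1 / real q ^ j) = (1 - 1 / real q ^ m) / (real q - 1) + 1 / real q ^ Suc m" by simp
    also have "\<dots> = (1 - 1 / real q ^ Suc m) / (real q - 1)" using q1 by (simp add: field_simps)
    finally show ?case .
  qed simp
  also have "real n * ((1 - 1 / real q ^ n) / (real q - 1)) \<le> real n * (1 / (real q - 1))"
    using q1 by (intro mult_left_mono divide_right_mono) auto
  finally show ?thesis by simp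
qed

lemma sum_ln_ge: "real n * ln (real n) - real n \<le> (\<Sum>k\<in>{1..n}. ln (real k))"
proof (induction n)
  case (Suc n)
  show ?case
  proof (cases "n = 0")
    case False
    have "ln (real (Suc n) / real n) \<le> real (Suc n) / real n - 1" using False by (intro ln_le_minus_one) auto
    also have "\<dots> = 1 / real n" using False by (simp add: field_simps)
    finally have "real n * (ln (real (Suc n)) - ln (real n)) \<le> real n * (1 / real n)"
      using False by (intro mult_left_mono) (auto simp: ln_div)
    also have "\<dots> = 1" using False by simp
    finally show ?thesis using Suc.IH by (simp add: algebra_simps)
  qed simp
qed simp

lemma sum_ln_le: "(\<Sum>k\<in>{1..n}. ln (real k)) \<le> real n * ln (real n)"
proof -
  have "(\<Sum>k\<in>{1..n}. ln (real k)) \<le> (\<Sum>k\<in>{1..n}. ln (real n))" by (intro sum_mono) simp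
  thus ?thesis by simp
qed

lemma sum_ln_eq_sum_primes:
  "(\<Sum>k\<in>{1..n}. ln (real k)) = (\<Sum>q | prime q \<and> q \<le> n. ln (real q) * (\<Sum>k\<in>{1..n}. real (multiplicity q k)))"
proof -
  have "(\<Sum>k\<in>{1..n}. ln (real k)) = (\<Sum>k\<in>{1..n}. \<Sum>q | prime q \<and> q \<le> n. real (multiplicity q k) * ln (real q))"
    by (intro sum.cong refl ln_eq_sum_multiplicity) auto
  also have "\<dots> = (\<Sum>q | prime q \<and> q \<le> n. \<Sum>k\<in>{1..n}. real (multiplicity q k) * ln (real q))" by (rule sum.swap)
  finally show ?thesis by (simp add: sum_distrib_left mult.commute)
qed

lemma ln_4_le_2: "ln (4::real) \<le> 2"
proof -
  have "ln (4::real) = 2 * ln 2" using ln_realpow[of 2 2] by simp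
  thus ?thesis using ln_le_minus_one[of 2] by simp
qed

text \<open>The factorisation of \<open>n!\<close> is compared with
  \<open>ln (n!) \<le> n ln n\<close>. Bounding each multiplicity below by \<open>n / q - 1\<close>
  costs Chebyshev's sum of \<open>ln q\<close>, at most \<open>n ln 4\<close>.\<close>

lemma mertens_upper:
  assumes n: "n \<ge> 1"
  shows "(\<Sum>q | prime q \<and> q \<le> n. ln (real q) / real q) \<le> ln (real n) + 2"
proof -
  have n0: "real n > 0" using n by simp
  have "(\<Sum>q | prime q \<and> q \<le> n. ln (real q) * (real n / real q - 1)) \<le> (\<Sum>k\<in>{1..n}. ln (real k))"
    unfolding sum_ln_eq_sum_primes
    by (intro sum_mono mult_left_mono sum_multiplicity_ge) (auto dest: prime_gt_0_nat)
  also have "\<dots> \<le> real n * ln (real n)" by (rule sum_ln_le)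
  also have "(\<Sum>q | prime q \<and> q \<le> n. ln (real q) * (real n / real q - 1))
      = real n * (\<Sum>q | prime q \<and> q \<le> n. ln (real q) / real q) - (\<Sum>q | prime q \<and> q \<le> n. ln (real q))"
    by (simp add: sum_distrib_left right_diff_distrib sum_subtractf mult_ac)
  finally have "real n * (\<Sum>q | prime q \<and> q \<le> n. ln (real q) / real q) \<le> real n * ln (real n) + real n * ln 4"
    using sum_ln_primes_le[of n] by linarith
  also have "\<dots> = real n * (ln (real n) + ln 4)" by (simp add: algebra_simps)
  finally have "(\<Sum>q | prime q \<and> q \<le> n. ln (real q) / real q) \<le> ln (real n) + ln 4"
    using n0 by (simp only: mult_le_cancel_left_pos)
  thus ?thesis using ln_4_le_2 by linarith
qed

lemma sum_ln_over_pronic_le: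
  "(\<Sum>k\<in>{2..n}. ln (real k) / (real k * (real k - 1))) \<le> 2"
proof -
  \<comment> \<open>A telescoping majorant makes the induction work: from \<open>n\<close> to
    \<open>n + 1\<close> the quantity \<open>(ln n + 2) / n\<close> drops by at least the new
    term.\<close>
  have "(\<Sum>k\<in>{2..n}. ln (real k) / (real k * (real k - 1))) \<le> 2 - (ln (real n) + 2) / real n" if "n \<ge> 1" for n
    using that
  proof (induction n rule: dec_induct)
    case (step n)
    have n: "real n \<ge> 1" using step by simp
    have "ln (real (Suc n) / real n) \<le> real (Suc n) / real n - 1" using n by (intro ln_le_minus_one) auto
    also have "\<dots> = 1 / real n" using n by (simp add: field_simps)
    finally have "ln (real (Suc n)) - ln (real n) \<le> 1 / real n" using n by (simp add: ln_div)
    hence "real (Suc n) * (ln (real (Suc n)) - ln (real n)) \<le> real (Suc n) * (1 / real n)"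
      by (intro mult_left_mono) auto
    also have "\<dots> \<le> 2" using n by (simp add: field_simps)
    finally have c: "real (Suc n) * (ln (real (Suc n)) - ln (real n)) \<le> 2" .
    have "ln (real (Suc n)) / (real (Suc n) * real n) \<le> (ln (real n) + 2) / real n - (ln (real (Suc n)) + 2) / real (Suc n)"
    proof -
      have "(ln (real n) + 2) / real n - (ln (real (Suc n)) + 2) / real (Suc n) - ln (real (Suc n)) / (real (Suc n) * real n)
          = (2 - real (Suc n) * (ln (real (Suc n)) - ln (real n))) / (real (Suc n) * real n)"
        using n by (simp add: divide_simps) (simp add: algebra_simps)
      also have "\<dots> \<ge> 0" using n c by (intro divide_nonneg_nonneg) auto
      finally show ?thesis by simp
    qed
    moreover have "{2..Suc n} = insert (Suc n) {2..n}" using step by auto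
    ultimately show ?case using step.IH by simp
  qed simp
  from this[of n] show ?thesis
  proof (cases "n \<ge> 1")
    case True
    have "(ln (real n) + 2) / real n \<ge> 0" using True by (intro divide_nonneg_nonneg add_nonneg_nonneg ln_ge_zero) auto
    thus ?thesis using True \<open>n \<ge> 1 \<Longrightarrow> _\<close> by linarith
  next
    case False
    thus ?thesis by simp
  qed
qed

text \<open>Of the 3, one unit comes from \<open>ln (n!) \<ge> n ln n - n\<close> and two from
  replacing \<open>1 / (q - 1)\<close> by \<open>1 / q\<close>, that is, from higher prime
  powers.\<close>

lemma mertens_lower:
  assumes n: "n \<ge> 1"
  shows "ln (real n) - 3 \<le> (\<Sum>q | prime q \<and> q \<le> n. ln (real q) / real q)"
proof -
  have n0: "real n > 0" using n by simp
  have "real n * (ln (real n) - 1) \<le> (\<Sum>k\<in>{1..n}. ln (real k))"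
    using sum_ln_ge[of n] by (simp add: algebra_simps)
  also have "\<dots> \<le> (\<Sum>q | prime q \<and> q \<le> n. ln (real q) * (real n / (real q - 1)))"
    unfolding sum_ln_eq_sum_primes
    by (intro sum_mono mult_left_mono sum_multiplicity_le) (auto dest: prime_gt_0_nat)
  also have "\<dots> = real n * (\<Sum>q | prime q \<and> q \<le> n. ln (real q) / (real q - 1))"
    by (simp add: sum_distrib_left mult_ac)
  finally have "ln (real n) - 1 \<le> (\<Sum>q | prime q \<and> q \<le> n. ln (real q) / (real q - 1))"
    using n0 by (simp only: mult_le_cancel_left_pos)
  also have "\<dots> = (\<Sum>q | prime q \<and> q \<le> n. ln (real q) / real q + ln (real q) / (real q * (real q - 1)))"
  proof (rule sum.cong[OF refl])
    fix q assume "q \<in> {q. prime q \<and> q \<le> n}"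
    hence "real q > 1" using prime_gt_1_nat[of q] by simp
    thus "ln (real q) / (real q - 1) = ln (real q) / real q + ln (real q) / (real q * (real q - 1))"
      by (simp add: divide_simps) (simp add: algebra_simps)
  qed
  also have "\<dots> = (\<Sum>q | prime q \<and> q \<le> n. ln (real q) / real q) + (\<Sum>q | prime q \<and> q \<le> n. ln (real q) / (real q * (real q - 1)))"
    by (rule sum.distrib)
  also have "(\<Sum>q | prime q \<and> q \<le> n. ln (real q) / (real q * (real q - 1))) \<le> (\<Sum>k\<in>{2..n}. ln (real k) / (real k * (real k - 1)))"
    by (rule sum_mono2) (auto dest: prime_ge_2_nat)
  also have "\<dots> \<le> 2" by (rule sum_ln_over_pronic_le)
  finally show ?thesis by simp
qed

section \<open>Partial summation and reciprocals of primes\<close>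

lemma abel_summation_le:
  fixes c w :: "nat \<Rightarrow> real"
  assumes xy: "x \<le> y" and part: "\<And>m. x \<le> m \<Longrightarrow> (\<Sum>n\<in>{x<..m}. c n) \<le> K"
    and dec: "\<And>n. x \<le> n \<Longrightarrow> w (Suc n) \<le> w n" and nn: "\<And>n. x \<le> n \<Longrightarrow> 0 \<le> w n"
  shows "(\<Sum>n\<in>{x<..y}. c n * w n) \<le> K * w x"
proof -
  have "(\<Sum>n\<in>{x<..y}. c n * w n) \<le> K * (w x - w y) + (\<Sum>n\<in>{x<..y}. c n) * w y"
    using xy
  proof (induction y rule: dec_induct)
    case (step y)
    have i: "{x<..Suc y} = insert (Suc y) {x<..y}" using step by auto
    have "0 \<le> (K - (\<Sum>n\<in>{x<..y}. c n)) * (w y - w (Suc y))"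
      using part[of y] dec[of y] step by (intro mult_nonneg_nonneg) auto
    thus ?case using step.IH unfolding i by (simp add: algebra_simps)
  qed simp
  also have "\<dots> \<le> K * (w x - w y) + K * w y"
    using part[OF xy] nn[OF xy] by (intro add_left_mono mult_right_mono) auto
  finally show ?thesis by (simp add: algebra_simps)
qed

text \<open>The prime weights \<open>ln q / q\<close> are compared with the increments of
  \<open>ln\<close>. Partial sums of the difference are at most \<open>2 + 3 = 5\<close> by the two
  Mertens estimates, and Abel summation against \<open>1 / ln n\<close> gives the error. The
  increments themselves, divided by \<open>ln n\<close>, telescope below \<open>ln (ln n)\<close>
  because \<open>ln\<close> is concave.\<close>

lemma sum_reciprocal_primes_le:
  assumes x: "x \<ge> 2" and xy: "x \<le> y"
  shows "(\<Sum>q | prime q \<and> x < q \<and> q \<le> y. 1 / real q) \<le> ln (ln (real y) / ln (real x)) + 5 / ln (real x)"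
proof -
  define a where "a = (\<lambda>n::nat. if prime n then ln (real n) / real n else 0)"
  define b where "b = (\<lambda>n::nat. ln (real n) - ln (real (n - 1)))"
  define w where "w = (\<lambda>n::nat. 1 / ln (real n))"
  have ln0: "ln (real n) > 0" if "x \<le> n" for n using that x by (intro ln_gt_zero) auto
  have sb: "(\<Sum>n\<in>{x<..m}. b n) = ln (real m) - ln (real x)" if "x \<le> m" for m
    using that
  proof (induction m rule: dec_induct)
    case (step m)
    have "{x<..Suc m} = insert (Suc m) {x<..m}" using step by auto
    thus ?case using step by (simp add: b_def)
  qed simp
  have sa: "(\<Sum>n\<in>{x<..m}. a n) = (\<Sum>q | prime q \<and> q \<le> m. ln (real q) / real q) - (\<Sum>q | prime q \<and> q \<le> x. ln (real q) / real q)"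
    if "x \<le> m" for m
  proof -
    have "(\<Sum>n\<in>{x<..m}. a n) = (\<Sum>q\<in>{q \<in> {x<..m}. prime q}. ln (real q) / real q)"
      unfolding a_def by (simp flip: sum.inter_filter)
    also have "{q \<in> {x<..m}. prime q} = {q. prime q \<and> q \<le> m} - {q. prime q \<and> q \<le> x}" by auto
    also have "(\<Sum>q\<in>\<dots>. ln (real q) / real q) = (\<Sum>q | prime q \<and> q \<le> m. ln (real q) / real q) - (\<Sum>q | prime q \<and> q \<le> x. ln (real q) / real q)"
      using that by (intro sum_diff finite_primes_le) auto
    finally show ?thesis .
  qed
  have 1: "(\<Sum>n\<in>{x<..y}. (a n - b n) * w n) \<le> 5 * w x"
  proof (rule abel_summation_le[OF xy])
    fix m assume m: "x \<le> m"
    show "(\<Sum>n\<in>{x<..m}. a n - b n) \<le> 5"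
      unfolding sum_subtractf sb[OF m] sa[OF m]
      using mertens_upper[of m] mertens_lower[of x] m x by simp
    show "0 \<le> w m" using ln0[OF m] by (simp add: w_def)
    show "w (Suc m) \<le> w m" unfolding w_def using ln0[OF m] ln0[of "Suc m"] m x by (intro divide_left_mono) auto
  qed
  have 2: "(\<Sum>n\<in>{x<..y}. b n * w n) \<le> ln (ln (real y)) - ln (ln (real x))"
    using xy
  proof (induction y rule: dec_induct)
    case (step m)
    have i: "{x<..Suc m} = insert (Suc m) {x<..m}" using step by auto
    define u v where "u = ln (real (Suc m))" and "v = ln (real m)"
    have uv: "u > 0" "v > 0" using ln0[of m] ln0[of "Suc m"] step by (auto simp: u_def v_def)
    have "ln (v / u) \<le> v / u - 1" using uv by (intro ln_le_minus_one) auto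
    hence "(u - v) / u \<le> ln u - ln v" using uv by (simp add: ln_div diff_divide_distrib)
    hence "b (Suc m) * w (Suc m) \<le> ln (ln (real (Suc m))) - ln (ln (real m))"
      by (simp add: b_def w_def u_def v_def)
    thus ?case unfolding i using step.IH by simp
  qed simp
  have "(\<Sum>q | prime q \<and> x < q \<and> q \<le> y. 1 / real q) = (\<Sum>n\<in>{x<..y}. a n * w n)"
  proof -
    have "(\<Sum>n\<in>{x<..y}. a n * w n) = (\<Sum>n\<in>{x<..y}. if prime n then 1 / real n else 0)"
      using ln0 by (intro sum.cong refl) (auto simp: a_def w_def order.strict_implies_order less_imp_neq)
    also have "\<dots> = (\<Sum>q\<in>{q \<in> {x<..y}. prime q}. 1 / real q)" by (simp flip: sum.inter_filter)
    also have "{q \<in> {x<..y}. prime q} = {q. prime q \<and> x < q \<and> q \<le> y}" by auto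
    finally show ?thesis by simp
  qed
  also have "\<dots> = (\<Sum>n\<in>{x<..y}. (a n - b n) * w n) + (\<Sum>n\<in>{x<..y}. b n * w n)"
    by (simp add: sum.distrib[symmetric] algebra_simps)
  finally show ?thesis using 1 2 ln0[OF xy] ln0[of x] by (simp add: w_def ln_div)
qed


section \<open>Counting nonresidues\<close>

text \<open>Since the symbols of \<open>q\<close> and \<open>m\<close> multiply to -1, neither is 0
  and one of them is -1: either \<open>q\<close> serves or the descent continues with
  \<open>m\<close>.\<close>

lemma nonresidue_has_prime_nonresidue_divisor:
  assumes p: "prime (p::nat)" "odd p"
  shows "n > 0 \<Longrightarrow> Legendre (int n) (int p) = -1 \<Longrightarrow> \<exists>q. prime q \<and> q dvd n \<and> Legendre (int q) (int p) = -1"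
proof (induction n rule: less_induct)
  case (less n)
  have "n \<noteq> 1" using less.prems Legendre_1[OF p(1)] by auto
  then obtain q where q: "prime q" "q dvd n" using prime_factor_nat by blast
  then obtain m where m: "n = q * m" by (elim dvdE)
  have mult: "Legendre (int q) (int p) * Legendre (int m) (int p) = -1"
    using less.prems(2) unfolding m by (simp add: Legendre_mult[OF p])
  show ?case
  proof (cases "Legendre (int q) (int p) = -1")
    case False
    hence "Legendre (int m) (int p) = -1" using mult Legendre_values[of "int q" "int p"] by auto
    moreover have "m > 0" "m < n" using less.prems(1) m prime_gt_1_nat[OF q(1)] by (auto intro: Nat.gr0I)
    ultimately show ?thesis using less.IH[of m] m by auto
  qed (use q in blast)
qed

text \<open>Below \<open>p\<close> the value 0 does not occur, so the symbol is 1 minus twice the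
  indicator of the nonresidues.\<close>

lemma card_nonresidues_eq:
  assumes "N < p"
  shows "real (card {n \<in> {1..N}. Legendre (int n) (int p) = -1})
    = (real N - real_of_int (\<Sum>n\<in>{1..N}. Legendre (int n) (int p))) / 2"
proof -
  have "Legendre (int n) (int p) = 1 - 2 * (if Legendre (int n) (int p) = -1 then 1 else 0)" if "n \<in> {1..N}" for n
  proof -
    have "\<not> p dvd n" using that assms by (auto dest: dvd_imp_le)
    thus ?thesis using Legendre_values[of "int n" "int p"] Legendre_eq_0_iff[of "int n" "int p"] by auto
  qed
  hence "(\<Sum>n\<in>{1..N}. Legendre (int n) (int p)) = (\<Sum>n\<in>{1..N}. 1 - 2 * (if Legendre (int n) (int p) = -1 then 1 else 0))"
    by (rule sum.cong[OF refl])
  also have "\<dots> = int N - 2 * (\<Sum>n\<in>{1..N}. if Legendre (int n) (int p) = -1 then 1 else 0)"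
    unfolding sum_subtractf sum_distrib_left by simp
  also have "(\<Sum>n\<in>{1..N}. if Legendre (int n) (int p) = -1 then 1 else 0) = int (card {n \<in> {1..N}. Legendre (int n) (int p) = -1})"
    by (simp flip: sum.inter_filter)
  finally show ?thesis by simp
qed

lemma card_nonresidues_le_sum_primes:
  assumes p: "prime (p::nat)" "odd p"
  shows "real (card {n \<in> {1..N}. Legendre (int n) (int p) = -1})
    \<le> real N * (\<Sum>q | prime q \<and> q \<le> N \<and> Legendre (int q) (int p) = -1. 1 / real q)"
proof -
  define Q where "Q = {q. prime q \<and> q \<le> N \<and> Legendre (int q) (int p) = -1}"
  have finQ: "finite Q" by (rule finite_subset[of _ "{..N}"]) (auto simp: Q_def)
  have "{n \<in> {1..N}. Legendre (int n) (int p) = -1} \<subseteq> (\<Union>q\<in>Q. {n \<in> {1..N}. q dvd n})"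
  proof
    fix n assume n: "n \<in> {n \<in> {1..N}. Legendre (int n) (int p) = -1}"
    then obtain q where "prime q" "q dvd n" "Legendre (int q) (int p) = -1"
      using nonresidue_has_prime_nonresidue_divisor[OF p, of n] by auto
    moreover from this have "q \<le> N" using n by (auto dest: dvd_imp_le)
    ultimately show "n \<in> (\<Union>q\<in>Q. {n \<in> {1..N}. q dvd n})" using n by (auto simp: Q_def)
  qed
  hence "card {n \<in> {1..N}. Legendre (int n) (int p) = -1} \<le> card (\<Union>q\<in>Q. {n \<in> {1..N}. q dvd n})"
    using finQ by (intro card_mono) auto
  also have "\<dots> \<le> (\<Sum>q\<in>Q. card {n \<in> {1..N}. q dvd n})" by (rule card_UN_le[OF finQ])
  also have "\<dots> = (\<Sum>q\<in>Q. N div q)"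
    by (intro sum.cong refl card_multiples) (auto simp: Q_def prime_gt_0_nat)
  finally have "real (card {n \<in> {1..N}. Legendre (int n) (int p) = -1}) \<le> real (\<Sum>q\<in>Q. N div q)" by (rule of_nat_mono)
  also have "\<dots> = (\<Sum>q\<in>Q. real (N div q))" by simp
  also have "\<dots> \<le> (\<Sum>q\<in>Q. real N / real q)" by (intro sum_mono of_nat_div_le_of_nat)
  also have "\<dots> = real N * (\<Sum>q\<in>Q. 1 / real q)" by (simp add: sum_distrib_left)
  finally show ?thesis by (simp add: Q_def)
qed

text \<open>If \<open>q\<close> is a nonresidue, then \<open>n\<close> or \<open>q n\<close> is one for every \<open>n\<close> prime to \<open>p\<close>.\<close>

lemma div_nonresidue_le_card_nonresidues:
  assumes p: "prime (p::nat)" "odd p" and x: "x < p" and q: "Legendre (int q) (int p) = -1" "q > 0"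
  shows "x div q \<le> 2 * card {n \<in> {1..x}. Legendre (int n) (int p) = -1}"
proof -
  define R where "R = {n \<in> {1..x}. Legendre (int n) (int p) = -1}"
  define R' where "R' = {n \<in> {1..x div q}. q * n \<in> R}"
  have finR: "finite R" by (simp add: R_def)
  have "{1..x div q} \<subseteq> R \<union> R'"
  proof
    fix n assume n: "n \<in> {1..x div q}"
    hence "n * q \<le> x" using q(2) by (simp add: less_eq_div_iff_mult_less_eq)
    moreover have "n * 1 \<le> n * q" using q(2) by (intro mult_le_mono2) simp
    ultimately have le: "n \<le> x" "q * n \<le> x" by (linarith, simp only: mult.commute)
    have "\<not> p dvd n" using n le x by (auto dest: dvd_imp_le)
    hence "Legendre (int n) (int p) = -1 \<or> Legendre (int n) (int p) = 1"
      using Legendre_values[of "int n" "int p"] Legendre_eq_0_iff[of "int n" "int p"] by auto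
    thus "n \<in> R \<union> R'"
      using n le q by (auto simp: R_def R'_def Legendre_mult[OF p])
  qed
  moreover have "finite R'" by (simp add: R'_def)
  ultimately have "card {1..x div q} \<le> card (R \<union> R')" using finR by (intro card_mono) auto
  also have "\<dots> \<le> card R + card R'" by (rule card_Un_le)
  also have "card R' \<le> card R"
    using finR q(2) by (intro card_inj_on_le[of "\<lambda>n. q * n" R' R]) (auto simp: R'_def inj_on_def)
  finally show ?thesis by (simp add: R_def)
qed

section \<open>The contradiction for large primes and the uniform constant\<close>

lemma card_less_enumerate_le:
  fixes S :: "nat set"
  assumes "infinite S"
  shows "card {n \<in> S. n < enumerate S m} \<le> m"
proof -
  have "{n \<in> S. n < enumerate S m} \<subseteq> enumerate S ` {..<m}"
  proof
    fix n assume n: "n \<in> {n \<in> S. n < enumerate S m}"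
    then obtain j where j: "enumerate S j = n" using enumerate_Ex[of S n] assms by auto
    have "j < m" using n j enumerate_mono_iff[OF assms] by auto
    thus "n \<in> enumerate S ` {..<m}" using j by blast
  qed
  hence "card {n \<in> S. n < enumerate S m} \<le> card (enumerate S ` {..<m})" by (intro card_mono) auto
  also have "\<dots> \<le> m" using card_image_le[of "{..<m}" "enumerate S"] by simp
  finally show ?thesis .
qed

lemma nth_nonresidue_le_aux:
  fixes p k :: nat
  defines "L \<equiv> ln (real p)"
  defines "X \<equiv> real p powr (1 / (4 * sqrt (exp 1))) * exp (sqrt (exp (-1) * L * ln L))"
  assumes p: "prime p" "odd p" and k: "k \<ge> 1"
    and kX: "real k \<le> real p powr (1 / (8 * sqrt (exp 1))) * exp (1/2 * sqrt (exp (-1) * L * ln L) - 1/2 * ln L)"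
    and L: "L \<ge> 2000" and L1: "L \<le> exp (L / 4)" and L2: "L / 4 + sqrt (L * ln L) < L"
    and burgess: "\<bar>real_of_int (\<Sum>n\<in>{1..nat \<lfloor>burgess_length L\<rfloor>}. Legendre (int n) (int p))\<bar> \<le> 11 * burgess_length L / L"
  shows "real (nth_nonresidue p k) \<le> 2 * exp 97 * X"
proof (rule ccontr)
  assume neg: "\<not> ?thesis"
  define g where "g = sqrt (exp 1 :: real)"
  \<comment> \<open>\<open>u\<close> is \<open>ln X\<close> and \<open>g * u\<close> is
    \<open>ln h\<close>: the factor \<open>g = sqrt e\<close> cancels the \<open>exp (-1)\<close>
    under the root.\<close>
  define u where "u = L / (4 * g) + sqrt (exp (-1) * L * ln L)"
  define h where "h = burgess_length L"
  define N where "N = nat \<lfloor>h\<rfloor>"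
  define x where "x = nat \<lfloor>2 * exp 97 * X\<rfloor>"
  define NR where "NR = (\<lambda>y. {n \<in> {1..y}. Legendre (int n) (int p) = -1})"
  have p0: "real p > 0" using prime_gt_0_nat[OF p(1)] by simp
  have pL: "real p = exp L" using p0 by (simp add: L_def)
  have lnL: "ln L \<ge> 0" using L by simp
  have g2: "g * g = exp 1" by (simp add: g_def)
  have e2: "(2::real) \<le> exp 1" using exp_ge_add_one_self[of 1] by simp
  have "g \<le> 2" unfolding g_def by (rule real_le_lsqrt) (use exp_le in auto)
  have "(7/5::real) \<le> g" unfolding g_def by (rule real_le_rsqrt) (use e2 in \<open>simp add: power2_eq_square\<close>)
  have gpos: "g > 0" using \<open>7/5 \<le> g\<close> by simp
  have X: "X = exp u"
    unfolding X_def u_def g_def pL by (simp add: powr_def exp_add)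
  have sq0: "sqrt (exp (-1) * L * ln L) \<ge> 0" using L lnL by simp
  have "L / 8 \<le> L / (4 * g)" using gpos \<open>g \<le> 2\<close> L by (intro divide_left_mono) auto
  hence u8: "L / 8 \<le> u" unfolding u_def using sq0 by linarith
  have gu: "g * u = L / 4 + sqrt (L * ln L)"
  proof -
    have "g * sqrt (exp (-1) * L * ln L) = sqrt (exp 1 * (exp (-1) * L * ln L))"
      unfolding g_def by (simp only: real_sqrt_mult)
    also have "exp 1 * (exp (-1) * L * ln L) = L * ln L" by (simp add: exp_minus)
    finally show ?thesis unfolding u_def using gpos by (simp add: distrib_left)
  qed
  have h: "h = exp (g * u)" unfolding h_def burgess_length_def gu ..
  have hp: "h < real p" unfolding h gu pL using L2 by simp
  have hL: "L \<le> h"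
  proof -
    have "exp (L / 4) \<le> h" unfolding h gu using L lnL by simp
    thus ?thesis using L1 by linarith
  qed
  have h1: "h \<ge> 1" using hL L by linarith
  note N = nat_floor_bounds[OF h1, folded N_def]
  have u_le: "u \<le> g * u" using \<open>7/5 \<le> g\<close> u8 L by (simp add: mult_le_cancel_right1)
  hence uL: "u \<le> L" using gu L2 by linarith
  \<comment> \<open>\<open>L \<ge> 2000\<close> gives \<open>u \<ge> 250\<close>, so with
    \<open>g \<ge> 7/5\<close> the gap \<open>(g - 1) u\<close> is at least 100.\<close>
  have "98 + u \<le> g * u"
  proof -
    have "(7/5) * u \<le> g * u" using \<open>7/5 \<le> g\<close> u8 L by (intro mult_right_mono) auto
    thus ?thesis using u8 L by linarith
  qed
  hence Xh: "2 * exp 97 * X \<le> h"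
  proof -
    have "2 * exp 97 * X \<le> exp 1 * exp 97 * X" using e2 by (intro mult_right_mono) (auto simp: X)
    also have "\<dots> = exp (98 + u)" by (simp add: X flip: exp_add)
    also have "\<dots> \<le> h" unfolding h using \<open>98 + u \<le> g * u\<close> by simp
    finally show ?thesis .
  qed
  have X1: "X \<ge> 1" unfolding X using u8 L by simp
  have "1 * 1 \<le> exp 97 * X" using X1 by (intro mult_mono) auto
  hence x1: "2 * exp 97 * X \<ge> 1" by linarith
  note xb = nat_floor_bounds[OF x1, folded x_def]
  have xlow: "exp 97 * X \<le> real x" using xb(2) by simp
  have xN: "x \<le> N" unfolding x_def N_def using Xh by (intro nat_mono floor_mono)
  have Np: "N < p" using N(1) hp by linarith
  hence xp: "x < p" using xN by simp
  have x2: "x \<ge> 2"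
  proof -
    have "exp 97 \<ge> (2::real)" using exp_ge_add_one_self[of 97] by simp
    hence "2 * 1 \<le> exp 97 * X" using X1 by (intro mult_mono) auto
    thus ?thesis using xlow by linarith
  qed
  \<comment> \<open>The negated claim puts the \<open>k\<close>-th nonresidue above
    \<open>x\<close>. Its index in the enumeration is \<open>k - 1\<close>, so at most
    \<open>k - 1\<close> nonresidues are up to \<open>x\<close>.\<close>
  have cx: "card (NR x) < k"
  proof -
    have "NR x \<subseteq> {n \<in> nonresidues p. n < enumerate (nonresidues p) (k - 1)}"
    proof
      fix n assume n: "n \<in> NR x"
      hence "real n \<le> real x" by (simp add: NR_def)
      hence "real n < real (nth_nonresidue p k)" using neg xb(1) by linarith
      thus "n \<in> {n \<in> nonresidues p. n < enumerate (nonresidues p) (k - 1)}"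
        using n by (auto simp: NR_def nonresidues_def nth_nonresidue_def)
    qed
    moreover have "finite {n \<in> nonresidues p. n < enumerate (nonresidues p) (k - 1)}" by simp
    ultimately have "card (NR x) \<le> card {n \<in> nonresidues p. n < enumerate (nonresidues p) (k - 1)}"
      by (intro card_mono)
    also have "\<dots> \<le> k - 1" by (rule card_less_enumerate_le[OF infinite_nonresidues[OF p]])
    finally show ?thesis using k by linarith
  qed
  \<comment> \<open>The admissible range of \<open>k\<close> is exactly
    \<open>k \<le> sqrt (X / L)\<close>.\<close>
  have k2: "real k * real k \<le> X / L"
  proof -
    have "real k * real k \<le> (real p powr (1 / (8 * g)) * exp (1/2 * sqrt (exp (-1) * L * ln L) - 1/2 * ln L))
        * (real p powr (1 / (8 * g)) * exp (1/2 * sqrt (exp (-1) * L * ln L) - 1/2 * ln L))"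
      using kX unfolding g_def by (intro mult_mono) auto
    also have "\<dots> = exp (u - ln L)"
      unfolding pL u_def using gpos by (simp add: powr_def flip: exp_add)
    also have "\<dots> = X / L" using L by (simp add: X exp_diff)
    finally show ?thesis .
  qed
  define Q where "Q = {q. prime q \<and> q \<le> N \<and> Legendre (int q) (int p) = -1}"
  have finQ: "finite Q" by (rule finite_subset[of _ "{..N}"]) (auto simp: Q_def)
  have "(\<Sum>q\<in>Q. 1 / real q) = (\<Sum>q\<in>Q - {q \<in> Q. q \<le> x}. 1 / real q) + (\<Sum>q\<in>{q \<in> Q. q \<le> x}. 1 / real q)"
    using finQ by (intro sum.subset_diff) auto
  also have "(\<Sum>q\<in>{q \<in> Q. q \<le> x}. 1 / real q) \<le> 2 / L"
  proof -
    have "1 / real q \<le> 2 * real k / real x" if q: "q \<in> {q \<in> Q. q \<le> x}" for q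
    proof -
      have q0: "q > 0" using q by (auto simp: Q_def prime_gt_0_nat)
      have "x div q \<le> 2 * card (NR x)"
        unfolding NR_def using q q0 by (intro div_nonresidue_le_card_nonresidues[OF p xp]) (auto simp: Q_def)
      \<comment> \<open>Having at most \<open>k - 1\<close> nonresidues up to \<open>x\<close>
        leaves room for the 1 that undoes the rounding in \<open>x div q\<close>.\<close>
      hence "x div q + 1 \<le> 2 * k" using cx by linarith
      hence "q * (x div q + 1) \<le> q * (2 * k)" by (rule mult_le_mono2)
      moreover have "x < q * (x div q + 1)" using dividend_less_times_div[OF q0, of x] by simp
      ultimately have "x \<le> q * (2 * k)" by linarith
      hence "real x \<le> real (q * (2 * k))" by (rule of_nat_mono)
      thus ?thesis using q0 x2 by (simp add: field_simps)
    qed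
    hence "(\<Sum>q\<in>{q \<in> Q. q \<le> x}. 1 / real q) \<le> real (card {q \<in> Q. q \<le> x}) * (2 * real k / real x)"
      by (rule sum_bounded_above)
    also have "{q \<in> Q. q \<le> x} \<subseteq> NR x" by (auto simp: Q_def NR_def dest: prime_gt_0_nat)
    hence "card {q \<in> Q. q \<le> x} \<le> card (NR x)" by (intro card_mono) (auto simp: NR_def)
    hence "real (card {q \<in> Q. q \<le> x}) * (2 * real k / real x) \<le> real k * (2 * real k / real x)"
      using cx by (intro mult_right_mono) auto
    also have "\<dots> = 2 * (real k * real k) / real x" by simp
    also have "\<dots> \<le> 2 * (X / L) / X"
    proof (rule frac_le)
      show "0 < X" using X1 by simp
      have "1 * X \<le> exp 97 * X" using X1 by (intro mult_right_mono) auto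
      thus "X \<le> real x" using xlow by linarith
    qed (use k2 X1 L in auto)
    also have "\<dots> = 2 / L" using X1 by simp
    finally show ?thesis by simp
  qed
  also have "(\<Sum>q\<in>Q - {q \<in> Q. q \<le> x}. 1 / real q) \<le> (\<Sum>q | prime q \<and> x < q \<and> q \<le> N. 1 / real q)"
    by (rule sum_mono2) (auto simp: Q_def intro: finite_subset[of _ "{..N}"])
  also have "\<dots> \<le> ln (ln (real N) / ln (real x)) + 5 / ln (real x)"
    by (rule sum_reciprocal_primes_le[OF x2 xN])
  also have "5 / ln (real x) \<le> 40 / L"
  proof -
    have "u \<le> ln (real x)"
    proof -
      have "1 * X \<le> exp 97 * X" using X1 by (intro mult_right_mono) auto
      hence "exp u \<le> real x" using xlow X by linarith
      thus ?thesis using x2 by (simp add: ln_ge_iff)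
    qed
    hence "5 / ln (real x) \<le> 5 / (L / 8)" using u8 L by (intro divide_left_mono) auto
    thus ?thesis by simp
  qed
  \<comment> \<open>The main term is \<open>ln g = 1/2\<close>, the whole share of the nonresidues.
    The constant \<open>exp 97\<close> adds 97 to \<open>ln x\<close> and so gains
    \<open>97 / (97 + u)\<close>, at least \<open>97 / (2 L)\<close>.\<close>
  also have "ln (ln (real N) / ln (real x)) \<le> 1 / 2 - 97 / (2 * L)"
  proof -
    have "exp (97 + u) \<le> real x" using xlow by (simp add: X exp_add)
    hence lx: "97 + u \<le> ln (real x)" using x2 by (simp add: ln_ge_iff)
    have "real N \<le> exp (g * u)" using N(1) h by simp
    hence "ln (real N) \<le> ln (exp (g * u))" using N(4) by (subst ln_le_cancel_iff) auto
    hence lN: "ln (real N) \<le> g * u" by simp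
    have lN0: "ln (real N) > 0" using xN x2 by (intro ln_gt_zero) auto
    have u0: "u > 0" using u8 L by linarith
    have "ln (real N) / ln (real x) \<le> g * u / (97 + u)" using lx lN lN0 u0 by (intro frac_le) auto
    hence "ln (ln (real N) / ln (real x)) \<le> ln (g * u / (97 + u))"
      using lN0 lx u0 gpos by (subst ln_le_cancel_iff) auto
    also have "\<dots> = ln g + ln (u / (97 + u))" using gpos u0 by (simp add: ln_mult ln_div)
    also have "ln g = 1 / 2" by (simp add: g_def ln_sqrt)
    also have "ln (u / (97 + u)) \<le> u / (97 + u) - 1" using u0 by (intro ln_le_minus_one) auto
    also have "u / (97 + u) - 1 = - (97 / (97 + u))" using u0 by (simp add: field_simps)
    also have "- (97 / (97 + u)) \<le> - (97 / (2 * L))"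
      using u0 uL u8 L by (simp add: frac_le)
    finally show ?thesis by simp
  qed
  \<comment> \<open>From the gain \<open>97 / 2\<close> the errors 40 and 2 leave
    \<open>13 / 2\<close>, one more than the \<open>11 / 2\<close> lost to the character sum below.
    This fixes the 97.\<close>
  finally have sumQ: "(\<Sum>q\<in>Q. 1 / real q) \<le> 1 / 2 - 13 / (2 * L)"
    by (simp add: field_simps)
  have "real (card (NR N)) \<le> real N * (\<Sum>q\<in>Q. 1 / real q)"
    unfolding NR_def Q_def by (rule card_nonresidues_le_sum_primes[OF p])
  also have "\<dots> \<le> h * (\<Sum>q\<in>Q. 1 / real q)" using N(1) by (intro mult_right_mono sum_nonneg) auto
  also have "\<dots> \<le> h * (1 / 2 - 13 / (2 * L))" using sumQ h1 by (intro mult_left_mono) auto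
  also have "\<dots> = h / 2 - 13 / 2 * (h / L)" by (simp add: algebra_simps)
  finally have up: "real (card (NR N)) \<le> h / 2 - 13 / 2 * (h / L)" .
  have "\<bar>real_of_int (\<Sum>n\<in>{1..N}. Legendre (int n) (int p))\<bar> \<le> 11 * (h / L)"
    using burgess by (simp add: N_def h_def)
  moreover have "(h - 1 - t) / 2 \<le> (real N - s) / 2" if "\<bar>s\<bar> \<le> t" for s t
    using abs_le_D1[OF that] N(3) by (intro divide_right_mono diff_mono) auto
  ultimately have "(h - 1 - 11 * (h / L)) / 2 \<le> real (card (NR N))"
    unfolding NR_def card_nonresidues_eq[OF Np] by blast
  \<comment> \<open>The lower count is \<open>h / 2 - 1 / 2 - 11 / 2 * t\<close> with
    \<open>t = h / L\<close>, where the \<open>1 / 2\<close> stems from rounding \<open>h\<close>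
    down. Only \<open>t \<le> 1 / 2\<close> would be compatible, but
    \<open>h \<ge> L\<close>.\<close>
  moreover have "t \<le> 1 / 2" if "(h - 1 - 11 * t) / 2 \<le> c" "c \<le> h / 2 - 13 / 2 * t" for t c
    using that by argo
  ultimately have "h / L \<le> 1 / 2" using up by blast
  moreover have "1 \<le> h / L" using hL L by simp
  ultimately have "(1::real) \<le> 1 / 2" by (rule order.trans[rotated])
  thus False by simp
qed

theorem theorem1p1:
  shows "\<exists>C::real. C > 0 \<and>
    (\<forall>(p::nat) (k::nat). prime p \<longrightarrow> odd p \<longrightarrow> k \<ge> 1 \<longrightarrow>
       real k \<le> real p powr (1 / (8 * sqrt (exp 1)))
                  * exp (1/2 * sqrt (exp (-1) * ln (real p) * ln (ln (real p)))
                         - 1/2 * ln (ln (real p))) \<longrightarrow>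
       real (nth_nonresidue p k) \<le> C * real p powr (1 / (4 * sqrt (exp 1)))
                  * exp (sqrt (exp (-1) * ln (real p) * ln (ln (real p)))))"
proof -
  define bd where "bd = (\<lambda>p::nat. real p powr (1 / (8 * sqrt (exp 1)))
                  * exp (1/2 * sqrt (exp (-1) * ln (real p) * ln (ln (real p))) - 1/2 * ln (ln (real p))))"
  define X where "X = (\<lambda>p::nat. real p powr (1 / (4 * sqrt (exp 1))) * exp (sqrt (exp (-1) * ln (real p) * ln (ln (real p)))))"
  have lim: "filterlim (\<lambda>p::nat. ln (real p)) at_top sequentially" by real_asymp
  have "eventually (\<lambda>L::real. L \<ge> 2000) at_top" by real_asymp
  moreover have "eventually (\<lambda>L::real. L \<le> exp (L / 4)) at_top" by real_asymp
  moreover have "eventually (\<lambda>L::real. L / 4 + sqrt (L * ln L) < L) at_top" by real_asymp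
  ultimately have "eventually (\<lambda>L::real. L \<ge> 2000 \<and> L \<le> exp (L / 4) \<and> L / 4 + sqrt (L * ln L) < L) at_top"
    by (intro eventually_conj)
  from eventually_conj[OF eventually_compose_filterlim[OF this lim] burgess_bound]
  obtain p0 where p0: "\<And>p. p \<ge> p0 \<Longrightarrow> ln (real p) \<ge> 2000 \<and> ln (real p) \<le> exp (ln (real p) / 4)
      \<and> ln (real p) / 4 + sqrt (ln (real p) * ln (ln (real p))) < ln (real p)"
    and p0': "\<And>p. p \<ge> p0 \<Longrightarrow> prime p \<Longrightarrow> odd p \<Longrightarrow>
      \<bar>real_of_int (\<Sum>n\<in>{1..nat \<lfloor>burgess_length (ln (real p))\<rfloor>}. Legendre (int n) (int p))\<bar>
        \<le> 11 * burgess_length (ln (real p)) / ln (real p)"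
    unfolding eventually_sequentially by blast
  \<comment> \<open>Below \<open>p0\<close> only finitely many pairs \<open>(p, k)\<close> are
    admissible, because \<open>bd p\<close> bounds \<open>k\<close>; the sum of all their values
    dominates each of them.\<close>
  define M where "M = (\<Sum>p<p0. \<Sum>k\<le>nat \<lfloor>bd p\<rfloor>. real (nth_nonresidue p k))"
  define C where "C = 2 * exp 97 + M"
  have M0: "M \<ge> 0" unfolding M_def by (intro sum_nonneg) auto
  have Cpos: "C > 0" unfolding C_def using M0 by (intro add_pos_nonneg) auto
  have "real (nth_nonresidue p k) \<le> C * X p" if p: "prime p" "odd p" and k: "k \<ge> 1" "real k \<le> bd p" for p k
  proof (cases "p \<ge> p0")
    case True
    have "real (nth_nonresidue p k) \<le> 2 * exp 97 * X p"
      unfolding X_def by (rule nth_nonresidue_le_aux[OF p k(1)]) (use k p0[OF True] p0'[OF True p] in \<open>auto simp: bd_def\<close>)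
    also have "\<dots> \<le> C * X p" unfolding C_def using M0 by (intro mult_right_mono) (auto simp: X_def)
    finally show ?thesis .
  next
    case False
    have "int k \<le> \<lfloor>bd p\<rfloor>" using k(2) by (simp add: le_floor_iff)
    hence kb: "k \<le> nat \<lfloor>bd p\<rfloor>" by linarith
    have "real (nth_nonresidue p k) \<le> (\<Sum>k\<le>nat \<lfloor>bd p\<rfloor>. real (nth_nonresidue p k))"
      using kb by (intro member_le_sum) auto
    also have "\<dots> \<le> M" unfolding M_def using False
      by (intro member_le_sum[where f = "\<lambda>p. \<Sum>k\<le>nat \<lfloor>bd p\<rfloor>. real (nth_nonresidue p k)"]) (auto intro: sum_nonneg)
    also have "\<dots> \<le> C" by (simp add: C_def)
    also have "\<dots> \<le> C * X p"
    proof -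
      have p3: "real p \<ge> 3"
      proof -
        have "p \<noteq> 2" using p(2) by auto
        thus ?thesis using prime_ge_2_nat[OF p(1)] by simp
      qed
      \<comment> \<open>An odd prime exceeds \<open>e\<close>, so \<open>ln (ln p)\<close> is
        nonnegative and \<open>X p \<ge> 1\<close>. For a negative argument \<open>sqrt\<close>
        would be negative and the exponential below 1.\<close>
      have "exp 1 \<le> real p" using p3 exp_le by linarith
      hence l1: "ln (real p) \<ge> 1" using p3 by (simp add: ln_ge_iff)
      have "1 * 1 \<le> X p" unfolding X_def
      proof (rule mult_mono)
        show "1 \<le> real p powr (1 / (4 * sqrt (exp 1)))" using p3 by (intro ge_one_powr_ge_zero) auto
        show "1 \<le> exp (sqrt (exp (- 1) * ln (real p) * ln (ln (real p))))" using l1 by simp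
      qed auto
      hence "C * 1 \<le> C * X p" using Cpos by (intro mult_left_mono) auto
      thus ?thesis by simp
    qed
    finally show ?thesis .
  qed
  thus ?thesis using Cpos unfolding bd_def X_def by (intro exI[of _ C]) (auto simp: mult.assoc)
qed

end
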